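(* Let $l\in\mathbb N$ and let $a(t)=\int_0^tG(s)\,ds$, $t\in[0,1]$, be a differentiable matrix-valued function, where $G(s)\in\mathbb R^{l\times l}$ is symmetric positive definite for each $s$ and $\int_0^1G_{ii}(s)\,ds<\infty$ for $i=1,\dots,l$. Let $\mathbb Q^a:=\mathcal L\big(\int_0^\cdot G(s)^{1/2}\,dB_s\big)$, with $B$ a standard $\mathbb R^l$-valued Brownian motion started at $0$, and let $\mathbb B=\mathcal L(B)$. Then $$h_l(\mathbb Q^a|\mathbb B)=\frac12\int_0^1\big(\mathrm{tr}(G(s))-l-\log\det G(s)\big)\,ds=\sup_{n\in\mathbb N}\frac1nH(\mathbb Q^a|\mathbb B)|_{\mathcal F^n}\in[0,\infty].$$ Moreover, if this quantity is finite, then, as $n\to\infty$, $$\frac1n\log\left(\frac{d\mathbb Q^a}{d\mathbb B}\Big|_{\mathcal F^n}\right)\longrightarrow\frac12\int_0^1\big(\mathrm{tr}(G(s))-l-\log\det G(s)\big)\,ds\quad\text{in }L^1(\mathbb Q^a).$$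
   Context: $C:=C([0,1];\mathbb R^l)$ is the space of continuous paths, $X_t(\omega)=\omega(t)$ the canonical process, $\mathcal F=\sigma(X_t:t\in[0,1])$. $G(s)^{1/2}$ is the unique symmetric positive definite square root. Relative entropy: $H(\mu|\nu)=\int\log\frac{d\mu}{d\nu}\,d\mu$ if $\mu\ll\nu$, and $+\infty$ otherwise. For $n\in\mathbb N$, $\mathcal F^n:=\sigma(X_{k/n}:k=0,1,\dots,n)$; $H(\mathbb Q|\mathbb P)|_{\mathcal F^n}$ is the relative entropy between the restrictions of $\mathbb Q$ and $\mathbb P$ to $\mathcal F^n$, and $\frac{d\mathbb Q}{d\mathbb P}|_{\mathcal F^n}$ is the Radon-Nikodym density of these restrictions. For probability measures $\mathbb Q,\mathbb P$ on $(C,\mathcal F)$ under which $X$ is a martingale, $h_l(\mathbb Q|\mathbb P):=\liminf_{n\to\infty}2^{-n}H(\mathbb Q|\mathbb P)|_{\mathcal F^{2^n}}$. *)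

theory Defs
  imports "HOL-Probability.Probability"
begin

section \<open>Path space\<close>

text \<open>
  A path in \<open>C([0,1]; \<real>\<^sup>l)\<close> is a function on the reals that is continuous on \<open>[0,1]\<close> and takes the
  dummy value \<open>undefined\<close> elsewhere, so that distinct elements are distinct paths. The dimension is
  \<open>l = CARD('l)\<close>.
\<close>

definition path_space :: "(real \<Rightarrow> real ^ 'l) set" where
  "path_space = {\<omega> \<in> extensional {0..1}. continuous_on {0..1} \<omega>}"

definition coord_algebra :: "real set \<Rightarrow> (real \<Rightarrow> real ^ 'l) measure" where
  "coord_algebra T =
     sigma path_space {{\<omega> \<in> path_space. \<omega> t \<in> A} | t A. t \<in> T \<and> A \<in> sets borel}"

abbreviation path_algebra :: "(real \<Rightarrow> real ^ 'l) measure" where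
  "path_algebra \<equiv> coord_algebra {0..1}"

definition grid_algebra :: "nat \<Rightarrow> (real \<Rightarrow> real ^ 'l) measure" where
  "grid_algebra n = coord_algebra {real k / real n | k. k \<le> n}"

definition path_law :: "'w measure \<Rightarrow> (real \<Rightarrow> 'w \<Rightarrow> real ^ 'l) \<Rightarrow> (real \<Rightarrow> real ^ 'l) measure" where
  "path_law M Y = distr M path_algebra (\<lambda>w. restrict (\<lambda>t. Y t w) {0..1})"


section \<open>Relative entropy\<close>

text \<open>
  Lebesgue integral with values in \<open>[-\<infinity>,\<infinity>]\<close>. Below it is only applied to functions whose
  negative part has finite integral, so that \<open>\<infinity> - \<infinity>\<close> does not arise.
\<close>

definition ext_integral :: "'a measure \<Rightarrow> ('a \<Rightarrow> real) \<Rightarrow> ereal" where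
  "ext_integral M f =
     enn2ereal (\<integral>\<^sup>+ x. ennreal (f x) \<partial>M) - enn2ereal (\<integral>\<^sup>+ x. ennreal (- f x) \<partial>M)"

text \<open>\<open>log_density \<mu> \<nu>\<close> is \<open>log (d\<mu>/d\<nu>)\<close>; note the argument order of \<open>RN_deriv\<close>.\<close>

definition log_density :: "'a measure \<Rightarrow> 'a measure \<Rightarrow> 'a \<Rightarrow> real" where
  "log_density \<mu> \<nu> x = ln (enn2real (RN_deriv \<nu> \<mu> x))"

text \<open>
  The library's \<open>KL_divergence\<close> is real-valued and does not treat singular or infinite-entropy
  pairs. The negative part of the integrand below has integral at most \<open>1/e\<close>.
\<close>

definition rel_entropy :: "'a measure \<Rightarrow> 'a measure \<Rightarrow> ereal" where
  "rel_entropy \<mu> \<nu> =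
     (if absolutely_continuous \<nu> \<mu> then ext_integral \<mu> (log_density \<mu> \<nu>) else \<infinity>)"

definition grid_restr ::
    "nat \<Rightarrow> (real \<Rightarrow> real ^ 'l) measure \<Rightarrow> (real \<Rightarrow> real ^ 'l) measure" where
  "grid_restr n Q = restr_to_subalg Q (grid_algebra n)"

text \<open>
  The formula makes sense for arbitrary laws; it is meant for laws under which the coordinate
  process is a martingale.
\<close>

definition specific_rel_entropy ::
    "(real \<Rightarrow> real ^ 'l) measure \<Rightarrow> (real \<Rightarrow> real ^ 'l) measure \<Rightarrow> ereal" where
  "specific_rel_entropy Q P =
     liminf (\<lambda>n. ereal (1 / 2 ^ n) * rel_entropy (grid_restr (2 ^ n) Q) (grid_restr (2 ^ n) P))"


section \<open>Symmetric positive definite matrices\<close>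

definition spd :: "real ^ 'l ^ 'l \<Rightarrow> bool" where
  "spd A \<longleftrightarrow> transpose A = A \<and> (\<forall>x. x \<noteq> 0 \<longrightarrow> x \<bullet> (A *v x) > 0)"

definition spd_sqrt :: "real ^ 'l ^ 'l \<Rightarrow> real ^ 'l ^ 'l" where
  "spd_sqrt A = (THE S. spd S \<and> S ** S = A)"


section \<open>Brownian motion and the stochastic integral of a deterministic integrand\<close>

text \<open>
  Standard \<open>l\<close>-dimensional Brownian motion on \<open>[0,1]\<close>, started at \<open>0\<close>. Continuity of every path
  (not just of almost every path) makes the law on path space well defined.
\<close>

definition brownian_motion :: "'w measure \<Rightarrow> (real \<Rightarrow> 'w \<Rightarrow> real ^ 'l) \<Rightarrow> bool" where
  "brownian_motion M B \<longleftrightarrow>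
     prob_space M \<and>
     (\<forall>t\<in>{0..1}. B t \<in> borel_measurable M) \<and>
     (\<forall>w\<in>space M. B 0 w = 0) \<and>
     (\<forall>w\<in>space M. continuous_on {0..1} (\<lambda>t. B t w)) \<and>
     (\<forall>m (t :: nat \<Rightarrow> real).
        (\<forall>k\<le>m. t k \<in> {0..1}) \<and> (\<forall>k<m. t k < t (Suc k)) \<longrightarrow>
        prob_space.indep_vars M (\<lambda>_. borel) (\<lambda>k w. B (t (Suc k)) w - B (t k) w) {..<m}) \<and>
     (\<forall>s t. 0 \<le> s \<and> s < t \<and> t \<le> 1 \<longrightarrow>
        distributed M lborel (\<lambda>w. B t w - B s w)
          (\<lambda>x. ennreal (\<Prod>i\<in>UNIV. normal_density 0 (sqrt (t - s)) (x $ i))))"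

text \<open>
  The step function \<open>\<Sum>k<m. A k 1_{(t k, t (k+1)]}\<close> and its elementary stochastic integral over
  \<open>[0,r]\<close>.
\<close>

definition step_fun :: "nat \<Rightarrow> (nat \<Rightarrow> real) \<Rightarrow> (nat \<Rightarrow> real ^ 'l ^ 'l) \<Rightarrow> real \<Rightarrow> real ^ 'l ^ 'l" where
  "step_fun m t A s = (\<Sum>k<m. indicator {t k <.. t (Suc k)} s *\<^sub>R A k)"

definition step_integral ::
    "(real \<Rightarrow> 'w \<Rightarrow> real ^ 'l) \<Rightarrow> nat \<Rightarrow> (nat \<Rightarrow> real) \<Rightarrow> (nat \<Rightarrow> real ^ 'l ^ 'l) \<Rightarrow>
     real \<Rightarrow> 'w \<Rightarrow> real ^ 'l" where
  "step_integral B m t A r w =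
     (\<Sum>k<m. A k *v (B (min (t (Suc k)) r) w - B (min (t k) r) w))"

text \<open>
  \<open>Y = \<integral>\<^sub>0\<^sup>\<cdot> \<sigma>(s) dB\<^sub>s\<close> for a deterministic square-integrable \<open>\<sigma>\<close>: \<open>Y\<close> is a continuous process such
  that \<open>Y r\<close> is, for each \<open>r\<close>, the \<open>L\<^sup>2(M)\<close>-limit of the elementary integrals over \<open>[0,r]\<close> of
  step functions converging to \<open>\<sigma>\<close> in \<open>L\<^sup>2([0,1])\<close>. By the Ito isometry the limit does not depend on
  the choice of step functions, so \<open>Y\<close> is determined up to indistinguishability. The matrix norm is
  the Frobenius norm.
\<close>

definition stochastic_integral ::
    "'w measure \<Rightarrow> (real \<Rightarrow> 'w \<Rightarrow> real ^ 'l) \<Rightarrow> (real \<Rightarrow> real ^ 'l ^ 'l) \<Rightarrow>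
     (real \<Rightarrow> 'w \<Rightarrow> real ^ 'l) \<Rightarrow> bool" where
  "stochastic_integral M B \<sigma> Y \<longleftrightarrow>
     \<sigma> \<in> borel_measurable (lebesgue_on {0..1}) \<and>
     (\<integral>\<^sup>+ s. ennreal ((norm (\<sigma> s))\<^sup>2) \<partial>lebesgue_on {0..1}) < \<infinity> \<and>
     (\<forall>t\<in>{0..1}. Y t \<in> borel_measurable M) \<and>
     (\<forall>w\<in>space M. continuous_on {0..1} (\<lambda>t. Y t w)) \<and>
     (\<exists>(m :: nat \<Rightarrow> nat) (t :: nat \<Rightarrow> nat \<Rightarrow> real) (A :: nat \<Rightarrow> nat \<Rightarrow> real ^ 'l ^ 'l).
        (\<forall>n. (\<forall>k\<le>m n. t n k \<in> {0..1}) \<and> (\<forall>k<m n. t n k < t n (Suc k))) \<and>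
        (\<lambda>n. \<integral>\<^sup>+ s. ennreal ((norm (step_fun (m n) (t n) (A n) s - \<sigma> s))\<^sup>2)
               \<partial>lebesgue_on {0..1}) \<longlonglongrightarrow> 0 \<and>
        (\<forall>r\<in>{0..1}.
          (\<lambda>n. \<integral>\<^sup>+ w. ennreal ((norm (step_integral B (m n) (t n) (A n) r w - Y r w))\<^sup>2)
                 \<partial>M) \<longlonglongrightarrow> 0))"

end

theory Submission
  imports Defs
begin

text \<open>
  On the grid \<open>k/n\<close> both laws are determined by independent centred Gaussian increments, with
  covariances \<open>A\<^sub>k/n\<close> and \<open>1/n\<close>, where \<open>A\<^sub>k\<close> is the mean of \<open>G\<close> over the \<open>k\<close>-th cell. Writing
  \<open>\<phi>(A) = tr A - l - log det A\<close>, the entropy divided by \<open>n\<close> is therefore half of the average of the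
  \<open>\<phi>(A\<^sub>k)\<close>. It is at most \<open>1/2 \<integral> \<phi>(G)\<close> because \<open>\<phi>\<close> is convex (Jensen), and its lower limit is at
  least \<open>1/2 \<integral> \<phi>(G)\<close> by Lebesgue differentiation and Fatou's lemma. After diagonalising
  each \<open>A\<^sub>k\<close> the log-density is a weighted sum of independent centred chi-square variables plus the
  entropy; the variance of the sum divided by \<open>n\<close> is of order \<open>\<Sum> tr(A\<^sub>k/n)\<^sup>2 + 1/n\<close>, which tends
  to zero by uniform continuity of \<open>tr a\<close>.
\<close>

section \<open>Symmetric positive definite matrices\<close>

text \<open>The stochastic integral is known only as an L2 limit of elementary integrals, and the
  values of \<open>G\<close> at different times need not commute, so \<open>avg n k\<close> shares
  no eigenbasis with \<open>G\<close> or with its neighbours. The law of the increments is therefore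
  reached through characteristic functions: for elementary integrals the exponents are explicit and
  pass to the limit, and uniqueness for finite families of variables is built from the
  one-dimensional case. The resulting quadratic forms depend on the increments of \<open>a\<close>
  alone, so the square root of \<open>G\<close> may be exchanged for another factor of the
  covariance; a rotation after a diagonal scaling reduces all densities to products of
  one-dimensional normal ratios. Since \<phi> is nonnegative on positive definite matrices, the
  limits of entropies are taken in [0,\<infinity>] without deciding beforehand whether log det G is
  integrable. The fluctuation bound contains only traces, so finiteness of the entropy enters only
  where the limit has to be a real number.\<close>

definition diag_mat :: "('l \<Rightarrow> real) \<Rightarrow> real ^ 'l ^ 'l" where
  "diag_mat d = (\<chi> i j. if i = j then d i else 0)"

lemma diag_mat_vec: "diag_mat d *v x = (\<chi> i. d i * x $ i)"
  by (simp add: diag_mat_def matrix_vector_mult_def vec_eq_iff if_distrib [of "\<lambda>z. z * _"] cong: if_cong)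

lemma transpose_diag_mat: "transpose (diag_mat d) = diag_mat d"
  by (auto simp: diag_mat_def transpose_def vec_eq_iff)

lemma inner_matrix_vec: "x \<bullet> (A *v y) = (transpose A *v x) \<bullet> (y :: real ^ 'n)"
  by (simp add: dot_lmul_matrix)

lemma symmetric_inner:
  fixes A :: "real ^ 'l ^ 'l"
  assumes "transpose A = A"
  shows "x \<bullet> (A *v y) = (A *v x) \<bullet> y"
  by (subst inner_matrix_vec) (simp only: assms)

text \<open>A maximiser of the Rayleigh quotient on the unit sphere of \<open>S\<close> is an
  eigenvector: its residual \<open>A *v x - l *\<^sub>R x\<close> lies in \<open>S\<close> and would
  otherwise be a direction of ascent. The invariant subspace makes the lemma usable on the
  orthogonal complement of eigenvectors already found.\<close>

lemma symmetric_eigenvector_exists: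
  fixes A :: "real ^ 'l ^ 'l"
  assumes sym: "transpose A = A" and S: "subspace S" "S \<noteq> {0}"
    and inv: "\<And>x. x \<in> S \<Longrightarrow> A *v x \<in> S"
  shows "\<exists>x\<in>S. norm x = 1 \<and> A *v x = (x \<bullet> (A *v x)) *\<^sub>R x"
proof -
  let ?K = "S \<inter> sphere 0 1"
  let ?q = "\<lambda>x. x \<bullet> (A *v x)"
  have "compact ?K"
    using S(1) by (simp add: closed_subspace closed_Int_compact)
  moreover obtain z where z: "z \<in> S" "z \<noteq> 0"
    using S subspace_0 by blast
  then have "(1 / norm z) *\<^sub>R z \<in> ?K"
    using S(1) by (simp add: subspace_scale)
  then have "?K \<noteq> {}" by blast
  moreover have "continuous_on ?K ?q"
    by (intro continuous_intros linear_continuous_on matrix_vector_mul_bounded_linear)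
  ultimately obtain x where x: "x \<in> ?K" and max: "\<And>y. y \<in> ?K \<Longrightarrow> ?q y \<le> ?q x"
    using continuous_attains_sup [of ?K ?q] by metis
  define l where "l = ?q x"
  have xS: "x \<in> S" and nx: "norm x = 1" using x by auto
  then have xx: "x \<bullet> x = 1" by (simp add: norm_eq_1)
  have le: "?q y \<le> l * (y \<bullet> y)" if "y \<in> S" for y
  proof (cases "y = 0")
    case False
    let ?u = "(1 / norm y) *\<^sub>R y"
    have "?u \<in> ?K" using S(1) that False by (simp add: subspace_scale)
    from max [OF this] have "(1 / norm y)\<^sup>2 * ?q y \<le> l"
      by (simp add: matrix_vector_mult_scaleR l_def power2_eq_square)
    then show ?thesis using False
      by (simp add: field_simps power2_norm_eq_inner)
  qed simp
  define y where "y = A *v x - l *\<^sub>R x"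
  have yS: "y \<in> S" unfolding y_def using S(1) xS inv by (simp add: subspace_diff subspace_scale)
  \<comment> \<open>Perturb the maximiser along the residual \<open>y\<close>. As \<open>y\<close>
    is orthogonal to \<open>x\<close>, the expansion in \<open>t\<close> has no constant term and
    its linear coefficient is \<open>- 2 * (y \<bullet> y)\<close>, which contradicts nonnegativity
    for small positive \<open>t\<close> unless \<open>y = 0\<close>.\<close>
  have "0 \<le> l * ((x + t *\<^sub>R y) \<bullet> (x + t *\<^sub>R y)) - ?q (x + t *\<^sub>R y)" for t
    using le [of "x + t *\<^sub>R y"] S(1) xS yS by (simp add: subspace_add subspace_scale)
  moreover have "l * ((x + t *\<^sub>R y) \<bullet> (x + t *\<^sub>R y)) - ?q (x + t *\<^sub>R y)
      = - 2 * t * (y \<bullet> y) + t\<^sup>2 * (l * (y \<bullet> y) - ?q y)" for t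
  proof -
    have a: "x \<bullet> (A *v y) = (A *v x) \<bullet> y" by (rule symmetric_inner [OF sym])
    have b: "A *v x = y + l *\<^sub>R x" by (simp add: y_def)
    have c: "x \<bullet> (A *v x) = l" by (simp add: l_def)
    have d: "x \<bullet> y = 0" using c b xx by (simp add: inner_add_right)
    show ?thesis
      by (simp add: matrix_vector_right_distrib matrix_vector_mult_scaleR inner_add_left inner_add_right a c)
         (simp add: b d xx inner_add_left inner_add_right inner_commute power2_eq_square algebra_simps)
  qed
  ultimately have P: "2 * t * (y \<bullet> y) \<le> t\<^sup>2 * (l * (y \<bullet> y) - ?q y)" for t
    by (metis add.commute add_uminus_conv_diff diff_ge_0_iff_ge minus_mult_left mult_minus_left)
  have "y \<bullet> y \<le> 0"
  proof (rule ccontr)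
    assume "\<not> y \<bullet> y \<le> 0"
    then have pos: "0 < y \<bullet> y" by linarith
    \<comment> \<open>Adding 1 keeps the denominator positive; for
      \<open>t = (y \<bullet> y) / ?C\<close> the quadratic term is at most half of the linear
      one.\<close>
    let ?C = "\<bar>l * (y \<bullet> y) - ?q y\<bar> + 1"
    let ?t = "(y \<bullet> y) / ?C"
    have C: "?C > 0" by simp
    have "2 * ?t * (y \<bullet> y) \<le> ?t\<^sup>2 * ?C"
      by (rule order_trans [OF P]) (intro mult_left_mono, auto)
    also have "\<dots> = ?t * (y \<bullet> y)" using C by (simp add: power2_eq_square)
    finally have "2 * (?t * (y \<bullet> y)) \<le> ?t * (y \<bullet> y)" by (simp only: mult.assoc)
    moreover have "0 < ?t * (y \<bullet> y)" using pos C by (intro mult_pos_pos divide_pos_pos)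
    ultimately show False by linarith
  qed
  then have "y = 0" by (metis inner_ge_zero inner_eq_zero_iff order_antisym)
  then show ?thesis using xS nx by (auto simp: y_def l_def)
qed

text \<open>In place of an induction on the dimension, an orthonormal set of eigenvectors of maximal
  size is taken. Its orthogonal complement is invariant because \<open>A\<close> is symmetric, so a
  nonzero complement would contribute one more eigenvector.\<close>

theorem symmetric_diagonalisable:
  fixes A :: "real ^ 'l ^ 'l"
  assumes sym: "transpose A = A"
  shows "\<exists>Q d. orthogonal_matrix Q \<and> A = Q ** diag_mat d ** transpose Q"
proof -
  let ?P = "\<lambda>E. pairwise orthogonal E \<and> (\<forall>x\<in>E. norm x = 1 \<and> A *v x = (x \<bullet> (A *v x)) *\<^sub>R x)"
  have indep: "independent E" if "?P E" for E
    using that by (intro pairwise_orthogonal_independent) auto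
  have bd: "finite E \<and> card E \<le> CARD('l)" if "?P E" for E
    using independent_bound [OF indep [OF that]] by simp
  define m where "m = Greatest (\<lambda>m. \<exists>E. ?P E \<and> card E = m)"
  have ex: "\<exists>E. ?P E \<and> card E = 0" by (rule exI [of _ "{}"]) simp
  have bdd: "\<And>y. \<exists>E. ?P E \<and> card E = y \<Longrightarrow> y \<le> CARD('l)" using bd by blast
  have "\<exists>E. ?P E \<and> card E = m"
    unfolding m_def by (rule GreatestI_nat [where k = 0 and b = "CARD('l)"]) (use ex bdd in blast)+
  then obtain E where E: "?P E" and cE: "card E = m" by blast
  have max: "card F \<le> card E" if "?P F" for F
    unfolding cE m_def by (rule Greatest_le_nat [where b = "CARD('l)"]) (use that bdd in blast)+
  let ?S = "{y. \<forall>x\<in>E. x \<bullet> y = 0}"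
  have subS: "subspace ?S" by (auto simp: subspace_def inner_add_right)
  have "?S = {0}"
  proof (rule ccontr)
    assume ne: "?S \<noteq> {0}"
    have inv: "A *v y \<in> ?S" if "y \<in> ?S" for y
    proof (clarsimp)
      fix x assume x: "x \<in> E"
      then have "x \<bullet> (A *v y) = ((x \<bullet> (A *v x)) *\<^sub>R x) \<bullet> y"
        using E symmetric_inner [OF sym, of x y] by metis
      also have "\<dots> = 0" using that x by simp
      finally show "x \<bullet> (A *v y) = 0" .
    qed
    from symmetric_eigenvector_exists [OF sym subS ne inv]
    obtain x where x: "x \<in> ?S" "norm x = 1" "A *v x = (x \<bullet> (A *v x)) *\<^sub>R x"
      by blast
    have "x \<notin> E" using x by (auto simp: norm_eq_1)
    moreover have "?P (insert x E)"
      using E x by (auto simp: pairwise_insert orthogonal_def inner_commute)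
    ultimately show False using max [of "insert x E"] bd [OF E] by simp
  qed
  have "span E = UNIV"
  proof (rule ccontr)
    assume "span E \<noteq> UNIV"
    then obtain a where a: "a \<noteq> 0" "\<And>x. x \<in> span E \<Longrightarrow> a \<bullet> x = 0"
      using span_not_UNIV_orthogonal by blast
    then have "a \<in> ?S" by (auto simp: span_base inner_commute)
    then show False using a(1) \<open>?S = {0}\<close> by blast
  qed
  then have "card E = CARD('l)"
    using dim_eq_card [of E UNIV] indep [OF E] by simp
  moreover have "finite E" using bd E by blast
  ultimately obtain e where e: "bij_betw e (UNIV :: 'l set) E"
    using finite_same_card_bij [of "UNIV :: 'l set" E] by auto
  define Q where "Q = (\<chi> i j. e j $ i)"
  define d where "d j = e j \<bullet> (A *v e j)" for j
  have eE: "e j \<in> E" for j using e by (auto simp: bij_betw_def)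
  have col: "column j Q = e j" for j by (simp add: Q_def column_def vec_eq_iff)
  have orth: "e i \<bullet> e j = (if i = j then 1 else 0)" for i j
  proof (cases "i = j")
    case True then show ?thesis using eE E by (auto simp: norm_eq_1)
  next
    case False
    then have "e i \<noteq> e j" using e by (auto simp: bij_betw_def inj_on_def)
    then show ?thesis using False eE E by (auto simp: pairwise_def orthogonal_def)
  qed
  have Q: "orthogonal_matrix Q"
    using orth by (auto simp: orthogonal_matrix_orthonormal_columns col norm_eq_1 orthogonal_def)
  have "A ** Q = Q ** diag_mat d"
  proof -
    have "(A ** Q) $ i $ j = (A *v e j) $ i" for i j
      by (simp add: matrix_matrix_mult_def matrix_vector_mult_def Q_def)
    moreover have "(A *v e j) $ i = d j * e j $ i" for i j
    proof -
      have "A *v e j = d j *\<^sub>R e j" unfolding d_def using E eE by blast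
      then show ?thesis by simp
    qed
    moreover have "(Q ** diag_mat d) $ i $ j = d j * e j $ i" for i j
      by (simp add: matrix_matrix_mult_def diag_mat_def Q_def if_distrib [of "\<lambda>z. _ * z"] cong: if_cong)
    ultimately show ?thesis by (simp add: vec_eq_iff)
  qed
  then have "A ** (Q ** transpose Q) = Q ** diag_mat d ** transpose Q"
    by (simp add: matrix_mul_assoc)
  then have "A = Q ** diag_mat d ** transpose Q"
    using Q by (simp add: orthogonal_matrix_def)
  with Q show ?thesis by blast
qed

lemma orthogonal_matrix_inner:
  fixes Q :: "real ^ 'l ^ 'l"
  assumes "orthogonal_matrix Q"
  shows "Q *v (transpose Q *v x) = x" "transpose Q *v (Q *v x) = x"
  using assms by (simp_all only: matrix_vector_mul_assoc orthogonal_matrix_def matrix_vector_mul_lid)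

lemma quad_conj_diag:
  fixes Q :: "real ^ 'l ^ 'l"
  shows "x \<bullet> ((Q ** diag_mat d ** transpose Q) *v y) = (\<Sum>i\<in>UNIV. d i * (transpose Q *v x) $ i * (transpose Q *v y) $ i)"
proof -
  have "x \<bullet> ((Q ** diag_mat d ** transpose Q) *v y) = x \<bullet> (Q *v (diag_mat d *v (transpose Q *v y)))"
    by (simp only: matrix_vector_mul_assoc matrix_mul_assoc)
  also have "\<dots> = (transpose Q *v x) \<bullet> (diag_mat d *v (transpose Q *v y))"
    by (rule inner_matrix_vec)
  finally show ?thesis
    by (simp only: diag_mat_vec inner_vec_def inner_real_def vec_lambda_beta mult_ac)
qed

lemma spd_diagonalisable:
  fixes A :: "real ^ 'l ^ 'l"
  assumes "spd A"
  shows "\<exists>Q d. orthogonal_matrix Q \<and> (\<forall>i. d i > 0) \<and> A = Q ** diag_mat d ** transpose Q"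
proof -
  obtain Q d where Q: "orthogonal_matrix Q" and A: "A = Q ** diag_mat d ** transpose Q"
    using symmetric_diagonalisable assms unfolding spd_def by blast
  have "d i > 0" for i
  proof -
    let ?x = "Q *v axis i 1"
    have ne: "?x \<noteq> 0"
    proof
      assume "?x = 0"
      then have "transpose Q *v ?x = 0" by simp
      then show False by (simp only: orthogonal_matrix_inner [OF Q]) (simp add: axis_eq_0_iff)
    qed
    have "?x \<bullet> (A *v ?x) = (\<Sum>j\<in>UNIV. d j * axis i 1 $ j * axis i 1 $ j)"
      unfolding A quad_conj_diag by (simp only: orthogonal_matrix_inner [OF Q])
    also have "\<dots> = d i" by (simp add: axis_def if_distrib [of "\<lambda>z. _ * z"] cong: if_cong)
    finally have "?x \<bullet> (A *v ?x) = d i" .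
    then show ?thesis using assms ne unfolding spd_def by metis
  qed
  with Q A show ?thesis by blast
qed

section \<open>Existence and uniqueness of the positive definite square root\<close>

lemma diag_mat_mult: "diag_mat c ** diag_mat d = diag_mat (\<lambda>i. c i * d i)"
  by (auto simp: diag_mat_def matrix_matrix_mult_def vec_eq_iff if_distrib [of "\<lambda>z. z * _"]
      if_distrib [of "\<lambda>z. _ * z"] cong: if_cong)

lemma conj_diag_mult:
  assumes "orthogonal_matrix (Q :: real ^ 'l ^ 'l)"
  shows "(Q ** diag_mat c ** transpose Q) ** (Q ** diag_mat d ** transpose Q)
    = Q ** diag_mat (\<lambda>i. c i * d i) ** transpose Q"
proof -
  have "(Q ** diag_mat c ** transpose Q) ** (Q ** diag_mat d ** transpose Q)
      = Q ** diag_mat c ** (transpose Q ** Q) ** diag_mat d ** transpose Q"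
    by (simp only: matrix_mul_assoc)
  also have "\<dots> = Q ** (diag_mat c ** diag_mat d) ** transpose Q"
    using assms by (simp only: orthogonal_matrix matrix_mul_rid matrix_mul_assoc)
  finally show ?thesis by (simp only: diag_mat_mult)
qed

lemma spd_conj_diag:
  fixes Q :: "real ^ 'l ^ 'l"
  assumes Q: "orthogonal_matrix Q" and d: "\<And>i. d i > 0"
  shows "spd (Q ** diag_mat d ** transpose Q)"
  unfolding spd_def
proof (intro conjI allI impI)
  show "transpose (Q ** diag_mat d ** transpose Q) = Q ** diag_mat d ** transpose Q"
    by (simp add: matrix_transpose_mul transpose_diag_mat matrix_mul_assoc)
  fix x :: "real ^ 'l" assume x: "x \<noteq> 0"
  let ?y = "transpose Q *v x"
  have "?y \<noteq> 0" using x orthogonal_matrix_inner(1) [OF Q, of x] by (metis matrix_vector_mult_0_right)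
  then obtain i where i: "?y $ i \<noteq> 0" by (auto simp: vec_eq_iff)
  have "0 < (\<Sum>i\<in>UNIV. d i * (?y $ i * ?y $ i))"
    using i d by (intro sum_pos2 [where i = i]) (auto simp: less_imp_le zero_less_mult_iff order_less_le)
  then show "0 < x \<bullet> ((Q ** diag_mat d ** transpose Q) *v x)"
    by (simp add: quad_conj_diag mult.assoc)
qed

text \<open>On an eigenvector \<open>x\<close> of \<open>R - S\<close> with eigenvalue
  \<open>d\<close>, equality of the squares gives \<open>R *v x\<close> and \<open>S *v x\<close>
  the same length. The difference of the squared lengths is \<open>d\<close> times the sum of the
  two quadratic forms at \<open>x\<close>, which is positive, so \<open>d = 0\<close>.\<close>

lemma spd_sqrt_unique:
  fixes R S :: "real ^ 'l ^ 'l"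
  assumes R: "spd R" and S: "spd S" and eq: "R ** R = S ** S"
  shows "R = S"
proof -
  have "transpose (R - S) = R - S"
    using R S by (simp add: spd_def transpose_def vec_eq_iff)
  from symmetric_diagonalisable [OF this]
  obtain Q d where Q: "orthogonal_matrix Q" and D: "R - S = Q ** diag_mat d ** transpose Q"
    by blast
  have "d i = 0" for i
  proof -
    let ?x = "Q *v axis i 1"
    have ne: "?x \<noteq> 0"
    proof
      assume "?x = 0"
      then have "transpose Q *v ?x = 0" by simp
      then show False by (simp only: orthogonal_matrix_inner [OF Q]) (simp add: axis_eq_0_iff)
    qed
    have "diag_mat d *v axis i 1 = d i *\<^sub>R axis i 1"
      by (simp add: diag_mat_vec axis_def vec_eq_iff)
    then have "(R - S) *v ?x = d i *\<^sub>R ?x"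
      unfolding D
      by (simp only: matrix_vector_mul_assoc [symmetric] orthogonal_matrix_inner [OF Q] matrix_vector_mult_scaleR)
    then have Rx: "R *v ?x = S *v ?x + d i *\<^sub>R ?x"
      by (simp add: matrix_vector_mult_diff_rdistrib algebra_simps)
    have "(R *v ?x) \<bullet> (R *v ?x) = ?x \<bullet> ((R ** R) *v ?x)" "(S *v ?x) \<bullet> (S *v ?x) = ?x \<bullet> ((S ** S) *v ?x)"
      using R S symmetric_inner [of R ?x "R *v ?x"] symmetric_inner [of S ?x "S *v ?x"]
      by (simp_all only: spd_def matrix_vector_mul_assoc matrix_mul_assoc simp_thms)
    then have "(R *v ?x) \<bullet> (R *v ?x) = (S *v ?x) \<bullet> (S *v ?x)" by (simp add: eq)
    then have "d i * (?x \<bullet> (R *v ?x) + ?x \<bullet> (S *v ?x)) = 0"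
      by (simp add: Rx inner_add_left inner_add_right inner_commute algebra_simps)
    moreover have "?x \<bullet> (R *v ?x) > 0" "?x \<bullet> (S *v ?x) > 0"
      using R S ne by (auto simp: spd_def)
    ultimately show "d i = 0" by simp
  qed
  then have "diag_mat d = 0" by (simp add: diag_mat_def vec_eq_iff)
  then have "R - S = 0" unfolding D by simp
  then show ?thesis by simp
qed

lemma spd_sqrt:
  fixes A :: "real ^ 'l ^ 'l"
  assumes "spd A"
  shows "spd (spd_sqrt A)" and "spd_sqrt A ** spd_sqrt A = A"
proof -
  obtain Q d where Q: "orthogonal_matrix Q" and d: "\<And>i. d i > 0"
    and A: "A = Q ** diag_mat d ** transpose Q"
    using spd_diagonalisable [OF assms] by blast
  let ?S = "Q ** diag_mat (\<lambda>i. sqrt (d i)) ** transpose Q"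
  have "spd ?S" by (rule spd_conj_diag) (use Q d in auto)
  moreover have "?S ** ?S = A"
    unfolding conj_diag_mult [OF Q] A using d by (simp add: less_imp_le)
  ultimately have "\<exists>!S. spd S \<and> S ** S = A" using spd_sqrt_unique by blast
  from theI' [OF this] show "spd (spd_sqrt A)" "spd_sqrt A ** spd_sqrt A = A"
    unfolding spd_sqrt_def by auto
qed

section \<open>Trace, determinant and the entropy functional\<close>

lemma trace_conj_diag:
  fixes Q :: "real ^ 'l ^ 'l"
  assumes "orthogonal_matrix Q"
  shows "trace (Q ** diag_mat d ** transpose Q) = (\<Sum>i\<in>UNIV. d i)"
proof -
  have "trace (Q ** diag_mat d ** transpose Q) = trace (transpose Q ** (Q ** diag_mat d))"
    by (rule trace_mul_sym)
  also have "\<dots> = trace (diag_mat d)"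
    using assms by (simp add: matrix_mul_assoc orthogonal_matrix)
  finally show ?thesis by (simp add: trace_def diag_mat_def)
qed

lemma det_conj_diag:
  fixes Q :: "real ^ 'l ^ 'l"
  assumes "orthogonal_matrix Q"
  shows "det (Q ** diag_mat d ** transpose Q) = (\<Prod>i\<in>UNIV. d i)"
proof -
  have "det Q * det Q = 1"
    using det_orthogonal_matrix [OF assms] by auto
  moreover have "det (diag_mat d) = (\<Prod>i\<in>UNIV. d i)"
    by (subst det_diagonal) (auto simp: diag_mat_def)
  ultimately show ?thesis by (simp add: det_mul mult.commute mult.left_commute)
qed

text \<open>The entropy rate of \<open>N(0, A)\<close> relative to the standard Gaussian, up to the factor \<open>1/2\<close>.\<close>

definition spd_entropy :: "real ^ 'l ^ 'l \<Rightarrow> real" where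
  "spd_entropy A = trace A - real CARD('l) - ln (det A)"

lemma spd_entropy_conj_diag:
  fixes Q :: "real ^ 'l ^ 'l"
  assumes "orthogonal_matrix Q" and d: "\<And>i. d i > 0"
  shows "spd_entropy (Q ** diag_mat d ** transpose Q) = (\<Sum>i\<in>UNIV. d i - 1 - ln (d i))"
  using assms by (simp add: spd_entropy_def trace_conj_diag det_conj_diag ln_prod sum_subtractf less_imp_neq [symmetric])

lemma spd_entropy_nonneg:
  assumes "spd A"
  shows "0 \<le> spd_entropy A"
proof -
  obtain Q d where Q: "orthogonal_matrix Q" and d: "\<And>i. d i > 0"
    and A: "A = Q ** diag_mat d ** transpose Q"
    using spd_diagonalisable [OF assms] by blast
  show ?thesis
    unfolding A spd_entropy_conj_diag [OF Q d]
    using d ln_le_minus_one by (intro sum_nonneg) (smt (verit))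
qed

lemma spd_det_pos:
  assumes "spd A"
  shows "0 < det A"
proof -
  obtain Q d where Q: "orthogonal_matrix Q" and d: "\<And>i. d i > 0"
    and A: "A = Q ** diag_mat d ** transpose Q"
    using spd_diagonalisable [OF assms] by blast
  show ?thesis unfolding A det_conj_diag [OF Q] using d by (simp add: prod_pos)
qed

text \<open>
  The tangent inequality for the convex function \<open>- ln det\<close> at \<open>A = R\<^sup>2\<close>, obtained by applying
  \<open>spd_entropy_nonneg\<close> to \<open>R\<^sup>-\<^sup>1 H R\<^sup>-\<^sup>1\<close>.
\<close>

lemma spd_entropy_tangent:
  fixes A :: "real ^ 'l ^ 'l"
  assumes A: "spd A"
  shows "\<exists>C. trace (C ** A) = real CARD('l) \<and>
    (\<forall>H. spd H \<longrightarrow> spd_entropy A + (trace H - trace A) - (trace (C ** H) - real CARD('l)) \<le> spd_entropy H)"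
proof -
  define R where "R = spd_sqrt A"
  have R: "spd R" and RR: "R ** R = A" using spd_sqrt [OF A] by (auto simp: R_def)
  have "det R \<noteq> 0" using spd_det_pos [OF R] by simp
  then obtain P where PR: "P ** R = mat 1" and RP: "R ** P = mat 1"
    using invertible_det_nz [of R] unfolding invertible_def by blast
  have "transpose P ** R = mat 1"
    by (metis RP R spd_def matrix_transpose_mul transpose_mat)
  then have tP: "transpose P = P"
    by (metis RP matrix_mul_assoc matrix_mul_lid matrix_mul_rid)
  have "P *v x \<noteq> 0" if "x \<noteq> 0" for x
    by (metis RP matrix_vector_mul_assoc matrix_vector_mul_lid matrix_vector_mult_0_right that)
  \<comment> \<open>The witness \<open>P ** P\<close> is the inverse of \<open>A\<close>, and
    \<open>trace (C ** H)\<close> is then the derivative of ln det at \<open>A\<close> in the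
    direction \<open>H\<close>. Only its linearity in \<open>H\<close> and its value at
    \<open>A\<close> matter when the inequality is integrated.\<close>
  have 1: "trace ((P ** P) ** A) = real CARD('l)"
  proof -
    have "(P ** P) ** A = P ** (P ** R) ** R"
      by (simp only: RR [symmetric] matrix_mul_assoc)
    then show ?thesis by (simp add: PR matrix_mul_rid trace_I)
  qed
  have 2: "spd_entropy A + (trace H - trace A) - (trace ((P ** P) ** H) - real CARD('l)) \<le> spd_entropy H"
    if H: "spd H" for H
  proof -
    let ?K = "P ** H ** P"
    have "spd ?K"
      unfolding spd_def
    proof (intro conjI allI impI)
      show "transpose ?K = ?K"
        using H by (simp add: matrix_transpose_mul tP spd_def matrix_mul_assoc)
      fix x :: "real ^ 'l" assume "x \<noteq> 0"
      then have "P *v x \<noteq> 0" by fact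
      moreover have "x \<bullet> (?K *v x) = (P *v x) \<bullet> (H *v (P *v x))"
        using symmetric_inner [OF tP, of x "H *v (P *v x)"]
        by (simp only: matrix_vector_mul_assoc matrix_mul_assoc)
      ultimately show "0 < x \<bullet> (?K *v x)" using H by (simp add: spd_def)
    qed
    from spd_entropy_nonneg [OF this]
    have "0 \<le> trace ?K - real CARD('l) - ln (det ?K)" by (simp add: spd_entropy_def)
    moreover have "trace ?K = trace ((P ** P) ** H)"
      using trace_mul_sym [of "P ** H" P] by (simp add: matrix_mul_assoc)
    moreover have "ln (det ?K) = ln (det H) - ln (det A)"
    proof -
      have "det P * det R = 1" using PR by (metis det_I det_mul)
      then have dP: "det P = 1 / det R" using \<open>det R \<noteq> 0\<close> by (simp add: field_simps)
      have "det ?K = det H / det A"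
        by (simp add: det_mul dP RR [symmetric])
      then show ?thesis using spd_det_pos [OF H] spd_det_pos [OF A] by (simp add: ln_div)
    qed
    ultimately show ?thesis by (simp add: spd_entropy_def)
  qed
  from 1 2 show ?thesis by blast
qed

section \<open>Uniqueness of joint characteristic functions\<close>

text \<open>Dividing \<open>V\<close> by its integral \<open>c\<close> gives a probability density;
  the characteristic function of the image law is the given integral divided by \<open>c\<close>, so
  one-dimensional uniqueness applies. The bound \<open>1 \<le> V\<close> keeps the weight positive
  and allows division by \<open>c\<close>.\<close>

lemma distr_eq_of_weighted_char:
  fixes X :: "'a \<Rightarrow> real" and X' :: "'b \<Rightarrow> real"
  assumes M: "prob_space M" and M': "prob_space M'"
    and [measurable]: "X \<in> borel_measurable M" "X' \<in> borel_measurable M'"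
      "V \<in> borel_measurable M" "V' \<in> borel_measurable M'"
    and V: "\<And>x. 1 \<le> V x" "\<And>x. V x \<le> K" and V': "\<And>x. 1 \<le> V' x" "\<And>x. V' x \<le> K"
    and eq: "\<And>u. (CLINT x|M. iexp (u * X x) * of_real (V x)) = (CLINT x|M'. iexp (u * X' x) * of_real (V' x))"
    and A: "A \<in> sets borel"
  shows "(\<integral>x. indicator A (X x) * V x \<partial>M) = (\<integral>x. indicator A (X' x) * V' x \<partial>M')"
proof -
  have *: "c \<ge> 1 \<and> prob_space (density N (\<lambda>x. ennreal (U x / c))) \<and>
      real_distribution (distr (density N (\<lambda>x. ennreal (U x / c))) borel Y) \<and>
      (\<forall>t. char (distr (density N (\<lambda>x. ennreal (U x / c))) borel Y) t = (CLINT x|N. iexp (t * Y x) * of_real (U x)) / of_real c) \<and>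
      measure (distr (density N (\<lambda>x. ennreal (U x / c))) borel Y) A = (\<integral>x. indicator A (Y x) * U x \<partial>N) / c"
    if N: "prob_space N" and [measurable]: "Y \<in> borel_measurable N" "U \<in> borel_measurable N"
      and U: "\<And>x. 1 \<le> U x" "\<And>x. U x \<le> K" and c: "c = (\<integral>x. U x \<partial>N)"
    for N :: "'z measure" and Y :: "'z \<Rightarrow> real" and U c
  proof -
    interpret N: prob_space N by fact
    have U0: "0 \<le> U x" for x using U(1) [of x] by linarith
    have iU: "integrable N U"
      by (rule N.integrable_const_bound [where B = K]) (use U U0 in \<open>auto simp: abs_of_nonneg\<close>)
    have "(\<integral>x. 1 \<partial>N) \<le> (\<integral>x. U x \<partial>N)"
      by (rule integral_mono) (use iU U in auto)
    then have c1: "c \<ge> 1" by (simp add: c N.prob_space)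
    let ?P = "density N (\<lambda>x. ennreal (U x / c))"
    have "(\<integral>\<^sup>+x. ennreal (U x / c) \<partial>N) = ennreal (\<integral>x. U x / c \<partial>N)"
      by (rule nn_integral_eq_integral) (use iU U0 c1 in auto)
    also have "\<dots> = 1" using c1 by (simp add: c)
    finally have P: "prob_space ?P"
      by (intro prob_spaceI) (simp add: emeasure_density cong: nn_integral_cong)
    interpret P: prob_space ?P by fact
    have rd: "real_distribution (distr ?P borel Y)"
      by (rule P.real_distribution_distr) simp
    have ch: "char (distr ?P borel Y) t = (CLINT x|N. iexp (t * Y x) * of_real (U x)) / of_real c" for t
    proof -
      have "char (distr ?P borel Y) t = (CLINT x|?P. iexp (t * Y x))"
        unfolding char_def by (subst integral_distr) auto
      also have "\<dots> = (CLINT x|N. (U x / c) *\<^sub>R iexp (t * Y x))"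
        by (subst integral_density) (use U0 c1 in auto)
      also have "\<dots> = (CLINT x|N. (iexp (t * Y x) * of_real (U x)) / of_real c)"
        by (intro Bochner_Integration.integral_cong) (auto simp: scaleR_conv_of_real mult.commute)
      finally show ?thesis by simp
    qed
    have me: "measure (distr ?P borel Y) A = (\<integral>x. indicator A (Y x) * U x \<partial>N) / c"
    proof -
      have "measure (distr ?P borel Y) A = (\<integral>x. indicator A x \<partial>distr ?P borel Y)"
        using A by simp
      also have "\<dots> = (\<integral>x. indicator A (Y x) \<partial>?P)"
        using A by (subst integral_distr) auto
      also have "\<dots> = (\<integral>x. (U x / c) *\<^sub>R indicator A (Y x) \<partial>N)"
        using A by (subst integral_density) (use U0 c1 in auto)
      finally show ?thesis by (simp add: mult.commute)
    qed
    show ?thesis using c1 P rd ch me by blast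
  qed
  define c where "c = (\<integral>x. V x \<partial>M)"
  \<comment> \<open>At \<open>u = 0\<close> the hypothesis says that both weights have the same
    normalising constant.\<close>
  have "c = (\<integral>x. V' x \<partial>M')"
    using eq [of 0] unfolding c_def by simp
  note 1 = * [OF M _ _ V c_def, of X] and 2 = * [OF M' _ _ V' this, of X']
  have D: "distr (density M (\<lambda>x. ennreal (V x / c))) borel X = distr (density M' (\<lambda>x. ennreal (V' x / c))) borel X'"
    by (rule Levy_uniqueness) (use 1 2 eq in auto)
  have "(\<integral>x. indicator A (X x) * V x \<partial>M) / c = (\<integral>x. indicator A (X' x) * V' x \<partial>M') / c"
    using 1 2 unfolding D by simp
  then show ?thesis using 1 by auto
qed

text \<open>The shifted weight \<open>2 + W\<close> lies in [1,3] and is covered by the positive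
  case; the contribution of the constant 2 is removed with the unweighted identity
  \<open>eq0\<close>.\<close>

lemma indicator_weight_eq_of_char_real:
  fixes X :: "'a \<Rightarrow> real" and X' :: "'b \<Rightarrow> real"
  assumes M: "prob_space M" and M': "prob_space M'"
    and [measurable]: "X \<in> borel_measurable M" "X' \<in> borel_measurable M'"
      "W \<in> borel_measurable M" "W' \<in> borel_measurable M'"
    and W: "\<And>x. \<bar>W x\<bar> \<le> 1" and W': "\<And>x. \<bar>W' x\<bar> \<le> 1"
    and eq0: "\<And>u. (CLINT x|M. iexp (u * X x)) = (CLINT x|M'. iexp (u * X' x))"
    and eq: "\<And>u. (CLINT x|M. iexp (u * X x) * of_real (W x)) = (CLINT x|M'. iexp (u * X' x) * of_real (W' x))"
    and A: "A \<in> sets borel"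
  shows "(\<integral>x. indicator A (X x) * W x \<partial>M) = (\<integral>x. indicator A (X' x) * W' x \<partial>M')"
proof -
  interpret M: prob_space M by fact
  interpret M': prob_space M' by fact
  note A [measurable]
  have b: "1 \<le> 2 + W x" "2 + W x \<le> 3" for x using W [of x] by (auto simp: abs_if split: if_splits)
  have b': "1 \<le> 2 + W' x" "2 + W' x \<le> 3" for x using W' [of x] by (auto simp: abs_if split: if_splits)
  have i: "integrable M (\<lambda>x. iexp (u * X x))" "integrable M (\<lambda>x. iexp (u * X x) * of_real (W x))"
     "integrable M' (\<lambda>x. iexp (u * X' x))" "integrable M' (\<lambda>x. iexp (u * X' x) * of_real (W' x))" for u
    using W W' by (auto intro!: M.integrable_const_bound [where B = 1] M'.integrable_const_bound [where B = 1] simp: norm_mult)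
  have i2: "integrable M (\<lambda>x. indicator A (X x) * (1::real))" "integrable M (\<lambda>x. indicator A (X x) * W x)"
     "integrable M' (\<lambda>x. indicator A (X' x) * (1::real))" "integrable M' (\<lambda>x. indicator A (X' x) * W' x)"
    using W W' by (auto intro!: M.integrable_const_bound [where B = 1] M'.integrable_const_bound [where B = 1]
        simp: indicator_def)
  have "(CLINT x|M. iexp (u * X x) * of_real (2 + W x)) = (CLINT x|M'. iexp (u * X' x) * of_real (2 + W' x))" for u
    using i eq0 [of u] eq [of u] by (simp add: distrib_left del: mult_exp_exp)
  from distr_eq_of_weighted_char [OF M M' _ _ _ _ b b' this A]
  have "(\<integral>x. indicator A (X x) * (2 + W x) \<partial>M) = (\<integral>x. indicator A (X' x) * (2 + W' x) \<partial>M')"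
    by measurable
  moreover have "(\<integral>x. indicator A (X x) * (1::real) \<partial>M) = (\<integral>x. indicator A (X' x) * 1 \<partial>M')"
    by (rule distr_eq_of_weighted_char [where K = 1 and V = "\<lambda>_. 1" and V' = "\<lambda>_. 1"]) (use M M' A eq0 in auto)
  ultimately show ?thesis using i2
    by (simp add: distrib_left)
qed

text \<open>Real and imaginary parts of \<open>Z\<close> are combinations of \<open>Z\<close> and
  \<open>cnj (Z x)\<close>. The identity for the conjugate weight is the conjugate of the given one
  at \<open>- u\<close>, which reduces the claim to real weights bounded by 1.\<close>

lemma indicator_weight_eq_of_char:
  fixes X :: "'a \<Rightarrow> real" and X' :: "'b \<Rightarrow> real" and Z :: "'a \<Rightarrow> complex" and Z' :: "'b \<Rightarrow> complex"
  assumes M: "prob_space M" and M': "prob_space M'"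
    and [measurable]: "X \<in> borel_measurable M" "X' \<in> borel_measurable M'"
      "Z \<in> borel_measurable M" "Z' \<in> borel_measurable M'"
    and Z: "\<And>x. norm (Z x) \<le> 1" and Z': "\<And>x. norm (Z' x) \<le> 1"
    and eq0: "\<And>u. (CLINT x|M. iexp (u * X x)) = (CLINT x|M'. iexp (u * X' x))"
    and eq: "\<And>u. (CLINT x|M. iexp (u * X x) * Z x) = (CLINT x|M'. iexp (u * X' x) * Z' x)"
    and A: "A \<in> sets borel"
  shows "(CLINT x|M. indicator A (X x) * Z x) = (CLINT x|M'. indicator A (X' x) * Z' x)"
proof -
  interpret M: prob_space M by fact
  interpret M': prob_space M' by fact
  note A [measurable]
  have [measurable]: "(\<lambda>x. cnj (Z x)) \<in> borel_measurable M" "(\<lambda>x. cnj (Z' x)) \<in> borel_measurable M'"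
    by (rule measurable_compose [where N = borel], simp, intro borel_measurable_continuous_onI continuous_intros)+
  have i: "integrable M (\<lambda>x. iexp (u * X x) * Z x)" "integrable M (\<lambda>x. iexp (u * X x) * cnj (Z x))"
     "integrable M' (\<lambda>x. iexp (u * X' x) * Z' x)" "integrable M' (\<lambda>x. iexp (u * X' x) * cnj (Z' x))" for u
    using Z Z' by (auto intro!: M.integrable_const_bound [where B = 1] M'.integrable_const_bound [where B = 1] simp: norm_mult)
  have i2: "integrable M (\<lambda>x. indicator A (X x) * Z x)" "integrable M' (\<lambda>x. indicator A (X' x) * Z' x)"
    using Z Z' by (auto intro!: M.integrable_const_bound [where B = 1] M'.integrable_const_bound [where B = 1]
        simp: indicator_def)
  have cj: "(CLINT x|M. iexp (u * X x) * cnj (Z x)) = (CLINT x|M'. iexp (u * X' x) * cnj (Z' x))" for u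
  proof -
    have "(CLINT x|M. iexp (u * X x) * cnj (Z x)) = cnj (CLINT x|M. iexp (- u * X x) * Z x)"
      by (subst Bochner_Integration.integral_cnj [symmetric]) (simp add: exp_cnj)
    also have "\<dots> = cnj (CLINT x|M'. iexp (- u * X' x) * Z' x)"
      by (simp only: eq)
    also have "\<dots> = (CLINT x|M'. iexp (u * X' x) * cnj (Z' x))"
      by (subst Bochner_Integration.integral_cnj [symmetric]) (simp add: exp_cnj)
    finally show ?thesis .
  qed
  have Re: "iexp y * of_real (Re z) = (iexp y * z + iexp y * cnj z) / 2" for y z
    by (simp add: complex_add_cnj distrib_left [symmetric])
  have Im: "iexp y * of_real (Im z) = (iexp y * z - iexp y * cnj z) / (2 * \<i>)" for y z
  proof -
    have "iexp y * z - iexp y * cnj z = (2 * \<i>) * (iexp y * of_real (Im z))"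
      unfolding right_diff_distrib [symmetric] complex_diff_cnj by (simp add: mult_ac)
    then show ?thesis by simp
  qed
  have bZ: "\<bar>Re (Z x)\<bar> \<le> 1" "\<bar>Im (Z x)\<bar> \<le> 1" for x
    using Z [of x] abs_Re_le_cmod [of "Z x"] abs_Im_le_cmod [of "Z x"] by linarith+
  have bZ': "\<bar>Re (Z' x)\<bar> \<le> 1" "\<bar>Im (Z' x)\<bar> \<le> 1" for x
    using Z' [of x] abs_Re_le_cmod [of "Z' x"] abs_Im_le_cmod [of "Z' x"] by linarith+
  have "(\<integral>x. indicator A (X x) * Re (Z x) \<partial>M) = (\<integral>x. indicator A (X' x) * Re (Z' x) \<partial>M')"
  proof (rule indicator_weight_eq_of_char_real [OF M M' _ _ _ _ _ _ eq0 _ A])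
    show "(CLINT x|M. iexp (u * X x) * of_real (Re (Z x))) = (CLINT x|M'. iexp (u * X' x) * of_real (Re (Z' x)))" for u
      unfolding Re using i cj [of u] eq [of u] by simp
  qed (simp_all add: bZ bZ')
  moreover have "(\<integral>x. indicator A (X x) * Im (Z x) \<partial>M) = (\<integral>x. indicator A (X' x) * Im (Z' x) \<partial>M')"
  proof (rule indicator_weight_eq_of_char_real [OF M M' _ _ _ _ _ _ eq0 _ A])
    show "(CLINT x|M. iexp (u * X x) * of_real (Im (Z x))) = (CLINT x|M'. iexp (u * X' x) * of_real (Im (Z' x)))" for u
      unfolding Im using i cj [of u] eq [of u] by simp
  qed (simp_all add: bZ bZ')
  moreover have "Re (indicator A y * z) = indicator A y * Re z" "Im (indicator A y * z) = indicator A y * Im z" for y :: real and z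
    by (auto simp: indicator_def)
  ultimately show ?thesis
    using i2 by (intro complex_eqI) (simp_all add: integral_Re [symmetric] integral_Im [symmetric] del: integral_Re integral_Im)
qed

text \<open>Fourier factors are exchanged for indicators one coordinate at a time. In each exchange
  the indicators already obtained and the remaining exponentials form a bounded complex weight, so
  one-dimensional uniqueness suffices; after the last exchange both laws agree on
  rectangles.\<close>

theorem distr_PiM_eqI_char:
  fixes X :: "'i \<Rightarrow> 'a \<Rightarrow> real" and X' :: "'i \<Rightarrow> 'b \<Rightarrow> real"
  assumes M: "prob_space M" and M': "prob_space M'" and I: "finite I"
    and X [measurable]: "\<And>i. i \<in> I \<Longrightarrow> X i \<in> borel_measurable M"
    and X' [measurable]: "\<And>i. i \<in> I \<Longrightarrow> X' i \<in> borel_measurable M'"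
    and eq: "\<And>u. (CLINT x|M. iexp (\<Sum>i\<in>I. u i * X i x)) = (CLINT x|M'. iexp (\<Sum>i\<in>I. u i * X' i x))"
  shows "distr M (PiM I (\<lambda>_. borel)) (\<lambda>x. \<lambda>i\<in>I. X i x) = distr M' (PiM I (\<lambda>_. borel)) (\<lambda>x. \<lambda>i\<in>I. X' i x)"
proof -
  interpret M: prob_space M by fact
  interpret M': prob_space M' by fact
  have step: "(CLINT x|M. (\<Prod>i\<in>J. indicator (A i) (X i x)) * iexp (\<Sum>i\<in>I - J. u i * X i x))
      = (CLINT x|M'. (\<Prod>i\<in>J. indicator (A i) (X' i x)) * iexp (\<Sum>i\<in>I - J. u i * X' i x))"
    if "finite J" "J \<subseteq> I" and A: "\<And>i. i \<in> I \<Longrightarrow> A i \<in> sets borel" for J A u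
    using that(1,2)
  proof (induction J arbitrary: u)
    case empty
    then show ?case using eq by simp
  next
    case (insert j J)
    then have j: "j \<in> I" and J: "J \<subseteq> I" and IJ: "I - J = insert j (I - insert j J)" by auto
    note A [measurable]
    have Am: "\<And>i. i \<in> J \<Longrightarrow> A i \<in> sets borel" using A J by auto
    have mX: "\<And>i. i \<in> J \<Longrightarrow> X i \<in> borel_measurable M" and mX': "\<And>i. i \<in> J \<Longrightarrow> X' i \<in> borel_measurable M'" using J by auto
    let ?Z = "\<lambda>x. (\<Prod>i\<in>J. indicator (A i) (X i x)) * iexp (\<Sum>i\<in>I - insert j J. u i * X i x)"
    let ?Z' = "\<lambda>x. (\<Prod>i\<in>J. indicator (A i) (X' i x)) * iexp (\<Sum>i\<in>I - insert j J. u i * X' i x)"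
    have m: "?Z \<in> borel_measurable M" "?Z' \<in> borel_measurable M'"
      using Am mX mX' by measurable
    have n: "norm ((\<Prod>i\<in>J. indicator (A i) (f i) :: complex) * iexp y) \<le> 1" for f :: "'i \<Rightarrow> real" and y
      by (auto simp: norm_mult prod_norm [symmetric] indicator_def intro!: prod_le_1)
    \<comment> \<open>Overwriting \<open>u j\<close> by \<open>t\<close> lets the induction
      hypothesis range over all frequencies of the coordinate \<open>j\<close>, while the other
      frequencies stay fixed inside the weight.\<close>
    have split: "(\<Sum>i\<in>I - J. (u(j := t)) i * f i) = t * f j + (\<Sum>i\<in>I - insert j J. u i * f i)" for t f
      unfolding IJ using I by (subst sum.insert) (auto intro!: sum.cong)
    \<comment> \<open>Frequencies supported on \<open>j\<close> alone yield the unweighted identity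
      that the weighted uniqueness lemma also asks for.\<close>
    have single: "(\<Sum>i\<in>I. (if i = j then t else 0) * f i) = t * f j" for t and f :: "'i \<Rightarrow> real"
      using I j by (subst sum.remove [of I j]) auto
    have "(CLINT x|M. indicator (A j) (X j x) * ?Z x) = (CLINT x|M'. indicator (A j) (X' j x) * ?Z' x)"
    proof (rule indicator_weight_eq_of_char [OF M M' X [OF j] X' [OF j] m n n _ _ A [OF j]])
      show "(CLINT x|M. iexp (t * X j x)) = (CLINT x|M'. iexp (t * X' j x))" for t
        using eq [of "\<lambda>i. if i = j then t else 0"] unfolding single .
      show "(CLINT x|M. iexp (t * X j x) * ?Z x) = (CLINT x|M'. iexp (t * X' j x) * ?Z' x)" for t
        using insert.IH [OF J, of "u(j := t)"] unfolding split
        by (simp add: distrib_left exp_add mult_ac del: mult_exp_exp)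
    qed
    then show ?case using insert.hyps by (simp add: mult.assoc)
  qed
  have *: "emeasure (distr N (PiM I (\<lambda>_. borel)) (\<lambda>x. \<lambda>i\<in>I. Y i x)) (Pi\<^sub>E I A) = ennreal (Re (CLINT x|N. (\<Prod>i\<in>I. indicator (A i) (Y i x))))"
    if N: "prob_space N" and Y [measurable]: "\<And>i. i \<in> I \<Longrightarrow> Y i \<in> borel_measurable N" and A: "\<And>i. i \<in> I \<Longrightarrow> A i \<in> sets borel"
    for N :: "'z measure" and Y A
  proof -
    interpret N: prob_space N by fact
    let ?E = "(\<lambda>x. \<lambda>i\<in>I. Y i x) -` Pi\<^sub>E I A \<inter> space N"
    have PA: "Pi\<^sub>E I A \<in> sets (PiM I (\<lambda>_. borel))"
      using I A by (intro sets_PiM_I_finite) auto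
    have mY: "(\<lambda>x. \<lambda>i\<in>I. Y i x) \<in> measurable N (PiM I (\<lambda>_. borel))" by measurable
    have E: "?E \<in> sets N" using measurable_sets [OF mY PA] .
    have ind: "(\<Prod>i\<in>I. indicator (A i) (Y i x)) = (indicator ?E x :: complex)" if "x \<in> space N" for x
      using that I by (auto simp: indicator_def PiE_iff prod_zero_iff split: if_splits)
    have "(CLINT x|N. (\<Prod>i\<in>I. indicator (A i) (Y i x))) = (CLINT x|N. indicator ?E x)"
      using ind by (intro Bochner_Integration.integral_cong) auto
    also have "\<dots> = (CLINT x|N. complex_of_real (indicator ?E x))"
      by (intro Bochner_Integration.integral_cong) (auto simp: indicator_def)
    also have "\<dots> = complex_of_real (\<integral>x. indicator ?E x \<partial>N)" by simp
    also have "\<dots> = complex_of_real (measure N ?E)" by (subst Bochner_Integration.integral_indicator) (simp add: Int_assoc)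
    finally show ?thesis using mY PA by (simp add: emeasure_distr N.emeasure_eq_measure)
  qed
  show ?thesis
  proof (rule measure_eqI_PiM_finite [OF I])
    fix A assume A: "\<And>i. i \<in> I \<Longrightarrow> A i \<in> sets (borel :: real measure)"
    then show "emeasure (distr M (PiM I (\<lambda>_. borel)) (\<lambda>x. \<lambda>i\<in>I. X i x)) (Pi\<^sub>E I A) =
        emeasure (distr M' (PiM I (\<lambda>_. borel)) (\<lambda>x. \<lambda>i\<in>I. X' i x)) (Pi\<^sub>E I A)"
      using * [OF M X A] * [OF M' X' A] step [OF I subset_refl, of A "\<lambda>_. 0"] by simp
  next
    show "range (\<lambda>_::nat. space (PiM I (\<lambda>_. borel :: real measure))) \<subseteq> prod_algebra I (\<lambda>_. borel)"
      using I by (auto simp: space_PiM intro!: prod_algebraI_finite)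
    interpret D: prob_space "distr M (PiM I (\<lambda>_. borel)) (\<lambda>x. \<lambda>i\<in>I. X i x)"
      by (rule M.prob_space_distr) measurable
    show "emeasure (distr M (PiM I (\<lambda>_. borel)) (\<lambda>x. \<lambda>i\<in>I. X i x)) (space (PiM I (\<lambda>_. borel))) \<noteq> \<infinity>"
      by simp
  qed auto
qed

section \<open>Characteristic functions of Brownian increments\<close>

abbreviation normal_law :: "real \<Rightarrow> real measure" where
  "normal_law \<sigma> \<equiv> density lborel (\<lambda>x. ennreal (normal_density 0 \<sigma> x))"

lemma distr_scale_normal_law:
  assumes "0 < \<sigma>" "0 < c"
  shows "distr (normal_law \<sigma>) borel (\<lambda>x. c * x) = normal_law (c * \<sigma>)"
proof -
  interpret prob_space "normal_law \<sigma>" using prob_space_normal_density [OF assms(1)] .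
  have "distr (normal_law \<sigma>) lborel (\<lambda>x. x) = normal_law \<sigma>"
    using distr_id2 [of lborel "normal_law \<sigma>"] by simp
  then have "distributed (normal_law \<sigma>) lborel (\<lambda>x. x) (normal_density 0 \<sigma>)"
    by (simp add: distributed_def)
  from distributed_distr_eq_density [OF normal_density_affine [OF this assms(1), of c 0]]
  show ?thesis using assms
    by (simp add: distr_cong [of "normal_law \<sigma>" "normal_law \<sigma>" lborel borel])
qed

lemma char_normal_law:
  assumes "0 < \<sigma>"
  shows "char (normal_law \<sigma>) t = exp (- (of_real (\<sigma>\<^sup>2 * t\<^sup>2 / 2)))"
proof -
  have "char (normal_law \<sigma>) t = char (distr (normal_law 1) borel (\<lambda>x. \<sigma> * x)) t"
    using assms by (simp add: distr_scale_normal_law)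
  also have "\<dots> = char (normal_law 1) (t * \<sigma>)"
    unfolding char_def by (subst integral_distr) (auto simp: mult.assoc)
  also have "\<dots> = of_real (exp (- ((t * \<sigma>)\<^sup>2) / 2))"
    using char_std_normal_distribution by metis
  finally show ?thesis by (simp add: exp_of_real [symmetric] power_mult_distrib mult.commute)
qed

text \<open>Lebesgue measure on the vector space is the image of the product over
  \<open>Basis\<close>, and density and exponential both factor along it; the integral becomes a
  product of one-dimensional characteristic functions.\<close>

lemma char_gaussian_vector:
  fixes D :: "'w \<Rightarrow> real ^ 'l"
  assumes D: "distributed M lborel D (\<lambda>x. ennreal (\<Prod>i\<in>UNIV. normal_density 0 \<sigma> (x $ i)))"
    and \<sigma>: "0 < \<sigma>"
  shows "(CLINT w|M. iexp (v \<bullet> D w)) = exp (- of_real (\<sigma>\<^sup>2 * (norm v)\<^sup>2 / 2))"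
proof -
  let ?f = "\<lambda>b y. normal_density 0 \<sigma> y *\<^sub>R iexp ((v \<bullet> b) * y)"
  interpret product_sigma_finite "\<lambda>_ :: real ^ 'l. lborel :: real measure" ..
  have Dm [measurable]: "D \<in> borel_measurable M" using D by (simp add: distributed_def)
  have B: "(\<Prod>i\<in>UNIV. normal_density 0 \<sigma> (x $ i)) = (\<Prod>b\<in>Basis. normal_density 0 \<sigma> (x \<bullet> b))" for x :: "real ^ 'l"
  proof -
    have 1: "(Basis :: (real ^ 'l) set) = range (\<lambda>i. axis i 1)"
      by (auto simp: Basis_vec_def)
    have 2: "inj (\<lambda>i::'l. axis i (1::real))" by (auto simp: inj_on_def axis_eq_axis)
    have "(\<Prod>b\<in>Basis. normal_density 0 \<sigma> (x \<bullet> b)) = (\<Prod>i\<in>UNIV. normal_density 0 \<sigma> (x \<bullet> axis i 1))"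
      unfolding 1 by (subst prod.reindex [OF 2]) simp
    then show ?thesis by (simp add: inner_axis)
  qed
  have "(CLINT w|M. iexp (v \<bullet> D w)) = (CLINT x|distr M lborel D. iexp (v \<bullet> x))"
    by (subst integral_distr) auto
  also have "\<dots> = (CLINT x|lborel. (\<Prod>i\<in>UNIV. normal_density 0 \<sigma> (x $ i)) *\<^sub>R iexp (v \<bullet> x))"
    unfolding distributed_distr_eq_density [OF D]
    by (subst integral_density) (auto intro!: prod_nonneg)
  also have "\<dots> = (CLINT x|lborel. (\<Prod>b\<in>Basis. ?f b (x \<bullet> b)))"
    unfolding B
    by (intro Bochner_Integration.integral_cong refl, subst euclidean_inner)
       (simp add: prod.distrib exp_sum sum_distrib_left scaleR_conv_of_real)
  also have "\<dots> = (CLINT x|(\<Pi>\<^sub>M b\<in>(Basis :: (real ^ 'l) set). lborel). (\<Prod>b\<in>Basis. ?f b (x b)))"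
    by (subst lborel_eq, subst integral_distr) (auto intro!: Bochner_Integration.integral_cong prod.cong)
  also have "\<dots> = (\<Prod>b\<in>Basis. CLINT y|lborel. ?f b y)"
    using \<sigma> by (intro product_integral_prod finite_Basis) (auto intro!: Bochner_Integration.integrable_bound [OF integrable_normal_density [OF \<sigma>, of 0]])
  also have "\<dots> = (\<Prod>b\<in>Basis. exp (- of_real (\<sigma>\<^sup>2 * (v \<bullet> b)\<^sup>2 / 2)))"
  proof (intro prod.cong refl)
    fix b :: "real ^ 'l"
    have "(CLINT y|lborel. ?f b y) = char (normal_law \<sigma>) (v \<bullet> b)"
      unfolding char_def by (subst integral_density) auto
    then show "(CLINT y|lborel. ?f b y) = exp (- of_real (\<sigma>\<^sup>2 * (v \<bullet> b)\<^sup>2 / 2))"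
      by (simp only: char_normal_law [OF \<sigma>])
  qed
  also have "\<dots> = exp (- of_real (\<Sum>b\<in>Basis. \<sigma>\<^sup>2 * (v \<bullet> b)\<^sup>2 / 2))"
    by (simp add: exp_sum [symmetric] sum_negf)
  also have "(\<Sum>b\<in>Basis. \<sigma>\<^sup>2 * (v \<bullet> b)\<^sup>2 / 2) = \<sigma>\<^sup>2 * (norm v)\<^sup>2 / 2"
    unfolding power2_norm_eq_inner by (subst (2) euclidean_inner) (simp only: power2_eq_square sum_distrib_left sum_divide_distrib)
  finally show ?thesis .
qed

section \<open>Characteristic functions of sums of Brownian increments\<close>

lemma norm_disjoint_sum_sq:
  fixes v :: "'i \<Rightarrow> 'a::real_inner"
  assumes "finite K" and "disjoint_family_on S K"
  shows "(norm (\<Sum>i\<in>K. indicator (S i) x *\<^sub>R v i))\<^sup>2 = (\<Sum>i\<in>K. indicator (S i) x * (norm (v i))\<^sup>2)"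
proof -
  have "(norm (\<Sum>i\<in>K. indicator (S i) x *\<^sub>R v i))\<^sup>2
      = (\<Sum>i\<in>K. \<Sum>j\<in>K. (indicator (S i) x *\<^sub>R v i) \<bullet> (indicator (S j) x *\<^sub>R v j))"
    unfolding power2_norm_eq_inner inner_sum_left inner_sum_right by (rule sum.swap)
  also have "\<dots> = (\<Sum>i\<in>K. \<Sum>j\<in>K. if j = i then indicator (S i) x * (norm (v i))\<^sup>2 else 0)"
  proof (intro sum.cong refl)
    fix i j assume "i \<in> K" "j \<in> K"
    then have "i \<noteq> j \<Longrightarrow> x \<in> S i \<Longrightarrow> x \<notin> S j"
      using assms(2) by (auto simp: disjoint_family_on_def)
    then show "(indicator (S i) x *\<^sub>R v i) \<bullet> (indicator (S j) x *\<^sub>R v j) = (if j = i then indicator (S i) x * (norm (v i))\<^sup>2 else 0)"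
      by (auto simp: indicator_def power2_norm_eq_inner)
  qed
  also have "\<dots> = (\<Sum>i\<in>K. indicator (S i) x * (norm (v i))\<^sup>2)"
    using assms(1) by simp
  finally show ?thesis .
qed

lemma measure_lebesgue_on_Ioc:
  assumes "0 \<le> a" "a \<le> b" "b \<le> 1"
  shows "measure (lebesgue_on {0..1}) {a<..b::real} = b - a"
proof -
  have "{a<..b} \<subseteq> {0..1}" using assms by auto
  then show ?thesis using assms by (simp add: measure_restrict_space)
qed

text \<open>The sum over the cells whose left end is at least \<open>a\<close> and below
  \<open>b\<close> telescopes, since both are grid points. The range of \<open>g\<close> is kept
  general because the identity is applied both to a path and to the function
  \<open>of_bool (s \<le> t)\<close> of the time \<open>t\<close>.\<close>

lemma telescope_grid:
  fixes p :: "nat \<Rightarrow> real" and g :: "real \<Rightarrow> 'v::real_vector"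
  assumes p: "\<And>i j. i < j \<Longrightarrow> j \<le> N \<Longrightarrow> p i < p j"
    and a: "a \<in> p ` {..N}" and b: "b \<in> p ` {..N}" and ab: "a \<le> b"
  shows "g b - g a = (\<Sum>i<N. of_bool (a \<le> p i \<and> p i < b) *\<^sub>R (g (p (Suc i)) - g (p i)))"
proof -
  obtain m k where m: "m \<le> N" "a = p m" and k: "k \<le> N" "b = p k" using a b by auto
  have le: "p i \<le> p j \<longleftrightarrow> i \<le> j" if "i \<le> N" "j \<le> N" for i j
    using p [of i j] p [of j i] that by (cases i j rule: linorder_cases) auto
  have mk: "m \<le> k" using ab m k le by auto
  have "(\<Sum>i<N. of_bool (a \<le> p i \<and> p i < b) *\<^sub>R (g (p (Suc i)) - g (p i))) = (\<Sum>i\<in>{m..<k}. g (p (Suc i)) - g (p i))"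
  proof (rule sum.mono_neutral_cong_right)
    show "\<forall>i\<in>{..<N} - {m..<k}. of_bool (a \<le> p i \<and> p i < b) *\<^sub>R (g (p (Suc i)) - g (p i)) = 0"
      using m k le by (auto simp: not_le [symmetric])
    show "of_bool (a \<le> p i \<and> p i < b) *\<^sub>R (g (p (Suc i)) - g (p i)) = g (p (Suc i)) - g (p i)" if "i \<in> {m..<k}" for i
      using m k le that by (auto simp: not_le [symmetric])
  qed (use k in auto)
  also have "\<dots> = g (p k) - g (p m)" using mk by (rule sum_Suc_diff')
  finally show ?thesis using m k by simp
qed

text \<open>The intervals may overlap or be empty, so their endpoints are merged into one partition.
  On it the exponent and the integrand have the same coefficients \<open>h i\<close>; independence
  factors the expectation, and disjointness of the cells removes the mixed terms of the squared
  norm.\<close>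

theorem brownian_char:
  fixes B :: "real \<Rightarrow> 'w \<Rightarrow> real ^ 'l"
  assumes B: "brownian_motion M B" and K: "finite K"
    and ab: "\<And>\<alpha>. \<alpha> \<in> K \<Longrightarrow> 0 \<le> a \<alpha> \<and> a \<alpha> \<le> b \<alpha> \<and> b \<alpha> \<le> 1"
  shows "(CLINT w|M. iexp (\<Sum>\<alpha>\<in>K. v \<alpha> \<bullet> (B (b \<alpha>) w - B (a \<alpha>) w)))
    = exp (- of_real ((LINT s|lebesgue_on {0..1}. (norm (\<Sum>\<alpha>\<in>K. indicator {a \<alpha><..b \<alpha>} s *\<^sub>R v \<alpha>))\<^sup>2) / 2))"
proof -
  let ?g = "\<lambda>s. \<Sum>\<alpha>\<in>K. indicator {a \<alpha><..b \<alpha>} s *\<^sub>R v \<alpha>"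
  let ?W = "\<lambda>w. \<Sum>\<alpha>\<in>K. v \<alpha> \<bullet> (B (b \<alpha>) w - B (a \<alpha>) w)"
  interpret prob_space M using B by (simp add: brownian_motion_def)
  \<comment> \<open>The point 0 keeps \<open>S\<close> nonempty when \<open>K\<close> is empty, so
    that \<open>card S - 1\<close> is the number of cells.\<close>
  define S where "S = insert 0 (a ` K \<union> b ` K)"
  define p where "p i = sorted_list_of_set S ! i" for i
  let ?D = "\<lambda>i w. B (p (Suc i)) w - B (p i) w"
  define N where "N = card S - 1"
  have fS: "finite S" and "S \<noteq> {}" using K by (auto simp: S_def)
  then have "card S \<noteq> 0" by auto
  then have lenN: "length (sorted_list_of_set S) = Suc N" by (simp add: N_def)
  have p: "p i < p j" if "i < j" "j \<le> N" for i j
    using that lenN strict_sorted_list_of_set [of S] unfolding p_def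
    by (auto simp: sorted_wrt_iff_nth_less)
  have pS: "p ` {..N} = S"
  proof -
    have "S = set (sorted_list_of_set S)" using fS by simp
    also have "\<dots> = p ` {..N}" unfolding set_conv_nth lenN p_def by auto
    finally show ?thesis by simp
  qed
  have p01: "p i \<in> {0..1}" if "i \<le> N" for i
  proof -
    have "p i \<in> S" using pS that by auto
    then show ?thesis using ab by (fastforce simp: S_def)
  qed
  define h where "h i = (\<Sum>\<alpha>\<in>K. of_bool (a \<alpha> \<le> p i \<and> p i < b \<alpha>) *\<^sub>R v \<alpha>)" for i
  have tel: "g (b \<alpha>) - g (a \<alpha>) = (\<Sum>i<N. of_bool (a \<alpha> \<le> p i \<and> p i < b \<alpha>) *\<^sub>R (g (p (Suc i)) - g (p i)))"
    if "\<alpha> \<in> K" for \<alpha> and g :: "real \<Rightarrow> 'v::real_vector"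
    using that ab by (intro telescope_grid p) (auto simp: pS S_def)
  have 1: "?W w = (\<Sum>i<N. h i \<bullet> ?D i w)" for w
  proof -
    have "?W w
        = (\<Sum>\<alpha>\<in>K. \<Sum>i<N. of_bool (a \<alpha> \<le> p i \<and> p i < b \<alpha>) * (v \<alpha> \<bullet> ?D i w))"
      using tel [of _ "\<lambda>t. B t w"] by (intro sum.cong refl) (simp add: inner_sum_right)
    also have "\<dots> = (\<Sum>i<N. h i \<bullet> ?D i w)"
      by (subst sum.swap) (simp add: h_def inner_sum_left)
    finally show ?thesis .
  qed
  have 2: "?g s = (\<Sum>i<N. indicator {p i<..p (Suc i)} s *\<^sub>R h i)" for s
  proof -
    \<comment> \<open>An indicator is an increment of a function of time, so the telescoping used
      for the path applies to it as well.\<close>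
    have ind: "indicator {c<..d} s = (of_bool (s \<le> d) - of_bool (s \<le> c) :: real)" if "c \<le> d" for c d
      using that by (auto simp: indicator_def)
    have "?g s
       = (\<Sum>\<alpha>\<in>K. \<Sum>i<N. indicator {p i<..p (Suc i)} s *\<^sub>R of_bool (a \<alpha> \<le> p i \<and> p i < b \<alpha>) *\<^sub>R v \<alpha>)"
    proof (intro sum.cong refl)
      fix \<alpha> assume \<alpha>: "\<alpha> \<in> K"
      have "indicator {a \<alpha><..b \<alpha>} s = (of_bool (s \<le> b \<alpha>) - of_bool (s \<le> a \<alpha>) :: real)"
        using ab \<alpha> by (intro ind) auto
      also have "\<dots> = (\<Sum>i<N. of_bool (a \<alpha> \<le> p i \<and> p i < b \<alpha>) *\<^sub>R (of_bool (s \<le> p (Suc i)) - of_bool (s \<le> p i)))"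
        by (rule tel [OF \<alpha>, of "\<lambda>t. of_bool (s \<le> t)"])
      also have "\<dots> = (\<Sum>i<N. indicator {p i<..p (Suc i)} s * of_bool (a \<alpha> \<le> p i \<and> p i < b \<alpha>))"
        using p by (intro sum.cong refl, subst ind) (auto simp: less_imp_le)
      finally show "indicator {a \<alpha><..b \<alpha>} s *\<^sub>R v \<alpha> = (\<Sum>i<N. indicator {p i<..p (Suc i)} s *\<^sub>R of_bool (a \<alpha> \<le> p i \<and> p i < b \<alpha>) *\<^sub>R v \<alpha>)"
        by (simp only: scaleR_sum_left scaleR_scaleR)
    qed
    also have "\<dots> = (\<Sum>i<N. indicator {p i<..p (Suc i)} s *\<^sub>R h i)"
      by (subst sum.swap) (simp only: h_def scaleR_sum_right)
    finally show ?thesis .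
  qed
  have disj: "disjoint_family_on (\<lambda>i. {p i<..p (Suc i)}) {..<N}"
  proof -
    have "p (Suc i) \<le> p j" if "i < j" "j < N" for i j
      using p [of "Suc i" j] that by (cases "Suc i = j") auto
    then show ?thesis unfolding disjoint_family_on_def
      by (metis (no_types, lifting) Int_emptyI greaterThanAtMost_iff lessThan_iff linorder_neqE_nat not_less order_trans)
  qed
  have 3: "(LINT s|lebesgue_on {0..1}. (norm (?g s))\<^sup>2)
      = (\<Sum>i<N. (p (Suc i) - p i) * (norm (h i))\<^sup>2)"
  proof -
    have set: "{p i<..p (Suc i)} \<in> sets (lebesgue_on {0..1})" "measure (lebesgue_on {0..1}) {p i<..p (Suc i)} = p (Suc i) - p i"
        "emeasure (lebesgue_on {0..1}) {p i<..p (Suc i)} < \<infinity>"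
      if "i < N" for i
    proof -
      have "{p i<..p (Suc i)} \<subseteq> {0..1}" using p01 [of i] p01 [of "Suc i"] that by auto
      then show "{p i<..p (Suc i)} \<in> sets (lebesgue_on {0..1})"
        by (auto simp: sets_restrict_space_iff)
      show "emeasure (lebesgue_on {0..1}) {p i<..p (Suc i)} < \<infinity>"
        using finite_measure.emeasure_finite [OF finite_measure_lebesgue_on [of "{0..1::real}"]]
        by (simp add: less_top)
      show "measure (lebesgue_on {0..1}) {p i<..p (Suc i)} = p (Suc i) - p i"
        using p01 [of i] p01 [of "Suc i"] that p [of i "Suc i"] by (intro measure_lebesgue_on_Ioc) auto
    qed
    have "(LINT s|lebesgue_on {0..1}. (norm (?g s))\<^sup>2)
      = (LINT s|lebesgue_on {0..1}. (\<Sum>i<N. indicator {p i<..p (Suc i)} s * (norm (h i))\<^sup>2))"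
      unfolding 2 by (subst norm_disjoint_sum_sq [OF _ disj]) auto
    also have "\<dots> = (\<Sum>i<N. LINT s|lebesgue_on {0..1}. indicator {p i<..p (Suc i)} s * (norm (h i))\<^sup>2)"
      using set by (intro Bochner_Integration.integral_sum) auto
    also have "\<dots> = (\<Sum>i<N. (p (Suc i) - p i) * (norm (h i))\<^sup>2)"
    proof (intro sum.cong refl)
      fix i assume i: "i \<in> {..<N}"
      then have "{p i<..p (Suc i)} \<inter> {0..1} = {p i<..p (Suc i)}"
        using p01 [of i] p01 [of "Suc i"] by auto
      then show "(LINT s|lebesgue_on {0..1}. indicator {p i<..p (Suc i)} s * (norm (h i))\<^sup>2) = (p (Suc i) - p i) * (norm (h i))\<^sup>2"
        using set [of i] i by simp
    qed
    finally show ?thesis .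
  qed
  have [measurable]: "B t \<in> borel_measurable M" if "t \<in> {0..1}" for t
    using B that by (simp add: brownian_motion_def)
  have mD: "(\<lambda>w. ?D i w) \<in> borel_measurable M" if "i < N" for i
    using p01 [of i] p01 [of "Suc i"] that by (intro borel_measurable_diff) auto
  have "indep_vars (\<lambda>_. borel) (\<lambda>k w. B (p (Suc k)) w - B (p k) w) {..<N}"
  proof -
    have "(\<forall>k\<le>N. p k \<in> {0..1}) \<and> (\<forall>k<N. p k < p (Suc k))" using p01 p by auto
    then show ?thesis using B unfolding brownian_motion_def by blast
  qed
  then have ind: "indep_vars (\<lambda>_. borel) (\<lambda>i w. iexp (h i \<bullet> ?D i w)) {..<N}"
    by (rule indep_vars_compose2 [where Y = "\<lambda>i x. iexp (h i \<bullet> x)"]) measurable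
  have "(CLINT w|M. iexp (?W w))
      = (CLINT w|M. \<Prod>i<N. iexp (h i \<bullet> ?D i w))"
    unfolding 1 by (simp add: exp_sum sum_distrib_left)
  also have "\<dots> = (\<Prod>i<N. CLINT w|M. iexp (h i \<bullet> ?D i w))"
    using mD by (intro indep_vars_lebesgue_integral ind) (auto intro!: integrable_const_bound [where B = 1])
  also have "\<dots> = (\<Prod>i<N. exp (- of_real ((p (Suc i) - p i) * (norm (h i))\<^sup>2 / 2)))"
  proof (intro prod.cong refl)
    fix i assume i: "i \<in> {..<N}"
    then have pp: "0 \<le> p i" "p i < p (Suc i)" "p (Suc i) \<le> 1" using p p01 [of i] p01 [of "Suc i"] by auto
    then have D: "distributed M lborel (\<lambda>w. ?D i w)
          (\<lambda>x. ennreal (\<Prod>j\<in>UNIV. normal_density 0 (sqrt (p (Suc i) - p i)) (x $ j)))"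
      using B unfolding brownian_motion_def by blast
    show "(CLINT w|M. iexp (h i \<bullet> ?D i w)) = exp (- of_real ((p (Suc i) - p i) * (norm (h i))\<^sup>2 / 2))"
      using char_gaussian_vector [OF D, of "h i"] pp by simp
  qed
  also have "\<dots> = exp (- of_real ((\<Sum>i<N. (p (Suc i) - p i) * (norm (h i))\<^sup>2) / 2))"
    by (simp add: exp_sum [symmetric] sum_negf sum_divide_distrib)
  finally show ?thesis unfolding 3 .
qed

section \<open>Increments of the stochastic integral\<close>

text \<open>By Young's inequality the difference of the squared norms is at most
  \<open>1 + 1 / e j\<close> times the squared distance plus \<open>e j\<close> times the squared
  norm of \<open>f\<close>. Letting \<open>e j\<close> tend to 0 more slowly than the squared
  distance makes both terms vanish.\<close>

lemma integral_norm_sq_tendsto: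
  fixes F :: "nat \<Rightarrow> 'a \<Rightarrow> 'b::{second_countable_topology, real_normed_vector}"
  assumes [measurable]: "\<And>j. F j \<in> borel_measurable M" "f \<in> borel_measurable M"
    and F: "\<And>j. integrable M (\<lambda>x. (norm (F j x))\<^sup>2)" and f: "integrable M (\<lambda>x. (norm (f x))\<^sup>2)"
    and lim: "(\<lambda>j. \<integral>\<^sup>+x. ennreal ((norm (F j x - f x))\<^sup>2) \<partial>M) \<longlonglongrightarrow> 0"
  shows "(\<lambda>j. \<integral>x. (norm (F j x))\<^sup>2 \<partial>M) \<longlonglongrightarrow> (\<integral>x. (norm (f x))\<^sup>2 \<partial>M)"
proof -
  let ?d = "\<lambda>j x. norm (F j x - f x)"
  have d: "integrable M (\<lambda>x. (?d j x)\<^sup>2)" for j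
  proof (rule Bochner_Integration.integrable_bound)
    show "integrable M (\<lambda>x. 2 * (norm (F j x))\<^sup>2 + 2 * (norm (f x))\<^sup>2)" using F f by simp
    have "(?d j x)\<^sup>2 \<le> 2 * (norm (F j x))\<^sup>2 + 2 * (norm (f x))\<^sup>2" for x
    proof -
      have "(?d j x)\<^sup>2 \<le> (norm (F j x) + norm (f x))\<^sup>2"
        by (intro power_mono norm_triangle_ineq4) auto
      also have "\<dots> \<le> 2 * (norm (F j x))\<^sup>2 + 2 * (norm (f x))\<^sup>2"
        using zero_le_power2 [of "norm (F j x) - norm (f x)"] by (simp add: power2_eq_square algebra_simps)
      finally show ?thesis .
    qed
    then show "AE x in M. norm ((?d j x)\<^sup>2) \<le> norm (2 * (norm (F j x))\<^sup>2 + 2 * (norm (f x))\<^sup>2)"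
      by simp
  qed measurable
  define X where "X j = (\<integral>x. (?d j x)\<^sup>2 \<partial>M)" for j
  define c where "c = (\<integral>x. (norm (f x))\<^sup>2 \<partial>M)"
  have X0: "0 \<le> X j" for j by (simp add: X_def)
  have "(\<lambda>j. ennreal (X j)) \<longlonglongrightarrow> ennreal 0"
    using lim unfolding X_def by (subst nn_integral_eq_integral [symmetric, OF d]) auto
  then have X: "X \<longlonglongrightarrow> 0" using X0 by (subst (asm) tendsto_ennreal_iff) auto
  \<comment> \<open>With this choice \<open>X j / e j\<close> is at most \<open>sqrt (X j)\<close>;
    the summand \<open>1 / real (Suc j)\<close> keeps \<open>e j\<close> positive when
    \<open>X j = 0\<close>.\<close>
  define e where "e j = sqrt (X j) + 1 / real (Suc j)" for j
  have e0: "0 < e j" for j using X0 by (simp add: e_def add_nonneg_pos)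
  have bound: "\<bar>(\<integral>x. (norm (F j x))\<^sup>2 \<partial>M) - c\<bar> \<le> X j + sqrt (X j) + e j * c" for j
  proof -
    have pt: "\<bar>(norm (F j x))\<^sup>2 - (norm (f x))\<^sup>2\<bar> \<le> (1 + 1 / e j) * (?d j x)\<^sup>2 + e j * (norm (f x))\<^sup>2" for x
    proof -
      let ?p = "norm (F j x)" and ?q = "norm (f x)" and ?r = "?d j x"
      have 1: "\<bar>?p - ?q\<bar> \<le> ?r" by (rule norm_triangle_ineq3)
      have "\<bar>?p\<^sup>2 - ?q\<^sup>2\<bar> = \<bar>?p - ?q\<bar> * (?p + ?q)"
        by (simp add: power2_eq_square square_diff_square_factored abs_mult)
      also have "\<dots> \<le> ?r * (?r + 2 * ?q)"
        using 1 by (intro mult_mono) auto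
      also have "\<dots> = ?r\<^sup>2 + 2 * ?r * ?q" by (simp add: power2_eq_square algebra_simps)
      also have "2 * ?r * ?q \<le> (1 / e j) * ?r\<^sup>2 + e j * ?q\<^sup>2"
      proof -
        have "0 \<le> (?r - e j * ?q)\<^sup>2 / e j" using e0 [of j] by simp
        also have "\<dots> = (1 / e j) * ?r\<^sup>2 + e j * ?q\<^sup>2 - 2 * ?r * ?q"
          using e0 [of j] by (simp add: power2_eq_square field_simps)
        finally show ?thesis by simp
      qed
      finally show ?thesis by (simp add: algebra_simps)
    qed
    have "\<bar>(\<integral>x. (norm (F j x))\<^sup>2 \<partial>M) - c\<bar> = \<bar>\<integral>x. (norm (F j x))\<^sup>2 - (norm (f x))\<^sup>2 \<partial>M\<bar>"
      using F f by (simp add: c_def)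
    also have "\<dots> \<le> (\<integral>x. \<bar>(norm (F j x))\<^sup>2 - (norm (f x))\<^sup>2\<bar> \<partial>M)"
      by (rule integral_abs_bound)
    also have "\<dots> \<le> (\<integral>x. (1 + 1 / e j) * (?d j x)\<^sup>2 + e j * (norm (f x))\<^sup>2 \<partial>M)"
      using F f d pt by (intro integral_mono) auto
    also have "\<dots> = (1 + 1 / e j) * X j + e j * c"
      using d f by (simp add: X_def c_def)
    also have "(1 + 1 / e j) * X j \<le> X j + sqrt (X j)"
    proof -
      have "X j = sqrt (X j) * sqrt (X j)" using X0 by simp
      also have "\<dots> \<le> sqrt (X j) * e j" using X0 by (intro mult_left_mono) (auto simp: e_def)
      finally have "X j / e j \<le> sqrt (X j)" using e0 [of j] by (simp add: field_simps)
      then show ?thesis by (simp add: distrib_right)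
    qed
    finally show ?thesis by simp
  qed
  have "(\<lambda>j. X j + sqrt (X j) + e j * c) \<longlonglongrightarrow> 0 + sqrt 0 + (sqrt 0 + 0) * c"
    unfolding e_def by (intro tendsto_intros X lim_1_over_n LIMSEQ_Suc [OF lim_1_over_n])
  then have lim0: "(\<lambda>j. X j + sqrt (X j) + e j * c) \<longlonglongrightarrow> 0" by simp
  have ev: "eventually (\<lambda>j. norm ((\<integral>x. (norm (F j x))\<^sup>2 \<partial>M) - c) \<le> X j + sqrt (X j) + e j * c) sequentially"
    by (rule always_eventually) (simp only: real_norm_def bound simp_thms)
  have "(\<lambda>j. (\<integral>x. (norm (F j x))\<^sup>2 \<partial>M) - c) \<longlonglongrightarrow> 0"
    by (rule Lim_null_comparison [OF ev lim0])
  then show ?thesis unfolding c_def by (rule LIM_zero_cancel)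
qed

text \<open>The pointwise bound \<open>f \<le> e + f\<^sup>2 / e\<close> takes the place of the
  Cauchy-Schwarz inequality and remains meaningful for infinite integrals.\<close>

lemma (in prob_space) nn_integral_tendsto_0_of_sq:
  fixes f :: "nat \<Rightarrow> 'a \<Rightarrow> real"
  assumes [measurable]: "\<And>j. f j \<in> borel_measurable M" and f: "\<And>j x. x \<in> space M \<Longrightarrow> 0 \<le> f j x"
    and lim: "(\<lambda>j. \<integral>\<^sup>+x. ennreal ((f j x)\<^sup>2) \<partial>M) \<longlonglongrightarrow> 0"
  shows "(\<lambda>j. \<integral>\<^sup>+x. ennreal (f j x) \<partial>M) \<longlonglongrightarrow> 0"
proof (rule order_tendstoI)
  fix a :: ennreal assume a: "0 < a"
  obtain e :: real where e: "0 < e" "ennreal (2 * e) < a"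
  proof -
    obtain r where r: "0 < r" "r < a" using dense [OF a] by blast
    then obtain r' where r': "r = ennreal r'" "0 < r'" by (cases r) auto
    then show ?thesis using that [of "r' / 2"] r by simp
  qed
  have "eventually (\<lambda>j. (\<integral>\<^sup>+x. ennreal ((f j x)\<^sup>2) \<partial>M) < ennreal (e\<^sup>2)) sequentially"
    by (rule order_tendstoD(2) [OF lim]) (use e in simp)
  then show "eventually (\<lambda>j. (\<integral>\<^sup>+x. ennreal (f j x) \<partial>M) < a) sequentially"
  proof eventually_elim
    case (elim j)
    have "(\<integral>\<^sup>+x. ennreal (f j x) \<partial>M) \<le> (\<integral>\<^sup>+x. ennreal e + ennreal (1 / e) * ennreal ((f j x)\<^sup>2) \<partial>M)"
    proof (intro nn_integral_mono)
      fix x assume "x \<in> space M"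
      have "f j x \<le> e + (f j x)\<^sup>2 / e"
      proof -
        have "0 \<le> (f j x - e / 2)\<^sup>2 / e" using e by simp
        also have "\<dots> = (f j x)\<^sup>2 / e - f j x + e / 4" using e by (simp add: power2_eq_square field_simps)
        finally show ?thesis using e by simp
      qed
      then show "ennreal (f j x) \<le> ennreal e + ennreal (1 / e) * ennreal ((f j x)\<^sup>2)"
        using e by (simp add: ennreal_mult' [symmetric] ennreal_plus [symmetric] del: ennreal_plus)
    qed
    also have "\<dots> = ennreal e + ennreal (1 / e) * (\<integral>\<^sup>+x. ennreal ((f j x)\<^sup>2) \<partial>M)"
      by (simp add: nn_integral_add nn_integral_cmult emeasure_space_1)
    also have "\<dots> \<le> ennreal e + ennreal (1 / e) * ennreal (e\<^sup>2)"
      using elim by (intro add_left_mono mult_left_mono) auto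
    also have "\<dots> = ennreal (2 * e)"
      using e by (simp add: ennreal_mult' [symmetric] ennreal_plus [symmetric] power2_eq_square del: ennreal_plus)
    also have "\<dots> < a" by fact
    finally show ?case .
  qed
qed simp

lemma iexp_dist_le: "norm (iexp x - iexp y) \<le> \<bar>x - y\<bar>"
proof -
  have "norm (iexp x - iexp y) = norm (iexp y * (iexp (x - y) - 1))"
    by (simp add: right_diff_distrib exp_diff)
  also have "\<dots> = norm (iexp (x - y) - 1)" by (simp add: norm_mult)
  also have "\<dots> \<le> \<bar>x - y\<bar>" using iexp_approx1 [of "x - y" 0] by simp
  finally show ?thesis .
qed

text \<open>Clipping a time at \<open>r'\<close> and subtracting the clipping at \<open>r\<close>
  amounts, up to the constant \<open>B r w\<close>, to clamping the time to the interval from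
  \<open>r\<close> to \<open>r'\<close>. The constant cancels in differences, so the increment is
  again a combination of Brownian increments.\<close>

lemma step_integral_increment:
  assumes "r \<le> r'"
  shows "u \<bullet> (step_integral B m t A r' w - step_integral B m t A r w)
    = (\<Sum>i<m. (transpose (A i) *v u) \<bullet> (B (max r (min (t (Suc i)) r')) w - B (max r (min (t i) r')) w))"
proof -
  have clamp: "B (max r (min x r')) w = B r w + B (min x r') w - B (min x r) w" for x
    using assms by (cases "x \<le> r") (auto simp: min_def max_def)
  show ?thesis
    by (simp add: step_integral_def sum_subtractf [symmetric] inner_sum_right inner_matrix_vec
        matrix_vector_mult_diff_distrib [symmetric] clamp inner_diff_right inner_add_right
        del: transpose_matrix_vector cong: sum.cong)
      (simp only: algebra_simps)
qed

lemma bounded_linear_transpose_vec: "bounded_linear (\<lambda>X :: real ^ 'l ^ 'l. transpose X *v u)"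
  by (intro linear_conv_bounded_linear [THEN iffD1] linearI)
     (simp_all add: vec_eq_iff transpose_def matrix_vector_mult_def sum.distrib distrib_right
       scaleR_sum_right mult.assoc sum_distrib_left)

text \<open>For elementary integrals the formula is an instance of \<open>brownian_char\<close>.
  Along the approximating step functions the left side converges because \<open>iexp\<close> is
  1-Lipschitz and L2 convergence implies L1 convergence; the right side converges because the
  integrand is a bounded linear image of the step function.\<close>

theorem stochastic_integral_char:
  fixes B Y :: "real \<Rightarrow> 'w \<Rightarrow> real ^ 'l"
  assumes B: "brownian_motion M B" and Y: "stochastic_integral M B \<sigma> Y"
    and r: "\<And>k. k < n \<Longrightarrow> r k \<le> r (Suc k)" "\<And>k. k \<le> n \<Longrightarrow> r k \<in> {0..1}"
  shows "(CLINT w|M. iexp (\<Sum>k<n. u k \<bullet> (Y (r (Suc k)) w - Y (r k) w)))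
    = exp (- of_real ((LINT s|lebesgue_on {0..1}. (norm (\<Sum>k<n. indicator {r k<..r (Suc k)} s *\<^sub>R (transpose (\<sigma> s) *v u k)))\<^sup>2) / 2))"
proof -
  interpret prob_space M using B by (simp add: brownian_motion_def)
  let ?L = "lebesgue_on {0..1::real}"
  have sm [measurable]: "\<sigma> \<in> borel_measurable ?L" and sfin: "(\<integral>\<^sup>+ s. ennreal ((norm (\<sigma> s))\<^sup>2) \<partial>?L) < \<infinity>"
    using Y by (simp_all add: stochastic_integral_def)
  have Bm [measurable]: "B t \<in> borel_measurable M" if "t \<in> {0..1}" for t
    using B that by (simp add: brownian_motion_def)
  have Ym [measurable]: "Y t \<in> borel_measurable M" if "t \<in> {0..1}" for t
    using Y that by (simp add: stochastic_integral_def)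
  obtain m t A where t: "\<And>j k. k \<le> m j \<Longrightarrow> t j k \<in> {0..1}" "\<And>j k. k < m j \<Longrightarrow> t j k < t j (Suc k)"
    and L2: "(\<lambda>j. \<integral>\<^sup>+ s. ennreal ((norm (step_fun (m j) (t j) (A j) s - \<sigma> s))\<^sup>2) \<partial>?L) \<longlonglongrightarrow> 0"
    and L2Y: "\<And>r. r \<in> {0..1} \<Longrightarrow> (\<lambda>j. \<integral>\<^sup>+ w. ennreal ((norm (step_integral B (m j) (t j) (A j) r w - Y r w))\<^sup>2) \<partial>M) \<longlonglongrightarrow> 0"
    using Y unfolding stochastic_integral_def by (elim conjE exE) blast
  let ?F = "\<lambda>j. step_fun (m j) (t j) (A j)"
  define S where "S j = step_integral B (m j) (t j) (A j)" for j
  \<comment> \<open>\<open>T\<close> is linear in \<open>X\<close> with a norm bound uniform in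
    \<open>s\<close>, so the L2 convergence of the step functions carries over to their
    images.\<close>
  define T where "T X s = (\<Sum>k<n. indicator {r k<..r (Suc k)} s *\<^sub>R (transpose X *v u k))" for X :: "real ^ 'l ^ 'l" and s
  have Tdiff: "T X s - T X' s = T (X - X') s" for X X' s
    by (simp add: T_def sum_subtractf [symmetric] scaleR_diff_right [symmetric]
        linear_diff [OF bounded_linear.linear [OF bounded_linear_transpose_vec]] del: transpose_matrix_vector)
  obtain C where C: "\<And>X s. norm (T X s) \<le> C * norm X" "0 \<le> C"
  proof -
    have "\<exists>K>0. \<forall>X :: real ^ 'l ^ 'l. norm (transpose X *v u k) \<le> norm X * K" for k
      using bounded_linear.pos_bounded [OF bounded_linear_transpose_vec] .
    then obtain K where K: "\<And>k. K k > 0" "\<And>k X :: real ^ 'l ^ 'l. norm (transpose X *v u k) \<le> norm X * K k"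
      by metis
    have "norm (T X s) \<le> (\<Sum>k<n. K k) * norm X" for X s
      unfolding T_def sum_distrib_right
    proof (rule sum_norm_le)
      fix k
      have "norm (indicator {r k<..r (Suc k)} s *\<^sub>R (transpose X *v u k)) \<le> norm (transpose X *v u k)"
        by (simp add: indicator_def)
      also have "\<dots> \<le> K k * norm X" using K(2) [of X k] by (simp add: mult.commute)
      finally show "norm (indicator {r k<..r (Suc k)} s *\<^sub>R (transpose X *v u k)) \<le> K k * norm X" .
    qed
    moreover have "0 \<le> (\<Sum>k<n. K k)" by (intro sum_nonneg) (use K(1) in \<open>auto simp: less_imp_le\<close>)
    ultimately show ?thesis using that by blast
  qed
  have indm [measurable]: "(\<lambda>s. indicator {a<..b} s :: real) \<in> borel_measurable ?L" for a b
    by (intro measurable_restrict_space1 measurable_completion borel_measurable_indicator) simp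
  have Tm: "(\<lambda>s. T (f s) s) \<in> borel_measurable ?L" if [measurable]: "f \<in> borel_measurable ?L" for f
  proof -
    have "(\<lambda>s. transpose (f s) *v u k) \<in> borel_measurable ?L" for k
      by (rule measurable_compose [OF that])
         (intro borel_measurable_continuous_onI linear_continuous_on bounded_linear_transpose_vec)
    then show ?thesis unfolding T_def by measurable
  qed
  have stepm: "?F j \<in> borel_measurable ?L" for j
    unfolding step_fun_def by measurable
  have sint: "integrable ?L (\<lambda>s. (norm (\<sigma> s))\<^sup>2)"
    using sfin by (intro integrableI_bounded) auto
  have stepint: "integrable ?L (\<lambda>s. (norm (?F j s))\<^sup>2)" for j
  proof -
    interpret L: finite_measure ?L by (rule finite_measure_lebesgue_on) simp
    have b: "norm (?F j s) \<le> (\<Sum>k<m j. norm (A j k))" for s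
      unfolding step_fun_def by (rule sum_norm_le) (simp add: indicator_def)
    show ?thesis
      by (rule L.integrable_const_bound [where B = "(\<Sum>k<m j. norm (A j k))\<^sup>2"])
         (use stepm b in \<open>auto intro!: power_mono\<close>)
  qed
  have Tint: "integrable ?L (\<lambda>s. (norm (T (f s) s))\<^sup>2)"
    if [measurable]: "f \<in> borel_measurable ?L" and "integrable ?L (\<lambda>s. (norm (f s))\<^sup>2)" for f
  proof (rule Bochner_Integration.integrable_bound)
    show "integrable ?L (\<lambda>s. C\<^sup>2 * (norm (f s))\<^sup>2)" using that by simp
    show "(\<lambda>s. (norm (T (f s) s))\<^sup>2) \<in> borel_measurable ?L" using Tm by measurable
    show "AE s in ?L. norm ((norm (T (f s) s))\<^sup>2) \<le> norm (C\<^sup>2 * (norm (f s))\<^sup>2)"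
      using power_mono [OF C(1), of _ _ 2] by (simp add: power_mult_distrib)
  qed
  let ?N1 = "\<lambda>j. \<integral>\<^sup>+s. ennreal ((norm (T (?F j s) s - T (\<sigma> s) s))\<^sup>2) \<partial>?L"
  let ?N2 = "\<lambda>j. ennreal (C\<^sup>2) * (\<integral>\<^sup>+ s. ennreal ((norm (?F j s - \<sigma> s))\<^sup>2) \<partial>?L)"
  have limT: "(?N1) \<longlonglongrightarrow> 0"
  proof (rule tendsto_sandwich [where f = "\<lambda>_. 0"])
    show "eventually (\<lambda>j. ?N1 j
      \<le> ?N2 j) sequentially"
    proof (intro always_eventually allI)
      fix j
      have [measurable]: "?F j \<in> borel_measurable ?L" by (rule stepm)
      have "(norm (T (?F j s) s - T (\<sigma> s) s))\<^sup>2 \<le> C\<^sup>2 * (norm (?F j s - \<sigma> s))\<^sup>2" for s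
        unfolding Tdiff power_mult_distrib [symmetric] by (intro power_mono C) auto
      then have "?N1 j
        \<le> (\<integral>\<^sup>+s. ennreal (C\<^sup>2) * ennreal ((norm (?F j s - \<sigma> s))\<^sup>2) \<partial>?L)"
        by (intro nn_integral_mono) (simp add: ennreal_mult' [symmetric])
      then show "?N1 j
         \<le> ?N2 j"
        by (subst (asm) nn_integral_cmult) auto
    qed
    have "(\<lambda>j. ?N2 j) \<longlonglongrightarrow> ennreal (C\<^sup>2) * 0"
      by (rule ennreal_tendsto_cmult [OF _ L2]) simp
    then show "(\<lambda>j. ?N2 j) \<longlonglongrightarrow> 0" by simp
  qed auto
  have lim1: "(\<lambda>j. LINT s|?L. (norm (T (?F j s) s))\<^sup>2) \<longlonglongrightarrow> (LINT s|?L. (norm (T (\<sigma> s) s))\<^sup>2)"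
    by (rule integral_norm_sq_tendsto [OF Tm Tm Tint Tint limT]) (use stepm stepint sint in auto)
  let ?W = "\<lambda>j w. \<Sum>k<n. u k \<bullet> (S j (r (Suc k)) w - S j (r k) w)"
  let ?V = "\<lambda>w. \<Sum>k<n. u k \<bullet> (Y (r (Suc k)) w - Y (r k) w)"
  have char_W: "(CLINT w|M. iexp (?W j w)) = exp (- of_real ((LINT s|?L. (norm (T (?F j s) s))\<^sup>2) / 2))" for j
  proof -
    \<comment> \<open>Each pair combines a grid interval with a step interval; the clamped endpoints
      delimit their intersection, and coincide when it is empty.\<close>
    let ?K = "{..<n} \<times> {..<m j}"
    let ?c = "\<lambda>k i. max (r k) (min (t j i) (r (Suc k)))"
    let ?v = "\<lambda>\<alpha>. transpose (A j (snd \<alpha>)) *v u (fst \<alpha>)"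
    let ?g = "\<lambda>s. \<Sum>\<alpha>\<in>?K. indicator {?c (fst \<alpha>) (snd \<alpha>)<..?c (fst \<alpha>) (Suc (snd \<alpha>))} s *\<^sub>R ?v \<alpha>"
    have cp: "(\<Sum>\<alpha>\<in>?K. F (fst \<alpha>) (snd \<alpha>)) = (\<Sum>k<n. \<Sum>i<m j. F k i)" for F :: "nat \<Rightarrow> nat \<Rightarrow> 'v::comm_monoid_add"
      by (simp add: sum.cartesian_product split_def)
    have "?W j w = (\<Sum>\<alpha>\<in>?K. ?v \<alpha> \<bullet> (B (?c (fst \<alpha>) (Suc (snd \<alpha>))) w - B (?c (fst \<alpha>) (snd \<alpha>)) w))" for w
      unfolding cp [of "\<lambda>k i. (transpose (A j i) *v u k) \<bullet> (B (?c k (Suc i)) w - B (?c k i) w)"] S_def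
      by (intro sum.cong refl step_integral_increment r(1)) simp
    then have "(CLINT w|M. iexp (?W j w)) = (CLINT w|M. iexp (\<Sum>\<alpha>\<in>?K. ?v \<alpha> \<bullet> (B (?c (fst \<alpha>) (Suc (snd \<alpha>))) w - B (?c (fst \<alpha>) (snd \<alpha>)) w)))"
      by (simp only:)
    also have "\<dots> = exp (- of_real ((LINT s|?L. (norm (?g s))\<^sup>2) / 2))"
    proof (rule brownian_char [OF B])
      fix \<alpha> assume "\<alpha> \<in> ?K"
      then obtain k i where [simp]: "\<alpha> = (k, i)" and k: "k < n" and i: "i < m j" by auto
      have "0 \<le> ?c k i" "?c k i \<le> ?c k (Suc i)" "?c k (Suc i) \<le> 1"
        using r(2) [of k] r(2) [of "Suc k"] t(2) [OF i] k
        by (auto simp: le_max_iff_disj intro: min.coboundedI2 max.mono min.mono)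
      then show "0 \<le> ?c (fst \<alpha>) (snd \<alpha>) \<and> ?c (fst \<alpha>) (snd \<alpha>) \<le> ?c (fst \<alpha>) (Suc (snd \<alpha>)) \<and> ?c (fst \<alpha>) (Suc (snd \<alpha>)) \<le> 1"
        by simp
    qed simp
    also have "?g = (\<lambda>s. T (?F j s) s)"
    proof
      fix s
      have "?g s
          = (\<Sum>k<n. \<Sum>i<m j. indicator {?c k i<..?c k (Suc i)} s *\<^sub>R (transpose (A j i) *v u k))"
        by (rule cp)
      also have "\<dots> = (\<Sum>k<n. \<Sum>i<m j. indicator {r k<..r (Suc k)} s *\<^sub>R indicator {t j i<..t j (Suc i)} s *\<^sub>R (transpose (A j i) *v u k))"
      proof (intro sum.cong refl)
        fix k i assume "k \<in> {..<n}" "i \<in> {..<m j}"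
        then have "r k \<le> r (Suc k)" "t j i < t j (Suc i)" using r t by auto
        then show "indicator {?c k i<..?c k (Suc i)} s *\<^sub>R (transpose (A j i) *v u k)
          = indicator {r k<..r (Suc k)} s *\<^sub>R indicator {t j i<..t j (Suc i)} s *\<^sub>R (transpose (A j i) *v u k)"
          by (auto simp: indicator_def)
      qed
      also have "\<dots> = T (?F j s) s"
        unfolding T_def step_fun_def
          linear_sum [OF bounded_linear.linear [OF bounded_linear_transpose_vec]]
          linear_cmul [OF bounded_linear.linear [OF bounded_linear_transpose_vec]]
        by (simp only: scaleR_sum_right)
      finally show "?g s = T (?F j s) s" .
    qed
    finally show ?thesis .
  qed
  have Sm [measurable]: "S j x \<in> borel_measurable M" if "x \<in> {0..1}" for j x
  proof -
    have 1: "min (t j k) x \<in> {0..1}" if "k \<le> m j" for k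
      using t(1) [OF that] \<open>x \<in> {0..1}\<close> by (auto simp: min_def)
    have "(\<lambda>w. A j k *v (B (min (t j (Suc k)) x) w - B (min (t j k) x) w)) \<in> borel_measurable M" if "k < m j" for k
    proof -
      have "(\<lambda>w. B (min (t j (Suc k)) x) w - B (min (t j k) x) w) \<in> borel_measurable M"
        using 1 [of k] 1 [of "Suc k"] that by (intro borel_measurable_diff Bm) auto
      then show ?thesis
        by (rule measurable_compose) (intro borel_measurable_continuous_onI linear_continuous_on matrix_vector_mul_bounded_linear)
    qed
    then have "(\<lambda>w. S j x w) \<in> borel_measurable M" unfolding S_def step_integral_def by (intro borel_measurable_sum) auto
    then show ?thesis by simp
  qed
  have rm: "r k \<in> {0..1}" "r (Suc k) \<in> {0..1}" if "k < n" for k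
    using r(2) [of k] r(2) [of "Suc k"] that by auto
  have Wm [measurable]: "?W j \<in> borel_measurable M" for j
    by (intro borel_measurable_sum borel_measurable_inner borel_measurable_diff Sm rm) auto
  have Vm [measurable]: "?V \<in> borel_measurable M"
    by (intro borel_measurable_sum borel_measurable_inner borel_measurable_diff Ym rm) auto
  have iexp_int: "integrable M (\<lambda>w. iexp (f w))" if "f \<in> borel_measurable M" for f
    using that by (intro integrable_const_bound [where B = 1]) auto
  let ?e = "\<lambda>j x w. norm (S j x w - Y x w)"
  have em: "(\<lambda>w. ?e j x w) \<in> borel_measurable M" if "x \<in> {0..1}" for j x
    by (rule measurable_compose [OF _ borel_measurable_norm]) (intro borel_measurable_diff Sm Ym that)
  have e0: "(\<lambda>j. \<integral>\<^sup>+w. ennreal (?e j x w) \<partial>M) \<longlonglongrightarrow> 0" if "x \<in> {0..1}" for x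
    by (rule nn_integral_tendsto_0_of_sq) (simp_all only: em [OF that] norm_ge_zero L2Y [OF that, folded S_def])
  have "(\<lambda>j. \<integral>\<^sup>+w. norm (iexp (?W j w) - iexp (?V w)) \<partial>M) \<longlonglongrightarrow> 0"
  proof (rule tendsto_sandwich [where f = "\<lambda>_. 0"])
    let ?b = "\<lambda>j. \<Sum>k<n. ennreal (norm (u k)) * ((\<integral>\<^sup>+w. ennreal (?e j (r (Suc k)) w) \<partial>M) + (\<integral>\<^sup>+w. ennreal (?e j (r k) w) \<partial>M))"
    show "eventually (\<lambda>j. (\<integral>\<^sup>+w. norm (iexp (?W j w) - iexp (?V w)) \<partial>M) \<le> ?b j) sequentially"
    proof (intro always_eventually allI)
      fix j
      let ?p = "\<lambda>k w. norm (u k) * (?e j (r (Suc k)) w + ?e j (r k) w)"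
      have pt: "norm (iexp (?W j w) - iexp (?V w)) \<le> (\<Sum>k<n. ?p k w)" for w
      proof -
        have "norm (iexp (?W j w) - iexp (?V w)) \<le> \<bar>?W j w - ?V w\<bar>" by (rule iexp_dist_le)
        also have "\<dots> \<le> (\<Sum>k<n. \<bar>u k \<bullet> (S j (r (Suc k)) w - S j (r k) w) - u k \<bullet> (Y (r (Suc k)) w - Y (r k) w)\<bar>)"
          unfolding sum_subtractf [symmetric] by (rule sum_abs)
        also have "\<dots> \<le> (\<Sum>k<n. ?p k w)"
        proof (rule sum_mono)
          fix k
          have "\<bar>u k \<bullet> (S j (r (Suc k)) w - S j (r k) w) - u k \<bullet> (Y (r (Suc k)) w - Y (r k) w)\<bar>
            = \<bar>u k \<bullet> ((S j (r (Suc k)) w - Y (r (Suc k)) w) - (S j (r k) w - Y (r k) w))\<bar>"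
            by (simp add: inner_diff_right algebra_simps)
          also have "\<dots> \<le> norm (u k) * norm ((S j (r (Suc k)) w - Y (r (Suc k)) w) - (S j (r k) w - Y (r k) w))"
            by (rule Cauchy_Schwarz_ineq2)
          also have "\<dots> \<le> ?p k w"
            by (intro mult_left_mono norm_triangle_ineq4) simp
          finally show "\<bar>u k \<bullet> (S j (r (Suc k)) w - S j (r k) w) - u k \<bullet> (Y (r (Suc k)) w - Y (r k) w)\<bar> \<le> ?p k w" .
        qed
        finally show ?thesis .
      qed
      have "(\<integral>\<^sup>+w. norm (iexp (?W j w) - iexp (?V w)) \<partial>M) \<le> (\<integral>\<^sup>+w. (\<Sum>k<n. ennreal (norm (u k)) * (ennreal (?e j (r (Suc k)) w) + ennreal (?e j (r k) w))) \<partial>M)"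
      proof (rule nn_integral_mono)
        fix w
        have "ennreal (norm (iexp (?W j w) - iexp (?V w))) \<le> ennreal (\<Sum>k<n. ?p k w)"
          using pt by (rule ennreal_leI)
        also have "\<dots> = (\<Sum>k<n. ennreal (norm (u k)) * (ennreal (?e j (r (Suc k)) w) + ennreal (?e j (r k) w)))"
          by (simp add: sum_ennreal [symmetric] ennreal_mult)
        finally show "ennreal (norm (iexp (?W j w) - iexp (?V w))) \<le> (\<Sum>k<n. ennreal (norm (u k)) * (ennreal (?e j (r (Suc k)) w) + ennreal (?e j (r k) w)))" .
      qed
      also have "\<dots> = ?b j"
        using em rm by (subst nn_integral_sum) (auto simp: nn_integral_cmult nn_integral_add intro!: sum.cong)
      finally show "(\<integral>\<^sup>+w. norm (iexp (?W j w) - iexp (?V w)) \<partial>M) \<le> ?b j" .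
    qed
    have "?b \<longlonglongrightarrow> (\<Sum>k<n. ennreal (norm (u k)) * (0 + 0))"
      by (intro tendsto_sum ennreal_tendsto_cmult tendsto_add e0 rm) auto
    then show "?b \<longlonglongrightarrow> 0" by simp
  qed auto
  then have "(\<lambda>j. CLINT w|M. iexp (?W j w)) \<longlonglongrightarrow> (CLINT w|M. iexp (?V w))"
    by (rule tendsto_L1_int [rotated 2]) (intro iexp_int Wm Vm)+
  moreover have "(\<lambda>j. CLINT w|M. iexp (?W j w)) \<longlonglongrightarrow> exp (- of_real ((LINT s|?L. (norm (T (\<sigma> s) s))\<^sup>2) / 2))"
    unfolding char_W by (intro tendsto_intros lim1) simp
  ultimately show ?thesis unfolding T_def by (rule LIMSEQ_unique)
qed

text \<open>At time 0 all elementary integrals vanish because the clipped times are 0; the value of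
  \<open>Y\<close> there is their L2 limit and hence determined only almost everywhere.\<close>

lemma stochastic_integral_zero:
  assumes B: "brownian_motion M B" and Y: "stochastic_integral M B \<sigma> Y"
  shows "AE w in M. Y 0 w = 0"
proof -
  obtain m t A where t: "\<And>j k. k \<le> m j \<Longrightarrow> t j k \<in> {0..1}"
    and L2Y: "\<And>r. r \<in> {0..1} \<Longrightarrow> (\<lambda>j. \<integral>\<^sup>+ w. ennreal ((norm (step_integral B (m j) (t j) (A j) r w - Y r w))\<^sup>2) \<partial>M) \<longlonglongrightarrow> 0"
    using Y unfolding stochastic_integral_def by (elim conjE exE) blast
  have Y0 [measurable]: "Y 0 \<in> borel_measurable M" using Y by (simp add: stochastic_integral_def)
  have S0: "step_integral B (m j) (t j) (A j) 0 w = 0" for j w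
  proof -
    have "min (t j (Suc k)) 0 = 0" "min (t j k) 0 = 0" if "k < m j" for k
      using t [of k j] t [of "Suc k" j] that by auto
    then show ?thesis by (simp add: step_integral_def)
  qed
  have "(\<lambda>j :: nat. \<integral>\<^sup>+ w. ennreal ((norm (0 - Y 0 w))\<^sup>2) \<partial>M) \<longlonglongrightarrow> 0"
    using L2Y [of 0] unfolding S0 by simp
  then have "(\<integral>\<^sup>+ w. ennreal ((norm (0 - Y 0 w))\<^sup>2) \<partial>M) = 0"
    by (simp only: LIMSEQ_const_iff)
  then show ?thesis by (subst (asm) nn_integral_0_iff_AE) auto
qed

section \<open>The laws of the grid increments\<close>

abbreviation normal_prod :: "'i set \<Rightarrow> real \<Rightarrow> ('i \<Rightarrow> real) measure" where
  "normal_prod I \<sigma> \<equiv> PiM I (\<lambda>_. normal_law \<sigma>)"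

definition normal_ratio :: "real \<Rightarrow> real \<Rightarrow> real \<Rightarrow> real" where
  "normal_ratio \<sigma> c y = normal_density 0 (c * \<sigma>) y / normal_density 0 \<sigma> y"

lemma normal_ratio_pos: "0 < \<sigma> \<Longrightarrow> 0 < c \<Longrightarrow> 0 < normal_ratio \<sigma> c y"
  by (simp add: normal_ratio_def normal_density_pos)

lemma normal_ratio_measurable [measurable]: "normal_ratio \<sigma> c \<in> borel_measurable borel"
  unfolding normal_ratio_def by measurable

text \<open>Under the scaled law the argument of the ratio is \<open>c * x\<close> with
  \<open>x\<close> unscaled, which explains the form of the left side. When \<open>c\<close> is the
  square root of an eigenvalue, \<open>ln (c\<^sup>2)\<close> is the logarithm of that
  eigenvalue.\<close>

lemma ln_normal_ratio:
  assumes "0 < \<sigma>" "0 < c"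
  shows "ln (normal_ratio \<sigma> c (c * x)) = ((c\<^sup>2 - 1) * x\<^sup>2 / \<sigma>\<^sup>2 - ln (c\<^sup>2)) / 2"
proof -
  have "ln (normal_density 0 s y) = - ln (sqrt (2 * pi)) - ln s - y\<^sup>2 / (2 * s\<^sup>2)" if "0 < s" for s y
    using that by (simp add: normal_density_def ln_mult ln_div real_sqrt_mult ln_sqrt)
  then have "ln (normal_ratio \<sigma> c (c * x)) =
      (- ln (sqrt (2 * pi)) - ln (c * \<sigma>) - (c * x)\<^sup>2 / (2 * (c * \<sigma>)\<^sup>2)) -
      (- ln (sqrt (2 * pi)) - ln \<sigma> - (c * x)\<^sup>2 / (2 * \<sigma>\<^sup>2))"
    using assms normal_density_pos [of \<sigma>] normal_density_pos [of "c * \<sigma>"]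
    by (simp add: normal_ratio_def ln_div less_imp_neq [symmetric])
  then show ?thesis using assms
    by (simp add: ln_mult ln_realpow power_mult_distrib diff_divide_distrib left_diff_distrib)
qed

text \<open>Both measures agree on rectangles with the product of the normal laws of deviation
  \<open>c i * \<sigma>\<close>: the image measure by scaling each factor, the density because each
  ratio cancels the reference density.\<close>

lemma distr_scale_normal_prod:
  assumes I: "finite I" and \<sigma>: "0 < \<sigma>" and c: "\<And>i. 0 < c i"
  shows "distr (normal_prod I \<sigma>) (PiM I (\<lambda>_. borel)) (\<lambda>x. \<lambda>i\<in>I. c i * x i)
    = density (normal_prod I \<sigma>) (\<lambda>x. \<Prod>i\<in>I. ennreal (normal_ratio \<sigma> (c i) (x i)))"
proof -
  let ?D = "distr (normal_prod I \<sigma>) (PiM I (\<lambda>_. borel)) (\<lambda>x. \<lambda>i\<in>I. c i * x i)"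
  let ?E = "density (normal_prod I \<sigma>) (\<lambda>x. \<Prod>i\<in>I. ennreal (normal_ratio \<sigma> (c i) (x i)))"
  interpret N: product_prob_space "\<lambda>_. normal_law \<sigma>"
    by (rule product_prob_spaceI) (rule prob_space_normal_density [OF \<sigma>])
  interpret S: product_prob_space "\<lambda>i. normal_law (c i * \<sigma>)"
    by (rule product_prob_spaceI) (rule prob_space_normal_density, use \<sigma> c in simp)
  have "?D = PiM I (\<lambda>i. normal_law (c i * \<sigma>))"
  proof (rule S.PiM_eqI [OF I])
    show "sets (?D) = sets (PiM I (\<lambda>i. normal_law (c i * \<sigma>)))"
      by (simp cong: sets_PiM_cong)
    fix A assume "\<And>i. i \<in> I \<Longrightarrow> A i \<in> sets (normal_law (c i * \<sigma>))"
    then have A: "\<And>i. i \<in> I \<Longrightarrow> A i \<in> sets borel" by simp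
    have pre: "(\<lambda>y. c i * y) -` A i \<in> sets borel" if "i \<in> I" for i
      using measurable_sets [OF _ A [OF that], of "\<lambda>y. c i * y" borel] by simp
    have "emeasure (?D) (Pi\<^sub>E I A)
        = emeasure (normal_prod I \<sigma>) ((\<lambda>x. \<lambda>i\<in>I. c i * x i) -` Pi\<^sub>E I A \<inter> space (normal_prod I \<sigma>))"
      using I A by (intro emeasure_distr sets_PiM_I_finite) (auto cong: measurable_cong_sets)
    also have "(\<lambda>x. \<lambda>i\<in>I. c i * x i) -` Pi\<^sub>E I A \<inter> space (normal_prod I \<sigma>) = (\<Pi>\<^sub>E i\<in>I. (\<lambda>y. c i * y) -` A i)"
      by (auto simp: space_PiM PiE_iff extensional_def)
    also have "emeasure (normal_prod I \<sigma>) \<dots> = (\<Prod>i\<in>I. emeasure (normal_law \<sigma>) ((\<lambda>y. c i * y) -` A i))"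
      using I pre by (intro N.emeasure_PiM) auto
    also have "\<dots> = (\<Prod>i\<in>I. emeasure (normal_law (c i * \<sigma>)) (A i))"
    proof (intro prod.cong refl)
      fix i assume i: "i \<in> I"
      have "emeasure (normal_law (c i * \<sigma>)) (A i) = emeasure (distr (normal_law \<sigma>) borel (\<lambda>y. c i * y)) (A i)"
        using distr_scale_normal_law [OF \<sigma> c, of i] by simp
      also have "\<dots> = emeasure (normal_law \<sigma>) ((\<lambda>y. c i * y) -` A i)"
        using A [OF i] by (subst emeasure_distr) auto
      finally show "emeasure (normal_law \<sigma>) ((\<lambda>y. c i * y) -` A i) = emeasure (normal_law (c i * \<sigma>)) (A i)" by simp
    qed
    finally show "emeasure (?D) (Pi\<^sub>E I A)
      = (\<Prod>i\<in>I. emeasure (normal_law (c i * \<sigma>)) (A i))" .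
  qed
  moreover have "?E = PiM I (\<lambda>i. normal_law (c i * \<sigma>))"
  proof (rule S.PiM_eqI [OF I])
    show "sets (?E) = sets (PiM I (\<lambda>i. normal_law (c i * \<sigma>)))"
      by (simp cong: sets_PiM_cong)
    fix A assume "\<And>i. i \<in> I \<Longrightarrow> A i \<in> sets (normal_law (c i * \<sigma>))"
    then have A [measurable]: "\<And>i. i \<in> I \<Longrightarrow> A i \<in> sets borel" by simp
    have "emeasure (?E) (Pi\<^sub>E I A)
      = (\<integral>\<^sup>+x. (\<Prod>i\<in>I. ennreal (normal_ratio \<sigma> (c i) (x i))) * indicator (Pi\<^sub>E I A) x \<partial>normal_prod I \<sigma>)"
      using I A by (intro emeasure_density sets_PiM_I_finite) auto
    also have "\<dots> = (\<integral>\<^sup>+x. (\<Prod>i\<in>I. ennreal (normal_ratio \<sigma> (c i) (x i)) * indicator (A i) (x i)) \<partial>normal_prod I \<sigma>)"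
    proof (rule nn_integral_cong)
      fix x assume "x \<in> space (normal_prod I \<sigma>)"
      then have "indicator (Pi\<^sub>E I A) x = (\<Prod>i\<in>I. indicator (A i) (x i) :: ennreal)"
        using I by (auto simp: indicator_def PiE_iff space_PiM prod_zero_iff split: if_splits)
      then show "(\<Prod>i\<in>I. ennreal (normal_ratio \<sigma> (c i) (x i))) * indicator (Pi\<^sub>E I A) x
         = (\<Prod>i\<in>I. ennreal (normal_ratio \<sigma> (c i) (x i)) * indicator (A i) (x i))"
        by (simp add: prod.distrib)
    qed
    also have "\<dots> = (\<Prod>i\<in>I. \<integral>\<^sup>+y. ennreal (normal_ratio \<sigma> (c i) y) * indicator (A i) y \<partial>normal_law \<sigma>)"
      using I A by (intro N.product_nn_integral_prod) auto
    also have "\<dots> = (\<Prod>i\<in>I. emeasure (normal_law (c i * \<sigma>)) (A i))"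
    proof (intro prod.cong refl)
      fix i assume i: "i \<in> I"
      note [measurable] = A [OF i]
      have "(\<integral>\<^sup>+y. ennreal (normal_ratio \<sigma> (c i) y) * indicator (A i) y \<partial>normal_law \<sigma>)
        = (\<integral>\<^sup>+y. ennreal (normal_density 0 \<sigma> y) * (ennreal (normal_ratio \<sigma> (c i) y) * indicator (A i) y) \<partial>lborel)"
        by (subst nn_integral_density) auto
      also have "\<dots> = (\<integral>\<^sup>+y. ennreal (normal_density 0 (c i * \<sigma>) y) * indicator (A i) y \<partial>lborel)"
        using normal_density_pos [OF \<sigma>, of 0]
        by (intro nn_integral_cong)
           (simp add: normal_ratio_def mult.assoc [symmetric] ennreal_mult' [symmetric] less_imp_neq [symmetric])
      also have "\<dots> = emeasure (normal_law (c i * \<sigma>)) (A i)"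
        by (subst emeasure_density) auto
      finally show "(\<integral>\<^sup>+y. ennreal (normal_ratio \<sigma> (c i) y) * indicator (A i) y \<partial>normal_law \<sigma>) = emeasure (normal_law (c i * \<sigma>)) (A i)" .
    qed
    finally show "emeasure (?E) (Pi\<^sub>E I A)
      = (\<Prod>i\<in>I. emeasure (normal_law (c i * \<sigma>)) (A i))" .
  qed
  ultimately show ?thesis by simp
qed

section \<open>Gaussian vectors indexed by cell and coordinate\<close>

abbreviation gridset :: "nat \<Rightarrow> (nat \<times> 'l) set" where
  "gridset n \<equiv> {..<n} \<times> UNIV"

abbreviation grid_borel :: "nat \<Rightarrow> (nat \<times> 'l \<Rightarrow> real) measure" where
  "grid_borel n \<equiv> PiM (gridset n) (\<lambda>_. borel)"

text \<open>The vectors attached to the cells are stored as one family of reals, so that product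
  measures of scalar laws apply; the restriction to \<open>gridset n\<close> puts the family into
  the space of the product measure.\<close>

definition flat :: "nat \<Rightarrow> (nat \<Rightarrow> real ^ 'l) \<Rightarrow> nat \<times> 'l \<Rightarrow> real" where
  "flat n V = (\<lambda>a\<in>gridset n. V (fst a) $ snd a)"

definition unflat :: "(nat \<times> 'l \<Rightarrow> real) \<Rightarrow> nat \<Rightarrow> real ^ 'l" where
  "unflat x k = (\<chi> j. x (k, j))"

lemma unflat_flat: "k < n \<Longrightarrow> unflat (flat n V) k = V k"
  by (simp add: unflat_def flat_def vec_eq_iff)

lemma flat_unflat: "x \<in> extensional (gridset n) \<Longrightarrow> flat n (unflat x) = x"
  by (auto simp: unflat_def flat_def extensional_def fun_eq_iff)

lemma flat_measurable [measurable]: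
  fixes V :: "nat \<Rightarrow> 'a \<Rightarrow> real ^ 'l"
  assumes "\<And>k. k < n \<Longrightarrow> V k \<in> borel_measurable M"
  shows "(\<lambda>w. flat n (\<lambda>k. V k w)) \<in> measurable M (grid_borel n)"
  unfolding flat_def
proof (rule measurable_restrict)
  fix a :: "nat \<times> 'l" assume "a \<in> gridset n"
  then show "(\<lambda>w. V (fst a) w $ snd a) \<in> borel_measurable M"
    using assms by (auto intro!: measurable_compose [OF _ borel_measurable_continuous_onI [OF continuous_on_component [OF continuous_on_id]]])
qed

lemma unflat_measurable:
  assumes "k < n"
  shows "(\<lambda>x. unflat x k) \<in> borel_measurable (PiM (gridset n :: (nat \<times> 'l::finite) set) (\<lambda>_. borel))"
proof (subst borel_measurable_euclidean_space, intro ballI)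
  fix b :: "real ^ 'l" assume "b \<in> Basis"
  then obtain j where b: "b = axis j 1" by (auto simp: Basis_vec_def)
  have "(\<lambda>x. x (k, j)) \<in> borel_measurable (PiM (gridset n :: (nat \<times> 'l::finite) set) (\<lambda>_. borel))"
    using assms by (intro measurable_component_singleton) auto
  then show "(\<lambda>x. unflat x k \<bullet> b) \<in> borel_measurable (PiM (gridset n :: (nat \<times> 'l::finite) set) (\<lambda>_. borel))"
    by (simp add: b inner_axis unflat_def)
qed

lemma distr_flat_eqI_char:
  fixes V :: "nat \<Rightarrow> 'a \<Rightarrow> real ^ 'l" and V' :: "nat \<Rightarrow> 'b \<Rightarrow> real ^ 'l"
  assumes M: "prob_space M" and M': "prob_space M'"
    and V: "\<And>k. k < n \<Longrightarrow> V k \<in> borel_measurable M"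
    and V': "\<And>k. k < n \<Longrightarrow> V' k \<in> borel_measurable M'"
    and eq: "\<And>u. (CLINT w|M. iexp (\<Sum>k<n. u k \<bullet> V k w)) = (CLINT w|M'. iexp (\<Sum>k<n. u k \<bullet> V' k w))"
  shows "distr M (grid_borel n) (\<lambda>w. flat n (\<lambda>k. V k w))
    = distr M' (grid_borel n) (\<lambda>w. flat n (\<lambda>k. V' k w))"
proof -
  have comp: "(\<lambda>w. W (fst a) w $ snd a) \<in> borel_measurable N"
    if "\<And>k. k < n \<Longrightarrow> W k \<in> borel_measurable N" "a \<in> gridset n"
    for W :: "nat \<Rightarrow> 'z \<Rightarrow> real ^ 'l" and N and a :: "nat \<times> 'l"
    using that by (auto intro!: measurable_compose [OF _ borel_measurable_continuous_onI [OF continuous_on_component [OF continuous_on_id]]])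
  have s: "(\<Sum>a\<in>gridset n. u a * f (fst a) $ snd a) = (\<Sum>k<n. (\<chi> i. u (k, i)) \<bullet> f k)" for u and f :: "nat \<Rightarrow> real ^ 'l"
    by (simp add: inner_vec_def sum.cartesian_product split_def)
  have eq': "(CLINT w|M. iexp (\<Sum>a\<in>gridset n. u a * V (fst a) w $ snd a)) = (CLINT w|M'. iexp (\<Sum>a\<in>gridset n. u a * V' (fst a) w $ snd a))" for u
    using eq [of "\<lambda>k. \<chi> i. u (k, i)"] by (simp only: s [of u "\<lambda>k. V k w" for w] s [of u "\<lambda>k. V' k w" for w])
  have mV: "(\<lambda>w. V (fst a) w $ snd a) \<in> borel_measurable M" "(\<lambda>w. V' (fst a) w $ snd a) \<in> borel_measurable M'"
    if "a \<in> gridset n" for a :: "nat \<times> 'l"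
    by (rule comp [OF _ that], erule V) (rule comp [OF _ that], erule V')
  show ?thesis
    unfolding flat_def
    by (rule distr_PiM_eqI_char [where X = "\<lambda>a w. V (fst a) w $ snd a" and X' = "\<lambda>a w. V' (fst a) w $ snd a", OF M M' _ mV eq']) auto
qed

lemma char_normal_prod:
  fixes v :: "nat \<Rightarrow> real ^ 'l"
  assumes \<sigma>: "0 < \<sigma>"
  shows "(CLINT x|normal_prod (gridset n) \<sigma>. iexp (\<Sum>k<n. v k \<bullet> unflat x k)) = exp (- of_real (\<sigma>\<^sup>2 * (\<Sum>k<n. (norm (v k))\<^sup>2) / 2))"
proof -
  let ?I = "gridset n :: (nat \<times> 'l::finite) set"
  interpret N: product_prob_space "\<lambda>_. normal_law \<sigma>"
    by (rule product_prob_spaceI) (rule prob_space_normal_density [OF \<sigma>])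
  note icb = finite_measure.integrable_const_bound [OF prob_space.finite_measure [OF prob_space_normal_density [OF \<sigma>]]]
  have "(CLINT x|normal_prod ?I \<sigma>. iexp (\<Sum>k<n. v k \<bullet> unflat x k)) = (CLINT x|normal_prod ?I \<sigma>. (\<Prod>a\<in>?I. iexp (v (fst a) $ snd a * x a)))"
    by (simp add: inner_vec_def unflat_def sum.cartesian_product split_def exp_sum [symmetric] sum_distrib_left)
  also have "\<dots> = (\<Prod>a\<in>?I. CLINT y|normal_law \<sigma>. iexp (v (fst a) $ snd a * y))"
    by (rule N.product_integral_prod) (auto intro!: icb [where B = 1])
  also have "\<dots> = (\<Prod>a\<in>?I. exp (- of_real (\<sigma>\<^sup>2 * (v (fst a) $ snd a)\<^sup>2 / 2)))"
    using char_normal_law [OF \<sigma>] unfolding char_def by (simp only:)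
  also have "\<dots> = exp (- of_real (\<Sum>a\<in>?I. \<sigma>\<^sup>2 * (v (fst a) $ snd a)\<^sup>2 / 2))"
    by (simp add: exp_sum [symmetric] sum_negf)
  also have "(\<Sum>a\<in>?I. \<sigma>\<^sup>2 * (v (fst a) $ snd a)\<^sup>2 / 2) = \<sigma>\<^sup>2 * (\<Sum>k<n. (norm (v k))\<^sup>2) / 2"
    unfolding power2_norm_eq_inner
    by (simp add: inner_vec_def sum.cartesian_product split_def sum_distrib_left sum_divide_distrib power2_eq_square)
  finally show ?thesis .
qed

definition rotate_grid :: "nat \<Rightarrow> (nat \<Rightarrow> real ^ 'l ^ 'l) \<Rightarrow> (nat \<times> 'l \<Rightarrow> real) \<Rightarrow> nat \<times> 'l \<Rightarrow> real" where
  "rotate_grid n Q x = flat n (\<lambda>k. Q k *v unflat x k)"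

definition scale_grid :: "nat \<Rightarrow> (nat \<times> 'l \<Rightarrow> real) \<Rightarrow> (nat \<times> 'l \<Rightarrow> real) \<Rightarrow> nat \<times> 'l \<Rightarrow> real" where
  "scale_grid n c x = (\<lambda>a\<in>gridset n. c a * x a)"

lemma rotate_grid_measurable [measurable]:
  "rotate_grid n Q \<in> measurable (grid_borel n) (grid_borel n)"
  unfolding rotate_grid_def
  by (rule flat_measurable, rule measurable_compose [OF unflat_measurable], assumption)
     (intro borel_measurable_continuous_onI linear_continuous_on matrix_vector_mul_bounded_linear)

lemma scale_grid_measurable [measurable]:
  "scale_grid n c \<in> measurable (grid_borel n) (grid_borel n)"
  unfolding scale_grid_def by measurable

lemma rotate_grid_inverse:
  assumes "\<And>k. orthogonal_matrix (Q k)" and "x \<in> extensional (gridset n)"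
  shows "rotate_grid n (\<lambda>k. transpose (Q k)) (rotate_grid n Q x) = x"
proof -
  have "rotate_grid n (\<lambda>k. transpose (Q k)) (rotate_grid n Q x) = flat n (unflat x)"
    unfolding rotate_grid_def flat_def [of n "\<lambda>k. transpose (Q k) *v _ k"] flat_def [of n "unflat x"]
    by (intro restrict_ext) (auto simp: unflat_flat orthogonal_matrix_inner(2) [OF assms(1)] simp del: transpose_matrix_vector)
  then show ?thesis using assms(2) by (simp add: flat_unflat)
qed

lemma sets_normal_prod [measurable_cong]: "sets (normal_prod I \<sigma>) = sets (PiM I (\<lambda>_. borel))"
  by (simp cong: sets_PiM_cong)

lemma space_normal_prod: "space (normal_prod I \<sigma>) = extensional I"
  by (simp add: space_PiM PiE_def)

lemma prob_space_normal_prod: "0 < \<sigma> \<Longrightarrow> prob_space (normal_prod I \<sigma>)"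
  by (intro prob_space_PiM prob_space_normal_density)

text \<open>The exponent sees \<open>A k\<close> only through \<open>A k ** transpose (A k)\<close>,
  so any factor of the covariance can be used to realise the law as a linear image of independent
  normal variables.\<close>

lemma distr_normal_prod_eqI:
  fixes V :: "nat \<Rightarrow> 'a \<Rightarrow> real ^ 'l" and A :: "nat \<Rightarrow> real ^ 'l ^ 'l"
  assumes M: "prob_space M" and \<sigma>: "0 < \<sigma>" and V: "\<And>k. k < n \<Longrightarrow> V k \<in> borel_measurable M"
    and char: "\<And>u. (CLINT w|M. iexp (\<Sum>k<n. u k \<bullet> V k w)) = exp (- of_real (\<sigma>\<^sup>2 * (\<Sum>k<n. (norm (transpose (A k) *v u k))\<^sup>2) / 2))"
  shows "distr M (grid_borel n) (\<lambda>w. flat n (\<lambda>k. V k w))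
    = distr (normal_prod (gridset n) \<sigma>) (grid_borel n) (\<lambda>x. flat n (\<lambda>k. A k *v unflat x k))"
proof (rule distr_flat_eqI_char [OF M prob_space_normal_prod [OF \<sigma>] V])
  show "(\<lambda>x. A k *v unflat x k) \<in> borel_measurable (normal_prod (gridset n) \<sigma>)" if "k < n" for k
  proof -
    have "(\<lambda>x. unflat x k) \<in> borel_measurable (normal_prod (gridset n :: (nat \<times> 'l) set) \<sigma>)"
      using unflat_measurable [OF that] by (simp only: measurable_cong_sets [OF sets_normal_prod refl])
    then show ?thesis
      by (rule measurable_compose) (intro borel_measurable_continuous_onI linear_continuous_on matrix_vector_mul_bounded_linear)
  qed
  show "(CLINT w|M. iexp (\<Sum>k<n. u k \<bullet> V k w)) = (CLINT x|normal_prod (gridset n) \<sigma>. iexp (\<Sum>k<n. u k \<bullet> (A k *v unflat x k)))" for u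
    unfolding inner_matrix_vec char char_normal_prod [OF \<sigma>] by (rule refl)
qed

lemma distr_rotate_normal_prod:
  fixes Q :: "nat \<Rightarrow> real ^ 'l ^ 'l"
  assumes \<sigma>: "0 < \<sigma>" and Q: "\<And>k. orthogonal_matrix (Q k)"
  shows "distr (normal_prod (gridset n) \<sigma>) (grid_borel n) (rotate_grid n Q) = normal_prod (gridset n) \<sigma>"
proof -
  let ?P = "normal_prod (gridset n :: (nat \<times> 'l::finite) set) \<sigma>"
  have um: "(\<lambda>x. unflat x k) \<in> borel_measurable ?P" if "k < n" for k
    using unflat_measurable [OF that] by (simp only: measurable_cong_sets [OF sets_normal_prod refl])
  have nrm: "(norm (transpose (Q k) *v u))\<^sup>2 = (norm u)\<^sup>2" for k u
  proof -
    have "(transpose (Q k) *v u) \<bullet> (transpose (Q k) *v u) = u \<bullet> (Q k *v (transpose (Q k) *v u))"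
      by (rule inner_matrix_vec [symmetric])
    also have "\<dots> = u \<bullet> u" by (simp only: orthogonal_matrix_inner [OF Q])
    finally show ?thesis by (simp only: power2_norm_eq_inner)
  qed
  have "?P = distr ?P (grid_borel n) (\<lambda>x. x)"
    by (rule distr_id2 [symmetric]) (simp add: sets_normal_prod)
  also have "\<dots> = distr ?P (grid_borel n) (\<lambda>x. flat n (\<lambda>k. unflat x k))"
    by (intro distr_cong refl) (simp add: flat_unflat space_normal_prod)
  also have "\<dots> = distr ?P (grid_borel n) (\<lambda>x. flat n (\<lambda>k. Q k *v unflat x k))"
    by (rule distr_normal_prod_eqI [OF prob_space_normal_prod [OF \<sigma>] \<sigma> um]) (simp_all only: char_normal_prod [OF \<sigma>] nrm)
  finally show ?thesis by (simp add: rotate_grid_def [abs_def])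
qed

text \<open>
  Since only orthogonal matrices and diagonal scalings occur, no linear change of variables for
  Lebesgue measure is needed: rotations preserve the Gaussian measure by its characteristic function.
\<close>

lemma distr_rotate_scale_normal_prod:
  fixes Q :: "nat \<Rightarrow> real ^ 'l ^ 'l"
  assumes \<sigma>: "0 < \<sigma>" and Q: "\<And>k. orthogonal_matrix (Q k)" and c: "\<And>a. 0 < c a"
  shows "distr (normal_prod (gridset n) \<sigma>) (grid_borel n) (\<lambda>x. rotate_grid n Q (scale_grid n c x))
    = density (normal_prod (gridset n) \<sigma>)
        (\<lambda>y. \<Prod>a\<in>gridset n. ennreal (normal_ratio \<sigma> (c a) (rotate_grid n (\<lambda>k. transpose (Q k)) y a)))"
    (is "distr ?P ?B _ = density ?P ?L")
proof (rule measure_eqI)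
  let ?l = "\<lambda>x. \<Prod>a\<in>gridset n. ennreal (normal_ratio \<sigma> (c a) (x a))"
  let ?R = "rotate_grid n Q"
  have lm [measurable]: "?l \<in> borel_measurable ?B" by measurable
  have Lm [measurable]: "?L \<in> borel_measurable ?B"
    by (rule measurable_compose [OF rotate_grid_measurable lm])
  show "sets (distr ?P ?B (\<lambda>x. ?R (scale_grid n c x))) = sets (density ?P ?L)"
    by (simp add: sets_normal_prod)
  fix E assume "E \<in> sets (distr ?P ?B (\<lambda>x. ?R (scale_grid n c x)))"
  then have E [measurable]: "E \<in> sets ?B" by simp
  have "distr ?P ?B (\<lambda>x. ?R (scale_grid n c x)) = distr (distr ?P ?B (scale_grid n c)) ?B ?R"
    by (subst distr_distr) (auto simp: comp_def)
  also have "distr ?P ?B (scale_grid n c) = density ?P ?l"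
    unfolding scale_grid_def [abs_def] by (rule distr_scale_normal_prod [OF _ \<sigma> c]) simp
  finally have "emeasure (distr ?P ?B (\<lambda>x. ?R (scale_grid n c x))) E = emeasure (distr (density ?P ?l) ?B ?R) E"
    by simp
  also have "\<dots> = (\<integral>\<^sup>+x. indicator E x \<partial>distr (density ?P ?l) ?B ?R)"
    by simp
  also have "\<dots> = (\<integral>\<^sup>+x. indicator E (?R x) \<partial>density ?P ?l)"
    by (subst nn_integral_distr) auto
  also have "\<dots> = (\<integral>\<^sup>+x. ?l x * indicator E (?R x) \<partial>?P)"
    by (subst nn_integral_density) auto
  \<comment> \<open>The density \<open>?L\<close> undoes the rotation before taking ratios, so
    \<open>?L (?R x)\<close> is \<open>?l x\<close>; rotation invariance of \<open>?P\<close> then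
    removes \<open>?R\<close> from the integral.\<close>
  also have "\<dots> = (\<integral>\<^sup>+x. ?L (?R x) * indicator E (?R x) \<partial>?P)"
    by (intro nn_integral_cong) (simp add: rotate_grid_inverse [OF Q] space_normal_prod)
  also have "\<dots> = (\<integral>\<^sup>+y. ?L y * indicator E y \<partial>distr ?P ?B ?R)"
    by (subst nn_integral_distr) auto
  also have "\<dots> = (\<integral>\<^sup>+y. ?L y * indicator E y \<partial>?P)"
    by (simp only: distr_rotate_normal_prod [OF \<sigma> Q])
  also have "\<dots> = emeasure (density ?P ?L) E"
    by (rule emeasure_density [symmetric]) (auto simp: sets_normal_prod)
  finally show "emeasure (distr ?P ?B (\<lambda>x. ?R (scale_grid n c x))) E = emeasure (density ?P ?L) E" .
qed

section \<open>Path increments over the grid cells\<close>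

definition grid_incr :: "nat \<Rightarrow> (real \<Rightarrow> real ^ 'l) \<Rightarrow> nat \<times> 'l \<Rightarrow> real" where
  "grid_incr n \<omega> = flat n (\<lambda>k. \<omega> (real (Suc k) / real n) - \<omega> (real k / real n))"

abbreviation cell :: "nat \<Rightarrow> nat \<Rightarrow> real set" where
  "cell n k \<equiv> {real k / real n<..real (Suc k) / real n}"

lemma grid_point:
  assumes "0 < n" "k \<le> n"
  shows "real k / real n \<in> {0..1}"
  using assms by (auto simp: field_simps)

lemma grid_interval:
  assumes "k < n"
  shows "0 \<le> real k / real n" "real k / real n \<le> real (Suc k) / real n" "real (Suc k) / real n \<le> 1"
    "cell n k \<subseteq> {0..1}"
proof -
  show *: "0 \<le> real k / real n" "real k / real n \<le> real (Suc k) / real n" "real (Suc k) / real n \<le> 1"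
    using assms by (auto simp: divide_right_mono)
  show "cell n k \<subseteq> {0..1}"
    using *(1,3) by (intro subsetI) (simp only: greaterThanAtMost_iff atLeastAtMost_iff, linarith)
qed

lemma disjoint_grid_intervals:
  assumes "s \<in> cell n k" "s \<in> cell n j"
  shows "j = k"
proof -
  have n: "0 < real n" using assms by (cases "n = 0") auto
  then have "real k < s * real n" "s * real n \<le> real (Suc k)" "real j < s * real n" "s * real n \<le> real (Suc j)"
    using assms by (auto simp: field_simps)
  then have "real k < real (Suc j)" "real j < real (Suc k)" by linarith+
  then show ?thesis by simp
qed

lemma distr_grid_incr_brownian:
  fixes B :: "real \<Rightarrow> 'w \<Rightarrow> real ^ 'l"
  assumes B: "brownian_motion M B" and n: "0 < n"
  shows "distr M (grid_borel n) (\<lambda>w. grid_incr n (\<lambda>t. B t w)) = normal_prod (gridset n) (sqrt (1 / real n))"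
proof -
  let ?\<sigma> = "sqrt (1 / real n)"
  have \<sigma>: "0 < ?\<sigma>" using n by simp
  have M: "prob_space M" using B by (simp add: brownian_motion_def)
  have Bm: "B t \<in> borel_measurable M" if "t \<in> {0..1}" for t
    using B that by (simp add: brownian_motion_def)
  have disj: "disjoint_family_on (\<lambda>k. cell n k) {..<n}"
    unfolding disjoint_family_on_def using disjoint_grid_intervals by blast
  let ?I = "\<lambda>u. LINT s|lebesgue_on {0..1}. (norm (\<Sum>k<n. indicator (cell n k) s *\<^sub>R u k))\<^sup>2"
  \<comment> \<open>\<open>mat 1\<close> puts the exponent into the shape of
    \<open>distr_normal_prod_eqI\<close>, which also serves the stochastic integral.\<close>
  have char: "(CLINT w|M. iexp (\<Sum>k<n. u k \<bullet> (B (real (Suc k) / real n) w - B (real k / real n) w)))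
     = exp (- of_real (?\<sigma>\<^sup>2 * (\<Sum>k<n. (norm (transpose (mat 1) *v u k))\<^sup>2) / 2))" for u
  proof -
    have "?I u
       = (LINT s|lebesgue_on {0..1}. (\<Sum>k<n. indicator (cell n k) s * (norm (u k))\<^sup>2))"
      by (subst norm_disjoint_sum_sq [OF _ disj]) auto
    also have "\<dots> = (\<Sum>k<n. LINT s|lebesgue_on {0..1}. indicator (cell n k) s * (norm (u k))\<^sup>2)"
    proof (rule Bochner_Integration.integral_sum)
      fix k assume k: "k \<in> {..<n}"
      have "cell n k \<subseteq> {0..1}"
        using k by (intro grid_interval) simp
      then have "cell n k \<in> sets (lebesgue_on {0..1})"
        by (auto simp: sets_restrict_space_iff)
      moreover have "emeasure (lebesgue_on {0..1}) (cell n k) < \<infinity>"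
        using finite_measure.emeasure_finite [OF finite_measure_lebesgue_on [of "{0..1::real}"]] by (simp add: less_top)
      ultimately show "integrable (lebesgue_on {0..1}) (\<lambda>s. indicator (cell n k) s * (norm (u k))\<^sup>2)"
        by auto
    qed
    also have "\<dots> = (\<Sum>k<n. (1 / real n) * (norm (u k))\<^sup>2)"
    proof (intro sum.cong refl)
      fix k assume k: "k \<in> {..<n}"
      have kn: "0 \<le> real k / real n" "real k / real n \<le> real (Suc k) / real n" "real (Suc k) / real n \<le> 1"
        using k by (auto intro: grid_interval simp del: of_nat_Suc)
      have meas: "measure (lebesgue_on {0..1}) (cell n k) = 1 / real n"
        unfolding measure_lebesgue_on_Ioc [OF kn] by (simp add: diff_divide_distrib [symmetric])
      have "cell n k \<inter> {0..1} = cell n k"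
        using grid_interval(4) [of k n] k by auto
      then show "(LINT s|lebesgue_on {0..1}. indicator (cell n k) s * (norm (u k))\<^sup>2) = (1 / real n) * (norm (u k))\<^sup>2"
        using meas by simp
    qed
    finally have *: "?I u = (\<Sum>k<n. (1 / real n) * (norm (u k))\<^sup>2)" .
    have "(CLINT w|M. iexp (\<Sum>k<n. u k \<bullet> (B (real (Suc k) / real n) w - B (real k / real n) w)))
      = exp (- of_real (?I u / 2))"
    proof (rule brownian_char [OF B])
      fix k assume "k \<in> {..<n}"
      then show "0 \<le> real k / real n \<and> real k / real n \<le> real (Suc k) / real n \<and> real (Suc k) / real n \<le> 1"
        using grid_interval by simp
    qed simp
    then show ?thesis unfolding * by (simp add: transpose_mat matrix_vector_mul_lid sum_distrib_left)
  qed
  have "distr M (grid_borel n) (\<lambda>w. grid_incr n (\<lambda>t. B t w))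
    = distr (normal_prod (gridset n) ?\<sigma>) (grid_borel n) (\<lambda>x. flat n (\<lambda>k. mat 1 *v unflat x k))"
    unfolding grid_incr_def
  proof (rule distr_normal_prod_eqI [OF M \<sigma> _ char])
    fix k assume "k < n"
    then show "(\<lambda>w. B (real (Suc k) / real n) w - B (real k / real n) w) \<in> borel_measurable M"
      using grid_point [OF n, of k] grid_point [OF n, of "Suc k"] by (intro borel_measurable_diff Bm) auto
  qed
  also have "\<dots> = distr (normal_prod (gridset n) ?\<sigma>) (grid_borel n) (\<lambda>x. x)"
    by (intro distr_cong refl) (simp add: flat_unflat space_normal_prod matrix_vector_mul_lid)
  also have "\<dots> = normal_prod (gridset n) ?\<sigma>"
    by (rule distr_id2) (simp add: sets_normal_prod)
  finally show ?thesis .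
qed

section \<open>The averaged volatility\<close>

lemma matrix_entry: "axis i 1 \<bullet> (A *v axis j 1) = A $ i $ j" for A :: "real ^ 'l ^ 'l"
  by (simp add: matrix_vector_mult_basis column_def inner_axis')

text \<open>Testing positivity on the sum and the difference of two axis vectors bounds an
  off-diagonal entry by the mean of two diagonal ones. The trace thus dominates the whole matrix,
  and integrability of the diagonal of \<open>G\<close> yields that of \<open>G\<close>.\<close>

lemma spd_entry_le_trace:
  fixes A :: "real ^ 'l ^ 'l"
  assumes A: "spd A"
  shows "\<bar>A $ i $ j\<bar> \<le> trace A" and "0 < A $ i $ i"
proof -
  have diag: "0 < A $ i $ i" for i
  proof -
    have "0 < axis i 1 \<bullet> (A *v axis i 1)" using A by (simp add: spd_def axis_eq_0_iff)
    then show ?thesis by (simp only: matrix_entry)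
  qed
  then show "0 < A $ i $ i" .
  have le: "A $ i $ i \<le> trace A" for i
    unfolding trace_def using diag by (intro member_le_sum) (auto simp: less_imp_le)
  have sym: "A $ i $ j = A $ j $ i"
    using A by (auto simp: spd_def transpose_def vec_eq_iff)
  have psd: "0 \<le> x \<bullet> (A *v x)" for x
    using A by (cases "x = 0") (auto simp: spd_def less_imp_le)
  have "0 \<le> A $ i $ i + A $ j $ j + 2 * A $ i $ j"
    using psd [of "axis i 1 + axis j 1"]
    by (simp add: matrix_vector_right_distrib inner_add_left inner_add_right matrix_entry sym)
  moreover have "0 \<le> A $ i $ i + A $ j $ j - 2 * A $ i $ j"
    using psd [of "axis i 1 - axis j 1"]
    by (simp add: matrix_vector_mult_diff_distrib inner_diff_left inner_diff_right matrix_entry sym)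
  ultimately show "\<bar>A $ i $ j\<bar> \<le> trace A" using le [of i] le [of j] by linarith
qed

lemma spd_norm_le_trace:
  fixes A :: "real ^ 'l ^ 'l"
  assumes "spd A"
  shows "norm A \<le> real (DIM(real ^ 'l ^ 'l)) * trace A"
proof -
  have "norm A \<le> (\<Sum>b\<in>Basis. \<bar>A \<bullet> b\<bar>)" by (rule norm_le_l1)
  also have "\<dots> \<le> real (card (Basis :: (real ^ 'l ^ 'l) set)) * trace A"
  proof (rule sum_bounded_above)
    fix b :: "real ^ 'l ^ 'l" assume "b \<in> Basis"
    then obtain i j where "b = axis i (axis j 1)" by (auto simp: Basis_vec_def)
    then show "\<bar>A \<bullet> b\<bar> \<le> trace A" using spd_entry_le_trace(1) [OF assms] by (simp add: inner_axis)
  qed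
  finally show ?thesis .
qed

lemma bounded_linear_entry: "bounded_linear (\<lambda>A :: real ^ 'l ^ 'm. A $ i $ j)"
  by (intro bounded_linear_compose [OF bounded_linear_vec_nth bounded_linear_vec_nth])

lemma bounded_linear_trace_mult: "bounded_linear (\<lambda>A :: real ^ 'l ^ 'l. trace (C ** A))"
  unfolding trace_def matrix_matrix_mult_def vec_lambda_beta
  by (intro bounded_linear_sum bounded_linear_const_mult bounded_linear_entry)

lemma bounded_linear_trace: "bounded_linear (\<lambda>A :: real ^ 'l ^ 'l. trace A)"
  unfolding trace_def by (intro bounded_linear_sum bounded_linear_entry)

lemma bounded_linear_quad: "bounded_linear (\<lambda>A :: real ^ 'l ^ 'l. x \<bullet> (A *v y))"
  unfolding inner_vec_def inner_real_def matrix_vector_mult_def vec_lambda_beta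
  by (intro bounded_linear_sum bounded_linear_const_mult bounded_linear_mult_const bounded_linear_entry)

lemma tendsto_spd_entropy:
  fixes A :: "'b \<Rightarrow> real ^ 'l ^ 'l"
  assumes "(A \<longlongrightarrow> A0) F" and "0 < det A0"
  shows "((\<lambda>x. spd_entropy (A x)) \<longlongrightarrow> spd_entropy A0) F"
proof -
  have ent: "((\<lambda>x. A x $ i $ j) \<longlongrightarrow> A0 $ i $ j) F" for i j
    by (intro tendsto_vec_nth assms)
  have "((\<lambda>x. det (A x)) \<longlongrightarrow> det A0) F"
    unfolding det_def by (intro tendsto_intros ent)
  moreover have "((\<lambda>x. trace (A x)) \<longlongrightarrow> trace A0) F"
    unfolding trace_def by (intro tendsto_intros ent)
  ultimately show ?thesis
    unfolding spd_entropy_def using assms(2) by (intro tendsto_intros) auto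
qed

locale volatility =
  fixes a G :: "real \<Rightarrow> real ^ 'l ^ 'l"
  assumes G_measurable [measurable]: "G \<in> borel_measurable (lebesgue_on {0..1})"
    and G_spd: "\<And>s. s \<in> {0..1} \<Longrightarrow> spd (G s)"
    and G_finite: "\<And>i. (\<integral>\<^sup>+ s. ennreal (G s $ i $ i) \<partial>lebesgue_on {0..1}) < \<infinity>"
    and a_integral: "\<And>t. t \<in> {0..1} \<Longrightarrow> a t = (LINT s|lebesgue_on {0..t}. G s)"
    and a_deriv: "AE t in lebesgue_on {0..1}. (a has_vector_derivative G t) (at t within {0..1})"
begin

abbreviation L :: "real measure" where "L \<equiv> lebesgue_on {0..1}"

definition avg :: "nat \<Rightarrow> nat \<Rightarrow> real ^ 'l ^ 'l" where
  "avg n k = real n *\<^sub>R (a (real (Suc k) / real n) - a (real k / real n))"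

lemma Ioc_sets: "0 \<le> x \<Longrightarrow> y \<le> 1 \<Longrightarrow> {x<..y} \<in> sets L"
  by (auto simp: sets_restrict_space_iff)

lemma cell_sets: "k < n \<Longrightarrow> cell n k \<in> sets L"
  using grid_interval [of k n] by (intro Ioc_sets)

lemma measure_cell:
  assumes "k < n"
  shows "measure L (cell n k) = 1 / real n"
  using measure_lebesgue_on_Ioc [OF grid_interval(1-3) [OF assms]] by (simp add: diff_divide_distrib [symmetric])

lemma fin_L: "finite_measure L"
  by (rule finite_measure_lebesgue_on) simp

lemma emeasure_cell:
  assumes "k < n"
  shows "emeasure L (cell n k) = ennreal (1 / real n)"
  using finite_measure.emeasure_eq_measure [OF fin_L] measure_cell [OF assms] by simp

lemma integrable_entry: "integrable L (\<lambda>s. G s $ i $ i)"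
proof (rule integrableI_bounded)
  show "(\<lambda>s. G s $ i $ i) \<in> borel_measurable L"
    by (rule measurable_compose [OF G_measurable]) (intro borel_measurable_continuous_onI linear_continuous_on bounded_linear_entry)
  have "(\<integral>\<^sup>+ s. ennreal (norm (G s $ i $ i)) \<partial>L) = (\<integral>\<^sup>+ s. ennreal (G s $ i $ i) \<partial>L)"
    using spd_entry_le_trace(2) [OF G_spd] by (intro nn_integral_cong) (simp add: less_imp_le)
  then show "(\<integral>\<^sup>+ s. ennreal (norm (G s $ i $ i)) \<partial>L) < \<infinity>" using G_finite by simp
qed

lemma G_integrable: "integrable L G"
proof (rule Bochner_Integration.integrable_bound)
  show "integrable L (\<lambda>s. real (DIM(real ^ 'l ^ 'l)) * trace (G s))"
    unfolding trace_def by (intro integrable_mult_right Bochner_Integration.integrable_sum integrable_entry)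
  show "AE s in L. norm (G s) \<le> norm (real (DIM(real ^ 'l ^ 'l)) * trace (G s))"
    using spd_norm_le_trace [OF G_spd] by (intro AE_I2) (simp add: order_trans [OF _ abs_ge_self])
qed measurable

lemma a_diff:
  assumes "0 \<le> x" "x \<le> y" "y \<le> 1"
  shows "a y - a x = (LINT s|L. indicator {x<..y} s *\<^sub>R G s)"
proof -
  have a: "a t = (LINT s|L. indicator {0..t} s *\<^sub>R G s)" if "t \<in> {0..1}" for t
  proof -
    have "a t = (LINT s|lebesgue. indicator {0..t} s *\<^sub>R G s)"
      using that by (simp add: a_integral integral_restrict_space)
    also have "\<dots> = (LINT s|lebesgue. indicator {0..1} s *\<^sub>R (indicator {0..t} s *\<^sub>R G s))"
      using that by (intro Bochner_Integration.integral_cong) (auto simp: indicator_def)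
    finally show ?thesis by (simp add: integral_restrict_space)
  qed
  have i: "integrable L (\<lambda>s. indicator {0..t} s *\<^sub>R G s)" if "t \<in> {0..1}" for t
    using that by (intro integrable_mult_indicator G_integrable) (auto simp: sets_restrict_space_iff)
  have "a y - a x = (LINT s|L. indicator {0..y} s *\<^sub>R G s - indicator {0..x} s *\<^sub>R G s)"
    using assms i [of x] i [of y] by (simp add: a)
  also have "\<dots> = (LINT s|L. indicator {x<..y} s *\<^sub>R G s)"
    using assms by (intro Bochner_Integration.integral_cong) (auto simp: indicator_def)
  finally show ?thesis .
qed

lemma integrable_functional:
  assumes "bounded_linear (F :: real ^ 'l ^ 'l \<Rightarrow> real)"
  shows "integrable L (\<lambda>s. F (G s))"
  using assms G_integrable by (rule integrable_bounded_linear)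

lemma integrable_cell_functional:
  assumes "bounded_linear (F :: real ^ 'l ^ 'l \<Rightarrow> real)" and "k < n"
  shows "integrable L (\<lambda>s. indicator (cell n k) s * F (G s))"
  using integrable_mult_indicator [OF cell_sets [OF assms(2)] integrable_functional [OF assms(1)]] by simp

lemma functional_incr:
  assumes F: "bounded_linear (F :: real ^ 'l ^ 'l \<Rightarrow> real)" and k: "k < n"
  shows "F (a (real (Suc k) / real n) - a (real k / real n)) = (LINT s|L. indicator (cell n k) s * F (G s))"
proof -
  have "F (a (real (Suc k) / real n) - a (real k / real n)) = (LINT s|L. F (indicator (cell n k) s *\<^sub>R G s))"
    unfolding a_diff [OF grid_interval(1-3) [OF k]]
    by (rule integral_bounded_linear [OF F, symmetric]) (rule integrable_mult_indicator [OF cell_sets [OF k] G_integrable])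
  then show ?thesis by (simp add: linear_cmul [OF bounded_linear.linear [OF F]])
qed

text \<open>Bounded linear functionals commute with the vector-valued integral. Entries, traces and
  quadratic forms of \<open>avg n k\<close> become scalar means of \<open>G\<close> over the cell,
  where positivity and Jensen's inequality are available.\<close>

lemma functional_avg:
  assumes F: "bounded_linear (F :: real ^ 'l ^ 'l \<Rightarrow> real)" and k: "k < n"
  shows "F (avg n k) = real n * (LINT s|L. indicator (cell n k) s * F (G s))"
  unfolding avg_def linear_cmul [OF bounded_linear.linear [OF F]] functional_incr [OF F k] by simp

lemma avg_spd:
  assumes k: "k < n"
  shows "spd (avg n k)"
  unfolding spd_def
proof (intro conjI allI impI)
  have "avg n k $ j $ i = avg n k $ i $ j" for i j
  proof -
    have "G s $ j $ i = G s $ i $ j" if "s \<in> {0..1}" for s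
      using G_spd [OF that] by (auto simp: spd_def transpose_def vec_eq_iff)
    then show ?thesis
      unfolding functional_avg [OF bounded_linear_entry k]
      by (intro arg_cong [where f = "\<lambda>z. real n * z"] Bochner_Integration.integral_cong) auto
  qed
  then show "transpose (avg n k) = avg n k"
    by (simp add: transpose_def vec_eq_iff)
next
  fix x :: "real ^ 'l" assume x: "x \<noteq> 0"
  let ?f = "\<lambda>s. indicator (cell n k) s * (x \<bullet> (G s *v x))"
  have pos: "0 < x \<bullet> (G s *v x)" if "s \<in> {0..1}" for s using G_spd [OF that] x by (simp add: spd_def)
  have nn: "AE s in L. 0 \<le> ?f s" by (intro AE_I2) (use pos in \<open>auto simp: less_imp_le\<close>)
  have int: "integrable L ?f" by (rule integrable_cell_functional [OF bounded_linear_quad k])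
  \<comment> \<open>A nonnegative integrand with integral zero vanishes almost everywhere, whereas
    this one is positive on a cell of measure \<open>1 / real n\<close>.\<close>
  have "(LINT s|L. ?f s) \<noteq> 0"
  proof
    assume "(LINT s|L. ?f s) = 0"
    then have "AE s in L. ?f s = 0" using integral_nonneg_eq_0_iff_AE [OF int nn] by simp
    then have "AE s in L. s \<notin> cell n k"
      by (rule AE_mp) (intro AE_I2 impI, use pos in \<open>fastforce simp: indicator_def\<close>)
    moreover have "{s \<in> space L. \<not> s \<notin> cell n k} = cell n k"
      using grid_interval(4) [OF k] unfolding space_lebesgue_on by blast
    ultimately have "emeasure L (cell n k) = 0"
      using AE_iff_measurable [OF cell_sets [OF k], of "\<lambda>s. s \<notin> cell n k"] by blast
    then show False using emeasure_cell [OF k] k by simp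
  qed
  moreover have "0 \<le> (LINT s|L. ?f s)" using nn by (rule integral_nonneg_AE)
  ultimately show "0 < x \<bullet> (avg n k *v x)"
    unfolding functional_avg [OF bounded_linear_quad k] using k by simp
qed

section \<open>Averaged entropy against the entropy integral\<close>

lemma G_entropy_measurable [measurable]: "(\<lambda>s. spd_entropy (G s)) \<in> borel_measurable L"
proof -
  have [measurable]: "(\<lambda>s. G s $ i $ j) \<in> borel_measurable L" for i j
    by (rule measurable_compose [OF G_measurable]) (intro borel_measurable_continuous_onI linear_continuous_on bounded_linear_entry)
  show ?thesis unfolding spd_entropy_def trace_def det_def by measurable
qed

text \<open>The integrand is nonnegative on the unit interval, so as an \<open>ennreal\<close> the
  integral exists even when it is infinite.\<close>

definition J :: ennreal where "J = (\<integral>\<^sup>+s. ennreal (spd_entropy (G s)) \<partial>L)"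

text \<open>For positive \<open>n\<close> this is twice the relative entropy on the grid divided by
  the number of steps.\<close>

definition mean_entropy :: "nat \<Rightarrow> real" where
  "mean_entropy n = (\<Sum>k<n. spd_entropy (avg n k)) / real n"

lemma mean_entropy_nonneg: "0 \<le> mean_entropy n"
  unfolding mean_entropy_def by (intro divide_nonneg_nonneg sum_nonneg spd_entropy_nonneg avg_spd) auto

text \<open>The tangent inequality at \<open>avg n k\<close> is integrated over the cell. Its linear
  part integrates to zero because \<open>avg n k\<close> is the mean of \<open>G\<close> there,
  which leaves the value at \<open>avg n k\<close> times the cell length. If the right side is
  infinite, nothing has to be shown.\<close>

lemma jensen_cell:
  assumes k: "k < n"
  shows "ennreal (spd_entropy (avg n k) / real n) \<le> (\<integral>\<^sup>+s. ennreal (indicator (cell n k) s * spd_entropy (G s)) \<partial>L)"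
proof (cases "(\<integral>\<^sup>+s. ennreal (indicator (cell n k) s * spd_entropy (G s)) \<partial>L) = \<infinity>")
  case False
  let ?i = "indicator (cell n k) :: real \<Rightarrow> real"
  let ?A = "avg n k"
  have n: "0 < real n" using k by simp
  obtain C where C: "trace (C ** ?A) = real CARD('l)"
    and tan: "\<And>H. spd H \<Longrightarrow> spd_entropy ?A + (trace H - trace ?A) - (trace (C ** H) - real CARD('l)) \<le> spd_entropy H"
    using spd_entropy_tangent [OF avg_spd [OF k]] by blast
  have im: "?i \<in> borel_measurable L" using cell_sets [OF k] by simp
  note [measurable] = im
  have nn: "0 \<le> ?i s * spd_entropy (G s)" if "s \<in> {0..1}" for s
    using spd_entropy_nonneg [OF G_spd [OF that]] by simp
  have int: "integrable L (\<lambda>s. ?i s * spd_entropy (G s))"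
  proof (rule integrableI_bounded)
    have "(\<integral>\<^sup>+s. ennreal (norm (?i s * spd_entropy (G s))) \<partial>L) = (\<integral>\<^sup>+s. ennreal (?i s * spd_entropy (G s)) \<partial>L)"
      using nn by (intro nn_integral_cong) simp
    then show "(\<integral>\<^sup>+s. ennreal (norm (?i s * spd_entropy (G s))) \<partial>L) < \<infinity>"
      using False by (simp add: less_top)
  qed measurable
  have ii: "integrable L ?i" "(LINT s|L. ?i s) = 1 / real n"
  proof -
    show "integrable L ?i" using cell_sets [OF k] emeasure_cell [OF k] by (intro integrable_real_indicator) auto
    have "cell n k \<inter> {0..1} = cell n k" using grid_interval(4) [OF k] by blast
    then show "(LINT s|L. ?i s) = 1 / real n" using measure_cell [OF k] by simp
  qed
  let ?T = "\<lambda>s. ?i s * trace (G s)" and ?U = "\<lambda>s. ?i s * trace (C ** G s)"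
  have iT: "integrable L ?T" "(LINT s|L. ?T s) = trace ?A / real n"
    using integrable_cell_functional [OF bounded_linear_trace k] functional_avg [OF bounded_linear_trace k] n by auto
  have iU: "integrable L ?U" "(LINT s|L. ?U s) = real CARD('l) / real n"
    using integrable_cell_functional [OF bounded_linear_trace_mult k] functional_avg [OF bounded_linear_trace_mult k, of C] C n by auto
  have "(LINT s|L. (spd_entropy ?A - trace ?A + real CARD('l)) * ?i s + ?T s - ?U s) \<le> (LINT s|L. ?i s * spd_entropy (G s))"
  proof (rule integral_mono)
    show "integrable L (\<lambda>s. (spd_entropy ?A - trace ?A + real CARD('l)) * ?i s + ?T s - ?U s)"
      using ii iT iU by simp
    fix s assume "s \<in> space L"
    then have "spd (G s)" using G_spd by simp
    from tan [OF this] show "(spd_entropy ?A - trace ?A + real CARD('l)) * ?i s + ?T s - ?U s \<le> ?i s * spd_entropy (G s)"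
      by (simp add: indicator_def)
  qed (rule int)
  also have "(LINT s|L. (spd_entropy ?A - trace ?A + real CARD('l)) * ?i s + ?T s - ?U s) = spd_entropy ?A / real n"
    using ii iT iU by (simp add: field_simps)
  finally have "ennreal (spd_entropy ?A / real n) \<le> ennreal (LINT s|L. ?i s * spd_entropy (G s))"
    by (rule ennreal_leI)
  also have "\<dots> = (\<integral>\<^sup>+s. ennreal (?i s * spd_entropy (G s)) \<partial>L)"
    by (rule nn_integral_eq_integral [symmetric, OF int]) (use nn in auto)
  finally show ?thesis .
qed simp

lemma mean_entropy_le: "ennreal (mean_entropy n) \<le> J"
proof -
  have "ennreal (mean_entropy n) = (\<Sum>k<n. ennreal (spd_entropy (avg n k) / real n))"
    unfolding mean_entropy_def sum_divide_distrib
    by (rule sum_ennreal [symmetric]) (auto intro!: divide_nonneg_nonneg spd_entropy_nonneg avg_spd)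
  also have "\<dots> \<le> (\<Sum>k<n. \<integral>\<^sup>+s. ennreal (indicator (cell n k) s * spd_entropy (G s)) \<partial>L)"
    by (intro sum_mono jensen_cell) auto
  also have "\<dots> = (\<integral>\<^sup>+s. (\<Sum>k<n. ennreal (indicator (cell n k) s * spd_entropy (G s))) \<partial>L)"
  proof (rule nn_integral_sum [symmetric])
    fix k assume "k \<in> {..<n}"
    then have [measurable]: "(indicator (cell n k) :: real \<Rightarrow> real) \<in> borel_measurable L" using cell_sets [of k n] by simp
    show "(\<lambda>s. ennreal (indicator (cell n k) s * spd_entropy (G s))) \<in> borel_measurable L" by measurable
  qed
  also have "\<dots> \<le> J"
    unfolding J_def
  proof (rule nn_integral_mono)
    fix s assume "s \<in> space L"
    then have nn: "0 \<le> spd_entropy (G s)" by (intro spd_entropy_nonneg G_spd) simp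
    \<comment> \<open>At most one cell contains \<open>s\<close>, and none contains 0, which is why
      this is an inequality.\<close>
    have "(\<Sum>k<n. indicator (cell n k) s :: real) \<le> 1"
    proof (cases "\<exists>k<n. s \<in> cell n k")
      case True
      then obtain k where k: "k < n" "s \<in> cell n k" by blast
      have "(\<Sum>j<n. indicator (cell n j) s :: real) = (\<Sum>j<n. if j = k then 1 else 0)"
        using disjoint_grid_intervals k by (intro sum.cong refl) (auto simp: indicator_def simp del: greaterThanAtMost_iff)
      then show ?thesis using k by simp
    next
      case False
      then have "(\<Sum>j<n. indicator (cell n j) s :: real) = 0" by (intro sum.neutral) (auto simp: indicator_def)
      then show ?thesis by simp
    qed
    then have "(\<Sum>k<n. indicator (cell n k) s * spd_entropy (G s)) \<le> spd_entropy (G s)"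
      unfolding sum_distrib_right [symmetric] using nn by (simp add: mult_left_le_one_le sum_nonneg)
    then show "(\<Sum>k<n. ennreal (indicator (cell n k) s * spd_entropy (G s))) \<le> ennreal (spd_entropy (G s))"
      using nn by (subst sum_ennreal) (auto intro: ennreal_leI)
  qed
  finally show ?thesis .
qed

lemma cell_exists:
  assumes "0 < s" "s \<le> 1" "0 < n"
  shows "\<exists>k<n. s \<in> cell n k"
proof -
  \<comment> \<open>Cells are open on the left, so the index is the ceiling of
    \<open>s * real n\<close> minus one.\<close>
  define c where "c = \<lceil>s * real n\<rceil>"
  have c: "real_of_int c - 1 < s * real n" "s * real n \<le> real_of_int c"
    unfolding c_def by linarith+
  have "0 < s * real n" "s * real n \<le> real n" using assms by (auto simp: mult_left_le_one_le)
  then have "0 < c" "c \<le> int n" using c by linarith+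
  define k where "k = nat (c - 1)"
  have "real k = real_of_int c - 1" using \<open>0 < c\<close> by (simp add: k_def)
  then have "real k < s * real n" "s * real n \<le> real (Suc k)" "k < n"
    using c \<open>0 < c\<close> \<open>c \<le> int n\<close> by (auto simp: k_def)
  then show ?thesis using assms by (intro exI [of _ k]) (auto simp: field_simps)
qed

text \<open>The point \<open>s\<close> need not be an endpoint of its cell. Differentiability at
  \<open>s\<close> controls the increments from \<open>s\<close> to both endpoints with errors
  proportional to their lengths; these lengths add up to \<open>1 / real n\<close>, which the factor
  \<open>real n\<close> in \<open>avg\<close> compensates.\<close>

lemma avg_tendsto:
  assumes d: "(a has_vector_derivative G s) (at s within {0..1})" and k: "\<And>n. 0 < n \<Longrightarrow> k n < n \<and> s \<in> cell n (k n)"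
  shows "(\<lambda>n. avg n (k n)) \<longlonglongrightarrow> G s"
proof (rule LIMSEQ_I)
  fix e :: real assume e: "0 < e"
  obtain r where r: "0 < r" and bd: "\<And>y. y \<in> {0..1} \<Longrightarrow> norm (y - s) < r \<Longrightarrow> norm (a y - a s - (y - s) *\<^sub>R G s) \<le> (e / 2) * norm (y - s)"
    using d e unfolding has_vector_derivative_def has_derivative_within_alt by (meson half_gt_zero)
  obtain N where N: "inverse (real (Suc N)) < r" using reals_Archimedean [OF r] by blast
  show "\<exists>n0. \<forall>n\<ge>n0. norm (avg n (k n) - G s) < e"
  proof (intro exI allI impI)
    fix n assume n: "Suc N \<le> n"
    then have n0: "0 < n" and rn: "0 < real n" by auto
    have "inverse (real n) \<le> inverse (real (Suc N))" using n by (intro le_imp_inverse_le) auto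
    then have ir: "1 / real n < r" using N by (simp add: inverse_eq_divide)
    let ?u = "real (k n) / real n" and ?v = "real (Suc (k n)) / real n"
    have uv: "?v - ?u = 1 / real n" by (simp add: diff_divide_distrib [symmetric])
    have s: "?u < s" "s \<le> ?v" and kn: "k n < n" using k [OF n0] by auto
    have 01: "?u \<in> {0..1}" "?v \<in> {0..1}" using grid_interval [OF kn] by auto
    have vs: "norm (?v - s) = ?v - s" "?v - s < r" and us: "norm (?u - s) = s - ?u" "s - ?u < r"
      using s uv ir unfolding real_norm_def by linarith+
    have "norm (a ?v - a s - (?v - s) *\<^sub>R G s) \<le> (e / 2) * (?v - s)"
      using bd [OF 01(2)] unfolding vs(1) by (simp only: vs(2) simp_thms)
    moreover have "norm (a ?u - a s - (?u - s) *\<^sub>R G s) \<le> (e / 2) * (s - ?u)"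
      using bd [OF 01(1)] unfolding us(1) by (simp only: us(2) simp_thms)
    moreover have "norm ((a ?v - a ?u) - (?v - ?u) *\<^sub>R G s) \<le> norm (a ?v - a s - (?v - s) *\<^sub>R G s) + norm (a ?u - a s - (?u - s) *\<^sub>R G s)"
    proof -
      have "(a ?v - a ?u) - (?v - ?u) *\<^sub>R G s = (a ?v - a s - (?v - s) *\<^sub>R G s) - (a ?u - a s - (?u - s) *\<^sub>R G s)"
        by (simp only: algebra_simps)
      then show ?thesis by (simp only: norm_triangle_ineq4)
    qed
    ultimately have "norm ((a ?v - a ?u) - (?v - ?u) *\<^sub>R G s) \<le> (e / 2) * (?v - s) + (e / 2) * (s - ?u)"
      by linarith
    also have "\<dots> = (e / 2) * (1 / real n)" unfolding distrib_left [symmetric] uv [symmetric] by simp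
    finally have "norm ((a ?v - a ?u) - (1 / real n) *\<^sub>R G s) \<le> (e / 2) * (1 / real n)" by (simp only: uv)
    moreover have "avg n (k n) - G s = real n *\<^sub>R ((a ?v - a ?u) - (1 / real n) *\<^sub>R G s)"
      using rn by (simp add: avg_def scaleR_diff_right)
    ultimately have "norm (avg n (k n) - G s) \<le> e / 2"
      using rn by (simp only: norm_scaleR) (simp add: field_simps)
    then show "norm (avg n (k n) - G s) < e" using e by simp
  qed
qed

text \<open>By Lebesgue differentiation \<open>avg n\<close> converges to \<open>G\<close> almost everywhere, so Fatou's lemma applies.\<close>

lemma J_le_liminf: "J \<le> liminf (\<lambda>n. ennreal (mean_entropy n))"
proof -
  let ?f = "\<lambda>n s. \<Sum>k<n. indicator (cell n k) s * spd_entropy (avg n k)"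
  have cm: "(indicator (cell n k) :: real \<Rightarrow> real) \<in> borel_measurable L" if "k < n" for n k using cell_sets [OF that] by simp
  have fm [measurable]: "?f n \<in> borel_measurable L" for n
    by (intro borel_measurable_sum borel_measurable_times cm) auto
  have int: "(\<integral>\<^sup>+s. ennreal (?f n s) \<partial>L) = ennreal (mean_entropy n)" for n
  proof -
    have "(\<integral>\<^sup>+s. ennreal (?f n s) \<partial>L) = (\<integral>\<^sup>+s. (\<Sum>k<n. ennreal (spd_entropy (avg n k)) * indicator (cell n k) s) \<partial>L)"
    proof (rule nn_integral_cong)
      fix s
      have "ennreal (?f n s) = (\<Sum>k<n. ennreal (indicator (cell n k) s * spd_entropy (avg n k)))"
        by (rule sum_ennreal [symmetric]) (auto intro!: mult_nonneg_nonneg spd_entropy_nonneg avg_spd)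
      also have "\<dots> = (\<Sum>k<n. ennreal (spd_entropy (avg n k)) * indicator (cell n k) s)"
        by (intro sum.cong refl) (auto simp: indicator_def)
      finally show "ennreal (?f n s) = (\<Sum>k<n. ennreal (spd_entropy (avg n k)) * indicator (cell n k) s)" .
    qed
    also have "\<dots> = (\<Sum>k<n. ennreal (spd_entropy (avg n k)) * emeasure L (cell n k))"
      using cell_sets by (subst nn_integral_sum) (auto simp: nn_integral_cmult_indicator)
    also have "\<dots> = (\<Sum>k<n. ennreal (spd_entropy (avg n k) / real n))"
      using emeasure_cell spd_entropy_nonneg [OF avg_spd]
      by (intro sum.cong refl) (simp add: ennreal_mult' [symmetric])
    also have "\<dots> = ennreal (mean_entropy n)"
      unfolding mean_entropy_def sum_divide_distrib
      by (rule sum_ennreal) (auto intro!: divide_nonneg_nonneg spd_entropy_nonneg avg_spd)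
    finally show ?thesis .
  qed
  \<comment> \<open>The point 0 lies in no cell and is discarded as a null set.\<close>
  have "AE s in lebesgue. s \<noteq> (0 :: real)" by (rule AE_completion [OF AE_lborel_singleton])
  then have "AE s in L. s \<noteq> 0"
    by (subst AE_restrict_space_iff) (auto elim: eventually_mono)
  then have "AE s in L. ennreal (spd_entropy (G s)) \<le> liminf (\<lambda>n. ennreal (?f n s))"
    using a_deriv AE_space
  proof eventually_elim
    case (elim s)
    then have s: "0 < s" "s \<le> 1" by auto
    then have "\<forall>n. \<exists>k. 0 < n \<longrightarrow> k < n \<and> s \<in> cell n k" using cell_exists by blast
    then obtain k where k: "\<And>n. 0 < n \<Longrightarrow> k n < n \<and> s \<in> cell n (k n)" by metis
    have f: "?f n s = spd_entropy (avg n (k n))" if "0 < n" for n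
    proof -
      have "?f n s = (\<Sum>j<n. if j = k n then spd_entropy (avg n (k n)) else 0)"
        using disjoint_grid_intervals [of s "k n" n] k [OF that]
        by (intro sum.cong refl) (auto simp: indicator_def simp del: greaterThanAtMost_iff)
      then show ?thesis using k [OF that] by simp
    qed
    have "(\<lambda>n. spd_entropy (avg n (k n))) \<longlonglongrightarrow> spd_entropy (G s)"
      by (intro tendsto_spd_entropy avg_tendsto [OF elim(2) k] spd_det_pos G_spd) (use s in auto)
    then have "(\<lambda>n. ?f n s) \<longlonglongrightarrow> spd_entropy (G s)"
    proof (rule Lim_transform_eventually)
      show "eventually (\<lambda>n. spd_entropy (avg n (k n)) = ?f n s) sequentially"
        using eventually_gt_at_top [of 0] by eventually_elim (rule f [symmetric])
    qed
    then have "(\<lambda>n. ennreal (?f n s)) \<longlonglongrightarrow> ennreal (spd_entropy (G s))" by (rule tendsto_ennrealI)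
    then show ?case by (simp add: lim_imp_Liminf)
  qed
  then have "J \<le> (\<integral>\<^sup>+s. liminf (\<lambda>n. ennreal (?f n s)) \<partial>L)"
    unfolding J_def by (rule nn_integral_mono_AE)
  also have "\<dots> \<le> liminf (\<lambda>n. \<integral>\<^sup>+s. ennreal (?f n s) \<partial>L)"
    by (rule nn_integral_liminf) (rule measurable_compose [OF fm measurable_ennreal])
  finally show ?thesis unfolding int .
qed

section \<open>Quadratic sums of the trace\<close>

lemma a_continuous: "continuous_on {0..1} a"
proof -
  have GH: "G integrable_on {0..1}" using G_integrable by (intro integrable_on_lebesgue_on) auto
  have "a t = integral {0..t} G" if "t \<in> {0..1}" for t
  proof -
    have "integrable (lebesgue_on {0..t}) G"
    proof -
      have "integrable (lebesgue_on {0..1}) (\<lambda>s. indicator {0..t} s *\<^sub>R G s)"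
        using that by (intro integrable_mult_indicator G_integrable) (auto simp: sets_restrict_space_iff)
      then have "integrable lebesgue (\<lambda>s. indicator {0..1} s *\<^sub>R (indicator {0..t} s *\<^sub>R G s))"
        by (simp add: integrable_restrict_space)
      also have "(\<lambda>s. indicator {0..1} s *\<^sub>R (indicator {0..t} s *\<^sub>R G s)) = (\<lambda>s. indicator {0..t} s *\<^sub>R G s)"
        using that by (auto simp: indicator_def fun_eq_iff)
      finally show ?thesis by (simp add: integrable_restrict_space)
    qed
    then show ?thesis using that by (simp add: a_integral lebesgue_integral_eq_integral)
  qed
  then show ?thesis
    using indefinite_integral_continuous_1 [OF GH] continuous_on_cong by (metis (no_types, lifting))
qed

text \<open>Along the grid the trace of \<open>a\<close> is nondecreasing, so the sum of its squared
  increments is at most the largest increment times the total increase.\<close>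

lemma sum_trace_sq_tendsto: "(\<lambda>n. (\<Sum>k<n. (trace (avg n k))\<^sup>2) / (real n)\<^sup>2) \<longlonglongrightarrow> 0"
proof (rule LIMSEQ_I)
  fix e :: real assume e: "0 < e"
  let ?t = "\<lambda>s. trace (a s)"
  have ct: "continuous_on {0..1} ?t"
    by (rule continuous_on_compose2 [OF linear_continuous_on [OF bounded_linear_trace] a_continuous]) auto
  then have uc: "uniformly_continuous_on {0..1} ?t" by (rule compact_uniformly_continuous) simp
  \<comment> \<open>Adding 1 keeps \<open>T\<close> positive and makes the last estimate
    strict.\<close>
  define T where "T = \<bar>?t 1 - ?t 0\<bar> + 1"
  have T: "0 < T" by (simp add: T_def)
  have "0 < e / T" using e T by simp
  then obtain r where r: "0 < r" and ur: "\<And>x y. x \<in> {0..1} \<Longrightarrow> y \<in> {0..1} \<Longrightarrow> dist y x < r \<Longrightarrow> dist (?t y) (?t x) < e / T"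
    using uc unfolding uniformly_continuous_on_def by blast
  obtain N where N: "inverse (real (Suc N)) < r" using reals_Archimedean [OF r] by blast
  show "\<exists>n0. \<forall>n\<ge>n0. norm ((\<Sum>k<n. (trace (avg n k))\<^sup>2) / (real n)\<^sup>2 - 0) < e"
  proof (intro exI allI impI)
    fix n assume n: "Suc N \<le> n"
    then have n0: "0 < n" and rn: "0 < real n" by auto
    have "inverse (real n) \<le> inverse (real (Suc N))" using n by (intro le_imp_inverse_le) auto
    then have ir: "1 / real n < r" using N by (simp add: inverse_eq_divide)
    let ?p = "\<lambda>k. real k / real n"
    define D where "D k = ?t (?p (Suc k)) - ?t (?p k)" for k
    have av: "trace (avg n k) = real n * D k" for k
      unfolding avg_def D_def linear_cmul [OF bounded_linear.linear [OF bounded_linear_trace]]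
        linear_diff [OF bounded_linear.linear [OF bounded_linear_trace]] by simp
    have D0: "0 \<le> D k" if "k < n" for k
    proof -
      have "0 \<le> trace (avg n k)" using spd_entry_le_trace(1) [OF avg_spd [OF that]] by (meson abs_ge_zero order_trans)
      then show ?thesis using av [of k] rn by (simp add: zero_le_mult_iff)
    qed
    have De: "D k \<le> e / T" if "k < n" for k
    proof -
      have "dist (?p (Suc k)) (?p k) = 1 / real n"
        using grid_interval(2) [OF that] by (simp only: dist_real_def abs_of_nonneg diff_ge_0_iff_ge diff_divide_distrib [symmetric]) simp
      then have "dist (?t (?p (Suc k))) (?t (?p k)) < e / T"
        using grid_interval [OF that] ir by (intro ur) (simp_all only: atLeastAtMost_iff, auto)
      then show ?thesis unfolding D_def dist_real_def by linarith
    qed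
    have "(\<Sum>k<n. (trace (avg n k))\<^sup>2) / (real n)\<^sup>2 = (\<Sum>k<n. (D k)\<^sup>2)"
      using rn by (simp add: av power_mult_distrib sum_distrib_left [symmetric])
    also have "\<dots> \<le> (\<Sum>k<n. (e / T) * D k)"
      unfolding power2_eq_square using D0 De by (intro sum_mono mult_right_mono) auto
    also have "\<dots> = (e / T) * (?t (?p n) - ?t (?p 0))"
      unfolding sum_distrib_left [symmetric] D_def sum_lessThan_telescope [of "\<lambda>k. ?t (?p k)"] ..
    also have "\<dots> = (e / T) * (?t 1 - ?t 0)" using rn by simp
    also have "\<dots> < (e / T) * T" using e T by (intro mult_strict_left_mono) (auto simp: T_def)
    also have "\<dots> = e" using T by simp
    finally have "(\<Sum>k<n. (trace (avg n k))\<^sup>2) / (real n)\<^sup>2 < e" .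
    moreover have "0 \<le> (\<Sum>k<n. (trace (avg n k))\<^sup>2) / (real n)\<^sup>2" by (intro divide_nonneg_nonneg sum_nonneg) auto
    ultimately show "norm ((\<Sum>k<n. (trace (avg n k))\<^sup>2) / (real n)\<^sup>2 - 0) < e" by simp
  qed
qed

end

section \<open>Moments of the log-density\<close>

lemma normal_law_moments:
  assumes \<sigma>: "0 < \<sigma>"
  shows "integrable (normal_law \<sigma>) (\<lambda>y. y\<^sup>2 / \<sigma>\<^sup>2 - 1)" "(\<integral>y. y\<^sup>2 / \<sigma>\<^sup>2 - 1 \<partial>normal_law \<sigma>) = 0"
    "integrable (normal_law \<sigma>) (\<lambda>y. (y\<^sup>2 / \<sigma>\<^sup>2 - 1)\<^sup>2)" "(\<integral>y. (y\<^sup>2 / \<sigma>\<^sup>2 - 1)\<^sup>2 \<partial>normal_law \<sigma>) = 2"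
proof -
  interpret prob_space "normal_law \<sigma>" by (rule prob_space_normal_density [OF \<sigma>])
  have m: "has_bochner_integral (normal_law \<sigma>) (\<lambda>y. y ^ (2 * k)) (fact (2 * k) / ((2 / \<sigma>\<^sup>2)^k * fact k))" for k
    using normal_moment_even [OF \<sigma>, of 0 k]
    by (intro has_bochner_integral_density) auto
  have 2: "has_bochner_integral (normal_law \<sigma>) (\<lambda>y. y\<^sup>2) (\<sigma>\<^sup>2)"
    using m [of 1] by simp
  have 4: "has_bochner_integral (normal_law \<sigma>) (\<lambda>y. y ^ 4) (3 * \<sigma> ^ 4)"
    using m [of 2] by (simp add: fact_numeral power_divide power_mult [symmetric])
  note i = integrable.intros [OF 2] integrable.intros [OF 4]
  note v = has_bochner_integral_integral_eq [OF 2] has_bochner_integral_integral_eq [OF 4]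
  show "integrable (normal_law \<sigma>) (\<lambda>y. y\<^sup>2 / \<sigma>\<^sup>2 - 1)"
    using i by simp
  show "(\<integral>y. y\<^sup>2 / \<sigma>\<^sup>2 - 1 \<partial>normal_law \<sigma>) = 0"
    using i v \<sigma> prob_space by simp
  have eq: "(\<lambda>y. (y\<^sup>2 / \<sigma>\<^sup>2 - 1)\<^sup>2) = (\<lambda>y :: real. y ^ 4 / \<sigma> ^ 4 - 2 * (y\<^sup>2 / \<sigma>\<^sup>2) + 1)"
    using \<sigma> by (intro ext) (simp add: power2_diff power_divide power_mult [symmetric])
  show "integrable (normal_law \<sigma>) (\<lambda>y. (y\<^sup>2 / \<sigma>\<^sup>2 - 1)\<^sup>2)"
    unfolding eq using i by simp
  show "(\<integral>y. (y\<^sup>2 / \<sigma>\<^sup>2 - 1)\<^sup>2 \<partial>normal_law \<sigma>) = 2"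
    unfolding eq using i v \<sigma> prob_space by simp
qed

text \<open>Independence kills the mixed terms, and each remaining square contributes its squared
  weight times 2, the variance of a chi-square variable.\<close>

lemma normal_prod_chi_square:
  fixes c :: "'i \<Rightarrow> real"
  assumes I: "finite I" and \<sigma>: "0 < \<sigma>"
  defines "S \<equiv> \<lambda>x. \<Sum>a\<in>I. c a * ((x a)\<^sup>2 / \<sigma>\<^sup>2 - 1)"
  shows "integrable (normal_prod I \<sigma>) S" "(\<integral>x. S x \<partial>normal_prod I \<sigma>) = 0"
    "integrable (normal_prod I \<sigma>) (\<lambda>x. (S x)\<^sup>2)" "(\<integral>x. (S x)\<^sup>2 \<partial>normal_prod I \<sigma>) = 2 * (\<Sum>a\<in>I. (c a)\<^sup>2)"
proof -
  let ?P = "normal_prod I \<sigma>"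
  let ?h = "\<lambda>y. y\<^sup>2 / \<sigma>\<^sup>2 - 1"
  interpret N: product_prob_space "\<lambda>_. normal_law \<sigma>"
    by (rule product_prob_spaceI) (rule prob_space_normal_density [OF \<sigma>])
  note nm = normal_law_moments [OF \<sigma>]
  have prob1: "(\<integral>y. 1 \<partial>normal_law \<sigma>) = (1::real)"
    using prob_space.prob_space [OF prob_space_normal_density [OF \<sigma>]] by simp
  have int1: "integrable (normal_law \<sigma>) (\<lambda>y. 1 :: real)"
    using finite_measure.integrable_const [OF prob_space.finite_measure [OF prob_space_normal_density [OF \<sigma>]]] .
  have single: "integrable ?P (\<lambda>x. ?h (x a))" "(\<integral>x. ?h (x a) \<partial>?P) = 0" if a: "a \<in> I" for a
  proof -
    \<comment> \<open>A function of one coordinate is written as a product over all coordinates with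
      factor 1 elsewhere, the form that the product integral accepts.\<close>
    let ?f = "\<lambda>i y. if i = a then ?h y else 1"
    have e: "(\<lambda>x. ?h (x a)) = (\<lambda>x. \<Prod>i\<in>I. ?f i (x i))"
      using I a by (simp add: prod.delta)
    have fi: "integrable (normal_law \<sigma>) (?f i)" for i using nm int1 by (cases "i = a") simp_all
    show "integrable ?P (\<lambda>x. ?h (x a))" unfolding e by (rule N.product_integrable_prod [OF I fi])
    have "(\<integral>x. ?h (x a) \<partial>?P) = (\<Prod>i\<in>I. \<integral>y. ?f i y \<partial>normal_law \<sigma>)"
      unfolding e by (rule N.product_integral_prod [OF I fi])
    also have "\<dots> = 0" using I a nm by (intro prod_zero) (auto intro!: bexI [of _ a])
    finally show "(\<integral>x. ?h (x a) \<partial>?P) = 0" .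
  qed
  have pair: "integrable ?P (\<lambda>x. ?h (x a) * ?h (x b))" "(\<integral>x. ?h (x a) * ?h (x b) \<partial>?P) = (if a = b then 2 else 0)"
    if a: "a \<in> I" and b: "b \<in> I" for a b
  proof -
    \<comment> \<open>Multiplying two such factors in each coordinate covers \<open>a = b\<close>
      and \<open>a \<noteq> b\<close> at once.\<close>
    let ?f = "\<lambda>i y. (if i = a then ?h y else 1) * (if i = b then ?h y else 1)"
    have e: "(\<lambda>x. ?h (x a) * ?h (x b)) = (\<lambda>x. \<Prod>i\<in>I. ?f i (x i))"
      using I a b by (simp add: prod.distrib prod.delta)
    have fi: "integrable (normal_law \<sigma>) (?f i)" for i
      using nm int1 by (cases "i = a"; cases "i = b") (simp_all add: power2_eq_square)
    show "integrable ?P (\<lambda>x. ?h (x a) * ?h (x b))" unfolding e by (rule N.product_integrable_prod [OF I fi])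
    have "(\<integral>x. ?h (x a) * ?h (x b) \<partial>?P) = (\<Prod>i\<in>I. \<integral>y. ?f i y \<partial>normal_law \<sigma>)"
      unfolding e by (rule N.product_integral_prod [OF I fi])
    also have "\<dots> = (if a = b then 2 else 0)"
    proof (cases "a = b")
      case True
      have "(\<integral>y. ?f i y \<partial>normal_law \<sigma>) = (if i = a then 2 else 1)" for i
        using nm prob1 True by (simp add: power2_eq_square)
      then show ?thesis using I a True by (simp add: prod.delta)
    next
      case False
      then have "(\<integral>y. ?f a y \<partial>normal_law \<sigma>) = 0" using nm by simp
      then show ?thesis using I a False by (auto intro!: prod_zero bexI [of _ a])
    qed
    finally show "(\<integral>x. ?h (x a) * ?h (x b) \<partial>?P) = (if a = b then 2 else 0)" .
  qed
  show "integrable ?P S" "(\<integral>x. S x \<partial>?P) = 0"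
    unfolding S_def using single by (simp_all add: Bochner_Integration.integral_sum)
  have sq: "(\<lambda>x. (S x)\<^sup>2) = (\<lambda>x. \<Sum>a\<in>I. \<Sum>b\<in>I. (c a * c b) * (?h (x a) * ?h (x b)))"
    unfolding S_def power2_eq_square [of "sum _ _"] sum_product by (simp only: mult_ac)
  show "integrable ?P (\<lambda>x. (S x)\<^sup>2)"
    unfolding sq by (intro Bochner_Integration.integrable_sum integrable_mult_right pair)
  have "(\<integral>x. (S x)\<^sup>2 \<partial>?P) = (\<Sum>a\<in>I. \<Sum>b\<in>I. (c a * c b) * (if a = b then 2 else 0))"
    unfolding sq using pair
    by (subst Bochner_Integration.integral_sum, intro Bochner_Integration.integrable_sum integrable_mult_right pair)
       (auto intro!: sum.cong simp: Bochner_Integration.integral_sum)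
  also have "\<dots> = 2 * (\<Sum>a\<in>I. (c a)\<^sup>2)"
    using I by (simp add: if_distrib [of "\<lambda>z. _ * z"] sum_distrib_left power2_eq_square mult_ac cong: if_cong)
  finally show "(\<integral>x. (S x)\<^sup>2 \<partial>?P) = 2 * (\<Sum>a\<in>I. (c a)\<^sup>2)" .
qed

section \<open>Diagonal form of the averages and fluctuation of the log-density\<close>

context volatility
begin

text \<open>For \<open>k \<ge> n\<close> only orthogonality and positivity are required, so
  rotations and scales exist for every index; the lemmas on Gaussian vectors quantify over all of
  them.\<close>

definition eig :: "nat \<Rightarrow> nat \<Rightarrow> (real ^ 'l ^ 'l) \<times> ('l \<Rightarrow> real)" where
  "eig n k = (SOME p. orthogonal_matrix (fst p) \<and> (\<forall>i. 0 < snd p i) \<and>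
     (k < n \<longrightarrow> avg n k = fst p ** diag_mat (snd p) ** transpose (fst p)))"

definition rotation :: "nat \<Rightarrow> nat \<Rightarrow> real ^ 'l ^ 'l" where
  "rotation n k = fst (eig n k)"

definition eigval :: "nat \<Rightarrow> nat \<times> 'l \<Rightarrow> real" where
  "eigval n x = snd (eig n (fst x)) (snd x)"

lemma eig:
  shows orthogonal_rotation: "orthogonal_matrix (rotation n k)" and eigval_pos: "0 < eigval n (k, i)"
    and avg_eq: "k < n \<Longrightarrow> avg n k = rotation n k ** diag_mat (\<lambda>i. eigval n (k, i)) ** transpose (rotation n k)"
proof -
  have ex: "\<exists>p. orthogonal_matrix (fst p) \<and> (\<forall>i. 0 < snd p i) \<and>
     (k < n \<longrightarrow> avg n k = fst p ** diag_mat (snd p) ** transpose (fst p))"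
  proof (cases "k < n")
    case True
    obtain Q d where "orthogonal_matrix Q" "\<forall>i. 0 < d i" "avg n k = Q ** diag_mat d ** transpose Q"
      using spd_diagonalisable [OF avg_spd [OF True]] by blast
    then show ?thesis by (intro exI [of _ "(Q, d)"]) simp
  next
    case False
    then show ?thesis by (intro exI [of _ "(mat 1, \<lambda>_. 1)"]) (simp add: orthogonal_matrix_id)
  qed
  have *: "orthogonal_matrix (fst (eig n k)) \<and> (\<forall>i. 0 < snd (eig n k) i) \<and>
     (k < n \<longrightarrow> avg n k = fst (eig n k) ** diag_mat (snd (eig n k)) ** transpose (fst (eig n k)))"
    unfolding eig_def by (rule someI_ex [OF ex])
  then show "orthogonal_matrix (rotation n k)" "0 < eigval n (k, i)"
    by (simp_all add: rotation_def eigval_def)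
  show "avg n k = rotation n k ** diag_mat (\<lambda>i. eigval n (k, i)) ** transpose (rotation n k)" if "k < n"
    using * that by (simp add: rotation_def eigval_def)
qed

lemma eigval_pos': "0 < eigval n x"
  using eigval_pos [of n "fst x" "snd x"] by simp

lemma trace_avg: "k < n \<Longrightarrow> trace (avg n k) = (\<Sum>i\<in>UNIV. eigval n (k, i))"
  by (subst avg_eq) (simp_all add: trace_conj_diag [OF orthogonal_rotation])

lemma spd_entropy_avg: "k < n \<Longrightarrow> spd_entropy (avg n k) = (\<Sum>i\<in>UNIV. eigval n (k, i) - 1 - ln (eigval n (k, i)))"
  by (subst avg_eq) (simp_all add: spd_entropy_conj_diag [OF orthogonal_rotation eigval_pos])

abbreviation scaling :: "nat \<Rightarrow> (nat \<times> 'l \<Rightarrow> real) \<Rightarrow> nat \<times> 'l \<Rightarrow> real" where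
  "scaling n \<equiv> scale_grid n (\<lambda>b. sqrt (eigval n b))"

text \<open>The log-density of the increments, expressed in the driving Gaussian vector \<open>x\<close>.\<close>

definition gauss_log_density :: "nat \<Rightarrow> (nat \<times> 'l \<Rightarrow> real) \<Rightarrow> real" where
  "gauss_log_density n x = (\<Sum>b\<in>gridset n. ((eigval n b - 1) * (real n * (x b)\<^sup>2) - ln (eigval n b)) / 2)"

abbreviation driver :: "nat \<Rightarrow> (nat \<times> 'l \<Rightarrow> real) measure" where
  "driver n \<equiv> normal_prod (gridset n) (sqrt (1 / real n))"

text \<open>For an eigenvalue \<open>d\<close> and a normalised square \<open>y\<close>, the term
  \<open>(d - 1) * y - ln d\<close> is \<open>(d - 1) * (y - 1)\<close> plus
  \<open>d - 1 - ln d\<close>: a centred chi-square part and the contribution of \<open>d\<close> to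
  the entropy.\<close>

lemma gauss_log_density_eq:
  assumes n: "0 < n"
  shows "gauss_log_density n x = (\<Sum>b\<in>gridset n. (eigval n b - 1) / 2 * ((x b)\<^sup>2 / (sqrt (1 / real n))\<^sup>2 - 1)) + real n * mean_entropy n / 2"
proof -
  have "real n * mean_entropy n = (\<Sum>b\<in>gridset n. eigval n b - 1 - ln (eigval n b))"
    using n by (simp add: mean_entropy_def spd_entropy_avg sum.cartesian_product split_def)
  then have "real n * mean_entropy n / 2 = (\<Sum>b\<in>gridset n. (eigval n b - 1 - ln (eigval n b)) / 2)"
    by (simp only: sum_divide_distrib)
  moreover have "((eigval n b - 1) * (real n * (x b)\<^sup>2) - ln (eigval n b)) / 2
    = (eigval n b - 1) / 2 * ((x b)\<^sup>2 / (sqrt (1 / real n))\<^sup>2 - 1) + (eigval n b - 1 - ln (eigval n b)) / 2" for b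
    using n by (simp add: field_simps)
  ultimately show ?thesis
    unfolding gauss_log_density_def by (simp only: sum.distrib)
qed

lemma gauss_log_density_integral:
  assumes n: "0 < n"
  shows "integrable (driver n) (gauss_log_density n)"
    and "(\<integral>x. gauss_log_density n x \<partial>driver n) = real n * mean_entropy n / 2"
proof -
  have \<sigma>: "0 < sqrt (1 / real n)" using n by simp
  interpret prob_space "driver n" by (rule prob_space_normal_prod [OF \<sigma>])
  have fin: "finite (gridset n :: (nat \<times> 'l) set)" by simp
  note c = normal_prod_chi_square [OF fin \<sigma>, of "\<lambda>b. (eigval n b - 1) / 2"]
  show "integrable (driver n) (gauss_log_density n)"
    unfolding gauss_log_density_eq [OF n, abs_def] using c(1) by simp
  show "(\<integral>x. gauss_log_density n x \<partial>driver n) = real n * mean_entropy n / 2"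
    unfolding gauss_log_density_eq [OF n] using c(1,2) prob_space by simp
qed

lemma gauss_log_density_L1:
  assumes n: "0 < n"
  shows "(\<integral>x. \<bar>gauss_log_density n x / real n - mean_entropy n / 2\<bar> \<partial>driver n)
    \<le> sqrt ((\<Sum>k<n. (trace (avg n k))\<^sup>2) / (real n)\<^sup>2 + real CARD('l) / real n)"
proof -
  let ?A = "\<integral>x. \<bar>gauss_log_density n x / real n - mean_entropy n / 2\<bar> \<partial>driver n"
  let ?T = "\<Sum>k<n. (trace (avg n k))\<^sup>2"
  let ?V = "\<Sum>b\<in>gridset n. ((eigval n b - 1) / 2)\<^sup>2"
  have \<sigma>: "0 < sqrt (1 / real n)" using n by simp
  interpret prob_space "driver n" by (rule prob_space_normal_prod [OF \<sigma>])
  have fin: "finite (gridset n :: (nat \<times> 'l) set)" by simp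
  define S where "S x = (\<Sum>b\<in>gridset n. (eigval n b - 1) / 2 * ((x b)\<^sup>2 / (sqrt (1 / real n))\<^sup>2 - 1))" for x
  note c = normal_prod_chi_square [OF fin \<sigma>, of "\<lambda>b. (eigval n b - 1) / 2", folded S_def]
  have "gauss_log_density n x / real n - mean_entropy n / 2 = S x / real n" for x
    unfolding gauss_log_density_eq [OF n] S_def [symmetric] using n by (simp add: field_simps)
  then have "?A = (\<integral>x. \<bar>S x\<bar> \<partial>driver n) / real n"
    by (simp add: abs_div_pos [symmetric])
  moreover have "(\<integral>x. \<bar>S x\<bar> \<partial>driver n) \<le> sqrt (2 * ?V)"
  proof (rule real_le_rsqrt)
    \<comment> \<open>Nonnegativity of the variance of \<open>\<bar>S x\<bar>\<close> serves as the
      Cauchy-Schwarz inequality.\<close>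
    have "(\<integral>x. \<bar>S x\<bar> \<partial>driver n)\<^sup>2 \<le> (\<integral>x. \<bar>S x\<bar>\<^sup>2 \<partial>driver n)"
      using variance_positive [of "\<lambda>x. \<bar>S x\<bar>"] variance_eq [of "\<lambda>x. \<bar>S x\<bar>"] c(1,3) by simp
    then show "(\<integral>x. \<bar>S x\<bar> \<partial>driver n)\<^sup>2 \<le> 2 * ?V"
      using c(4) by simp
  qed
  moreover have "2 * ?V \<le> ?T + real CARD('l) * real n"
  proof -
    have "2 * ?V = (\<Sum>k<n. \<Sum>i\<in>UNIV. (eigval n (k, i) - 1)\<^sup>2 / 2)"
      by (simp add: sum.cartesian_product split_def sum_distrib_left power_divide)
    also have "\<dots> \<le> (\<Sum>k<n. (trace (avg n k))\<^sup>2 + real CARD('l))"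
    proof (rule sum_mono)
      fix k assume k: "k \<in> {..<n}"
      have tr: "trace (avg n k) = (\<Sum>i\<in>UNIV. eigval n (k, i))" using trace_avg k by simp
      \<comment> \<open>A squared eigenvalue is at most the eigenvalue times the trace, and summing
        these products over the eigenvalues gives the squared trace.\<close>
      have "(\<Sum>i\<in>UNIV. (eigval n (k, i) - 1)\<^sup>2 / 2) \<le> (\<Sum>i\<in>UNIV. eigval n (k, i) * trace (avg n k) + 1)"
      proof (rule sum_mono)
        fix i
        have p: "0 < eigval n (k, i)" by (rule eigval_pos)
        have "eigval n (k, i) \<le> trace (avg n k)"
          unfolding tr using eigval_pos by (intro member_le_sum) (auto simp: less_imp_le)
        then have "eigval n (k, i) * eigval n (k, i) \<le> eigval n (k, i) * trace (avg n k)"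
          using p by (intro mult_left_mono) auto
        moreover have "(eigval n (k, i) - 1)\<^sup>2 \<le> eigval n (k, i) * eigval n (k, i) + 1"
          using p by (simp add: power2_eq_square algebra_simps)
        ultimately show "(eigval n (k, i) - 1)\<^sup>2 / 2 \<le> eigval n (k, i) * trace (avg n k) + 1"
          using zero_le_square [of "eigval n (k, i)"] by linarith
      qed
      also have "\<dots> = (trace (avg n k))\<^sup>2 + real CARD('l)"
        by (simp add: sum.distrib sum_distrib_right [symmetric] tr [symmetric] power2_eq_square)
      finally show "(\<Sum>i\<in>UNIV. (eigval n (k, i) - 1)\<^sup>2 / 2) \<le> (trace (avg n k))\<^sup>2 + real CARD('l)" .
    qed
    also have "\<dots> = ?T + real CARD('l) * real n"
      by (simp add: sum.distrib mult.commute)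
    finally show ?thesis .
  qed
  ultimately have "?A
    \<le> sqrt (?T + real CARD('l) * real n) / real n"
    by (simp add: divide_right_mono order_trans [OF _ real_sqrt_le_mono])
  also have "\<dots> = sqrt ((?T + real CARD('l) * real n) / (real n)\<^sup>2)"
    by (simp add: real_sqrt_divide)
  also have "(?T + real CARD('l) * real n) / (real n)\<^sup>2 = ?T / (real n)\<^sup>2 + real CARD('l) / real n"
    using n by (simp add: add_divide_distrib power2_eq_square)
  finally show ?thesis .
qed

text \<open>No log det enters the bound, so the fluctuation vanishes even when the entropy integral
  is infinite.\<close>

lemma gauss_log_density_L1_tendsto:
  "(\<lambda>n. \<integral>x. \<bar>gauss_log_density n x / real n - mean_entropy n / 2\<bar> \<partial>driver n) \<longlonglongrightarrow> 0"
proof (rule tendsto_sandwich [where f = "\<lambda>_. 0"])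
  show "eventually (\<lambda>n. (\<integral>x. \<bar>gauss_log_density n x / real n - mean_entropy n / 2\<bar> \<partial>driver n)
     \<le> sqrt ((\<Sum>k<n. (trace (avg n k))\<^sup>2) / (real n)\<^sup>2 + real CARD('l) / real n)) sequentially"
    using eventually_gt_at_top [of 0] by eventually_elim (rule gauss_log_density_L1)
  have "(\<lambda>n. sqrt ((\<Sum>k<n. (trace (avg n k))\<^sup>2) / (real n)\<^sup>2 + real CARD('l) * (1 / real n))) \<longlonglongrightarrow> sqrt (0 + real CARD('l) * 0)"
    by (intro tendsto_intros sum_trace_sq_tendsto lim_1_over_n)
  then show "(\<lambda>n. sqrt ((\<Sum>k<n. (trace (avg n k))\<^sup>2) / (real n)\<^sup>2 + real CARD('l) / real n)) \<longlonglongrightarrow> 0" by simp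
qed auto

text \<open>Both sides have the exponent of a centred Gaussian vector whose covariance block for
  cell \<open>k\<close> is \<open>avg n k\<close> divided by \<open>n\<close>. On the left the
  symmetric root squares to \<open>G\<close> inside the norm and the quadratic forms of
  \<open>G\<close> are integrated over the cell; on the right the block comes from a rotation after
  a diagonal scaling.\<close>

lemma distr_grid_incr_ito:
  fixes B Y :: "real \<Rightarrow> 'w \<Rightarrow> real ^ 'l"
  assumes B: "brownian_motion M B" and Y: "stochastic_integral M B (\<lambda>s. spd_sqrt (G s)) Y" and n: "0 < n"
  shows "distr M (grid_borel n) (\<lambda>w. grid_incr n (\<lambda>t. Y t w))
    = distr (driver n) (grid_borel n) (\<lambda>x. rotate_grid n (rotation n) (scaling n x))"
proof -
  let ?\<sigma> = "sqrt (1 / real n)"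
  have \<sigma>: "0 < ?\<sigma>" using n by simp
  have M: "prob_space M" using B by (simp add: brownian_motion_def)
  have Ym: "Y t \<in> borel_measurable M" if "t \<in> {0..1}" for t
    using Y that by (simp add: stochastic_integral_def)
  \<comment> \<open>This factor is preferred to the symmetric root of \<open>avg n k\<close> because
    it acts as a coordinatewise scaling followed by a rotation.\<close>
  define A where "A k = rotation n k ** diag_mat (\<lambda>i. sqrt (eigval n (k, i)))" for k
  have AA: "A k ** transpose (A k) = avg n k" if "k < n" for k
  proof -
    have "A k ** transpose (A k) = rotation n k ** (diag_mat (\<lambda>i. sqrt (eigval n (k, i))) ** diag_mat (\<lambda>i. sqrt (eigval n (k, i)))) ** transpose (rotation n k)"
      unfolding A_def matrix_transpose_mul transpose_diag_mat by (simp only: matrix_mul_assoc)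
    also have "\<dots> = avg n k"
      unfolding diag_mat_mult avg_eq [OF that] using eigval_pos by (simp add: less_imp_le)
    finally show ?thesis .
  qed
  have normA: "(norm (transpose (A k) *v u))\<^sup>2 = u \<bullet> (avg n k *v u)" if "k < n" for k u
  proof -
    have "(transpose (A k) *v u) \<bullet> (transpose (A k) *v u) = u \<bullet> (A k *v (transpose (A k) *v u))"
      by (rule inner_matrix_vec [symmetric])
    then show ?thesis by (simp only: power2_norm_eq_inner matrix_vector_mul_assoc AA [OF that])
  qed
  have normS: "(norm (transpose (spd_sqrt (G s)) *v u))\<^sup>2 = u \<bullet> (G s *v u)" if "s \<in> {0..1}" for s u
  proof -
    have S: "spd_sqrt (G s) ** spd_sqrt (G s) = G s" "transpose (spd_sqrt (G s)) = spd_sqrt (G s)"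
      using spd_sqrt [OF G_spd [OF that]] by (simp_all add: spd_def)
    have "(transpose (spd_sqrt (G s)) *v u) \<bullet> (transpose (spd_sqrt (G s)) *v u) = u \<bullet> (spd_sqrt (G s) *v (transpose (spd_sqrt (G s)) *v u))"
      by (rule inner_matrix_vec [symmetric])
    then show ?thesis by (simp only: power2_norm_eq_inner matrix_vector_mul_assoc S)
  qed
  have disj: "disjoint_family_on (cell n) {..<n}"
    unfolding disjoint_family_on_def using disjoint_grid_intervals by blast
  have char: "(CLINT w|M. iexp (\<Sum>k<n. u k \<bullet> (Y (real (Suc k) / real n) w - Y (real k / real n) w)))
     = exp (- of_real (?\<sigma>\<^sup>2 * (\<Sum>k<n. (norm (transpose (A k) *v u k))\<^sup>2) / 2))" for u
  proof -
    have "(LINT s|L. (norm (\<Sum>k<n. indicator (cell n k) s *\<^sub>R (transpose (spd_sqrt (G s)) *v u k)))\<^sup>2)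
       = (LINT s|L. (\<Sum>k<n. indicator (cell n k) s * (u k \<bullet> (G s *v u k))))"
      by (intro Bochner_Integration.integral_cong refl, subst norm_disjoint_sum_sq [OF finite_lessThan disj])
         (simp only: space_lebesgue_on normS)
    also have "\<dots> = (\<Sum>k<n. LINT s|L. indicator (cell n k) s * (u k \<bullet> (G s *v u k)))"
      by (intro Bochner_Integration.integral_sum integrable_cell_functional bounded_linear_quad) simp
    also have "\<dots> = (\<Sum>k<n. (1 / real n) * (u k \<bullet> (avg n k *v u k)))"
      using n by (intro sum.cong refl, subst functional_avg [OF bounded_linear_quad]) auto
    also have "\<dots> = ?\<sigma>\<^sup>2 * (\<Sum>k<n. (norm (transpose (A k) *v u k))\<^sup>2)"
      unfolding sum_distrib_left [symmetric] by (simp add: normA del: transpose_matrix_vector)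
    finally have *: "(LINT s|L. (norm (\<Sum>k<n. indicator (cell n k) s *\<^sub>R (transpose (spd_sqrt (G s)) *v u k)))\<^sup>2)
       = ?\<sigma>\<^sup>2 * (\<Sum>k<n. (norm (transpose (A k) *v u k))\<^sup>2)" .
    show ?thesis
      unfolding * [symmetric]
      by (rule stochastic_integral_char [OF B Y, where r = "\<lambda>k. real k / real n"])
         (use grid_interval(2) grid_point [OF n] in auto)
  qed
  have "distr M (grid_borel n) (\<lambda>w. grid_incr n (\<lambda>t. Y t w))
    = distr (driver n) (grid_borel n) (\<lambda>x. flat n (\<lambda>k. A k *v unflat x k))"
    unfolding grid_incr_def
  proof (rule distr_normal_prod_eqI [OF M \<sigma> _ char])
    fix k assume "k < n"
    then show "(\<lambda>w. Y (real (Suc k) / real n) w - Y (real k / real n) w) \<in> borel_measurable M"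
      using grid_point [OF n, of k] grid_point [OF n, of "Suc k"] by (intro borel_measurable_diff Ym) auto
  qed
  also have "(\<lambda>x. flat n (\<lambda>k. A k *v unflat x k)) = (\<lambda>x. rotate_grid n (rotation n) (scaling n x))"
  proof
    fix x
    have "A k *v unflat x k = rotation n k *v unflat (scaling n x) k" if "k < n" for k
    proof -
      have "diag_mat (\<lambda>i. sqrt (eigval n (k, i))) *v unflat x k = unflat (scaling n x) k"
        using that by (simp add: diag_mat_vec unflat_def scale_grid_def)
      then show ?thesis by (simp only: A_def matrix_vector_mul_assoc [symmetric])
    qed
    then show "flat n (\<lambda>k. A k *v unflat x k) = rotate_grid n (rotation n) (scaling n x)"
      unfolding rotate_grid_def flat_def by (intro restrict_ext) auto
  qed
  finally show ?thesis .
qed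

end

section \<open>Laws on path space\<close>

lemma space_coord_algebra: "space (coord_algebra T) = path_space"
  by (simp add: coord_algebra_def space_measure_of_conv)

lemma sets_coord_algebra:
  "sets (coord_algebra T) = sigma_sets path_space {{\<omega> \<in> path_space. \<omega> t \<in> A} | t A. t \<in> T \<and> A \<in> sets borel}"
  unfolding coord_algebra_def by (rule sets_measure_of) blast

lemma coord_measurable:
  assumes "t \<in> T"
  shows "(\<lambda>\<omega>. \<omega> t) \<in> borel_measurable (coord_algebra T)"
proof (rule measurableI)
  fix A :: "(real ^ 'l) set" assume "A \<in> sets borel"
  then have "{\<omega> \<in> path_space. \<omega> t \<in> A} \<in> sets (coord_algebra T)"
    unfolding sets_coord_algebra using assms by (intro sigma_sets.Basic) blast
  then show "(\<lambda>\<omega>. \<omega> t) -` A \<inter> space (coord_algebra T) \<in> sets (coord_algebra T)"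
    by (simp add: space_coord_algebra vimage_def Int_def conj_commute)
qed simp

lemma grid_subset:
  assumes "0 < n"
  shows "{real k / real n | k. k \<le> n} \<subseteq> {0..1}"
  using grid_point [OF assms] by blast

lemma sets_grid_subset: "0 < n \<Longrightarrow> sets (grid_algebra n) \<subseteq> sets path_algebra"
  unfolding grid_algebra_def sets_coord_algebra by (intro sigma_sets_mono' subsetI) (use grid_subset in blast)

lemma subalgebra_grid:
  assumes "0 < n" "sets P = sets path_algebra"
  shows "subalgebra P (grid_algebra n)"
  unfolding subalgebra_def
  using sets_grid_subset [OF assms(1)] assms(2) sets_eq_imp_space_eq [OF assms(2)]
  by (simp add: grid_algebra_def space_coord_algebra)

lemma grid_incr_measurable:
  assumes n: "0 < n"
  shows "grid_incr n \<in> measurable (grid_algebra n) (grid_borel n)"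
  unfolding grid_incr_def
proof (rule flat_measurable)
  fix k assume k: "k < n"
  have "real k / real n \<in> {real k / real n | k. k \<le> n}" "real (Suc k) / real n \<in> {real k / real n | k. k \<le> n}"
    using k by (auto intro: less_imp_le Suc_leI simp del: of_nat_Suc)
  then show "(\<lambda>\<omega>. \<omega> (real (Suc k) / real n) - \<omega> (real k / real n)) \<in> borel_measurable (grid_algebra n)"
    unfolding grid_algebra_def by (intro borel_measurable_diff coord_measurable)
qed

text \<open>The grid algebra contains the starting position, which increments do not determine. On
  paths from 0 the position at a grid point is a sum of increments, so generators factor through
  \<open>grid_incr\<close>, and this passes to complements and countable unions.\<close>

lemma grid_set_factor:
  assumes n: "0 < n" and E: "E \<in> sets (grid_algebra n :: (real \<Rightarrow> real ^ 'l) measure)"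
  shows "\<exists>E'\<in>sets (grid_borel n). \<forall>\<omega>\<in>path_space. \<omega> 0 = 0 \<longrightarrow> (\<omega> \<in> E \<longleftrightarrow> grid_incr n \<omega> \<in> E')"
  using E unfolding grid_algebra_def sets_coord_algebra
proof (induction E rule: sigma_sets.induct)
  case (Basic a)
  then obtain k A where a: "a = {\<omega> \<in> path_space. \<omega> (real k / real n) \<in> A}" and k: "k \<le> n" and A: "A \<in> sets borel"
    by blast
  let ?s = "\<lambda>x. \<Sum>j<k. unflat x j :: real ^ 'l"
  have m: "?s \<in> borel_measurable (grid_borel n)"
    using k by (intro borel_measurable_sum unflat_measurable) auto
  have "?s (grid_incr n \<omega>) = \<omega> (real k / real n)" if "\<omega> 0 = 0" for \<omega>
  proof -
    have "?s (grid_incr n \<omega>) = (\<Sum>j<k. \<omega> (real (Suc j) / real n) - \<omega> (real j / real n))"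
      unfolding grid_incr_def using k by (intro sum.cong refl unflat_flat) auto
    also have "\<dots> = \<omega> (real k / real n) - \<omega> (real 0 / real n)"
      by (rule sum_lessThan_telescope [of "\<lambda>j. \<omega> (real j / real n)"])
    finally show ?thesis using that by simp
  qed
  then have "\<forall>\<omega>\<in>path_space. \<omega> 0 = 0 \<longrightarrow> (\<omega> \<in> a \<longleftrightarrow> grid_incr n \<omega> \<in> ?s -` A \<inter> space (grid_borel n))"
    by (simp add: a space_PiM grid_incr_def flat_def)
  then show ?case using measurable_sets [OF m A] by blast
next
  case Empty
  show ?case by (intro bexI [of _ "{}"]) auto
next
  case (Compl a)
  then obtain E' where "E' \<in> sets (grid_borel n)"
    "\<forall>\<omega>\<in>path_space. \<omega> 0 = 0 \<longrightarrow> (\<omega> \<in> a \<longleftrightarrow> grid_incr n \<omega> \<in> E')" by blast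
  moreover have "grid_incr n \<omega> \<in> space (grid_borel n)" for \<omega> :: "real \<Rightarrow> real ^ 'l"
    by (simp add: space_PiM grid_incr_def flat_def)
  ultimately show ?case by (intro bexI [of _ "space (grid_borel n) - E'"]) auto
next
  case (Union a)
  then have "\<forall>i. \<exists>E'. E' \<in> sets (grid_borel n) \<and> (\<forall>\<omega>\<in>path_space. \<omega> 0 = 0 \<longrightarrow> (\<omega> \<in> a i \<longleftrightarrow> grid_incr n \<omega> \<in> E'))" by blast
  then obtain E' where "\<And>i. E' i \<in> sets (grid_borel n)"
    "\<And>i. \<forall>\<omega>\<in>path_space. \<omega> 0 = 0 \<longrightarrow> (\<omega> \<in> a i \<longleftrightarrow> grid_incr n \<omega> \<in> E' i)" by metis
  then show ?case by (intro bexI [of _ "\<Union>i. E' i"]) (blast, blast)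
qed

text \<open>Common interface of the Brownian motion and the stochastic integral. The start at 0 is
  asked almost surely because the L2 definition of the integral gives no more.\<close>

locale path_process =
  fixes M :: "'w measure" and X :: "real \<Rightarrow> 'w \<Rightarrow> real ^ 'l"
  assumes M: "prob_space M"
    and X_measurable: "\<And>t. t \<in> {0..1} \<Longrightarrow> X t \<in> borel_measurable M"
    and X_continuous: "\<And>w. w \<in> space M \<Longrightarrow> continuous_on {0..1} (\<lambda>t. X t w)"
    and X_zero: "AE w in M. X 0 w = 0"
begin

abbreviation path :: "'w \<Rightarrow> real \<Rightarrow> real ^ 'l" where
  "path w \<equiv> restrict (\<lambda>t. X t w) {0..1}"

lemma path_in_space:
  assumes "w \<in> space M"
  shows "path w \<in> path_space"
proof -
  have "continuous_on {0..1} (path w) \<longleftrightarrow> continuous_on {0..1} (\<lambda>t. X t w)"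
    by (intro continuous_on_cong) auto
  then show ?thesis using X_continuous [OF assms] by (simp add: path_space_def)
qed

lemma path_measurable: "path \<in> measurable M path_algebra"
  unfolding coord_algebra_def
proof (rule measurable_measure_of)
  show "path \<in> space M \<rightarrow> path_space" using path_in_space by blast
  fix E assume "E \<in> {{\<omega> \<in> path_space. \<omega> t \<in> A} | t A. t \<in> {0..1} \<and> A \<in> sets (borel :: (real ^ 'l) measure)}"
  then obtain t A where E: "E = {\<omega> \<in> path_space. \<omega> t \<in> A}" and t: "t \<in> {0..1}" and A: "A \<in> sets borel" by blast
  have "path -` E \<inter> space M = X t -` A \<inter> space M"
    using path_in_space t by (auto simp: E)
  then show "path -` E \<inter> space M \<in> sets M" using measurable_sets [OF X_measurable [OF t] A] by simp
qed blast

lemma sets_path_law: "sets (path_law M X) = sets path_algebra"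
  by (simp add: path_law_def)

lemma prob_space_path_law: "prob_space (path_law M X)"
  unfolding path_law_def by (rule prob_space.prob_space_distr [OF M path_measurable])

lemma grid_incr_path: "0 < n \<Longrightarrow> grid_incr n (path w) = grid_incr n (\<lambda>t. X t w)"
  unfolding grid_incr_def flat_def using grid_interval
  by (intro restrict_ext) (auto simp del: of_nat_Suc)

lemma subalgebra_path_law: "0 < n \<Longrightarrow> subalgebra (path_law M X) (grid_algebra n)"
  by (rule subalgebra_grid [OF _ sets_path_law])

lemma grid_incr_process_measurable:
  assumes n: "0 < n"
  shows "(\<lambda>w. grid_incr n (\<lambda>t. X t w)) \<in> measurable M (grid_borel n)"
  unfolding grid_incr_def
proof (rule flat_measurable)
  fix k assume "k < n"
  then show "(\<lambda>w. X (real (Suc k) / real n) w - X (real k / real n) w) \<in> borel_measurable M"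
    using grid_point [OF n, of k] grid_point [OF n, of "Suc k"] by (intro borel_measurable_diff X_measurable) auto
qed

text \<open>Almost every path starts at 0, so \<open>E\<close> may be replaced by \<open>E'\<close>
  and the integral moves to the law of the increments. This serves for the mass of an event under
  one law and for the integral of the density under the other.\<close>

lemma nn_integral_path_law:
  assumes n: "0 < n" and E: "E \<in> sets (grid_algebra n)" and E': "E' \<in> sets (grid_borel n)"
    and eq: "\<And>\<omega>. \<omega> \<in> path_space \<Longrightarrow> \<omega> 0 = 0 \<Longrightarrow> (\<omega> \<in> E \<longleftrightarrow> grid_incr n \<omega> \<in> E')"
    and f: "f \<in> borel_measurable (grid_borel n)"
  shows "(\<integral>\<^sup>+\<omega>. f (grid_incr n \<omega>) * indicator E \<omega> \<partial>grid_restr n (path_law M X))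
    = (\<integral>\<^sup>+x. f x * indicator E' x \<partial>distr M (grid_borel n) (\<lambda>w. grid_incr n (\<lambda>t. X t w)))"
proof -
  have m: "(\<lambda>\<omega>. f (grid_incr n \<omega>) * indicator E \<omega>) \<in> borel_measurable (grid_algebra n)"
    using E by (intro borel_measurable_times_ennreal borel_measurable_indicator measurable_compose [OF grid_incr_measurable [OF n] f])
  have "(\<integral>\<^sup>+\<omega>. f (grid_incr n \<omega>) * indicator E \<omega> \<partial>grid_restr n (path_law M X))
      = (\<integral>\<^sup>+\<omega>. f (grid_incr n \<omega>) * indicator E \<omega> \<partial>path_law M X)"
    unfolding grid_restr_def by (rule nn_integral_subalgebra2 [OF subalgebra_path_law [OF n] m])
  also have "\<dots> = (\<integral>\<^sup>+w. f (grid_incr n (path w)) * indicator E (path w) \<partial>M)"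
    unfolding path_law_def
    by (rule nn_integral_distr [OF path_measurable])
       (use measurable_from_subalg [OF subalgebra_path_law [OF n] m] in \<open>simp add: path_law_def\<close>)
  also have "\<dots> = (\<integral>\<^sup>+w. f (grid_incr n (\<lambda>t. X t w)) * indicator E' (grid_incr n (\<lambda>t. X t w)) \<partial>M)"
  proof (rule nn_integral_cong_AE)
    show "AE w in M. f (grid_incr n (path w)) * indicator E (path w) = f (grid_incr n (\<lambda>t. X t w)) * indicator E' (grid_incr n (\<lambda>t. X t w))"
      using X_zero AE_space
    proof eventually_elim
      case (elim w)
      then have "path w \<in> E \<longleftrightarrow> grid_incr n (path w) \<in> E'"
        by (intro eq path_in_space) simp_all
      then show ?case by (simp add: grid_incr_path [OF n] indicator_def)
    qed
  qed
  also have "\<dots> = (\<integral>\<^sup>+x. f x * indicator E' x \<partial>distr M (grid_borel n) (\<lambda>w. grid_incr n (\<lambda>t. X t w)))"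
    using E' f by (intro nn_integral_distr [symmetric] grid_incr_process_measurable n) simp
  finally show ?thesis .
qed

end

lemma brownian_path_process:
  assumes "brownian_motion M B"
  shows "path_process M B"
proof (rule path_process.intro)
  show "AE w in M. B 0 w = 0" using assms unfolding brownian_motion_def by (intro AE_I2) blast
qed (use assms in \<open>unfold brownian_motion_def, blast\<close>)+

lemma stochastic_integral_path_process:
  assumes "brownian_motion M B" "stochastic_integral M B \<sigma> Y"
  shows "path_process M Y"
proof (rule path_process.intro)
  show "prob_space M" using assms(1) unfolding brownian_motion_def by blast
  show "AE w in M. Y 0 w = 0" by (rule stochastic_integral_zero [OF assms])
qed (use assms(2) in \<open>unfold stochastic_integral_def, blast\<close>)+

section \<open>Density and log-density on the grid\<close>

locale volatility_law = volatility a G for a G :: "real \<Rightarrow> real ^ 'l ^ 'l" +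
  fixes M :: "'w measure" and B Y :: "real \<Rightarrow> 'w \<Rightarrow> real ^ 'l"
  assumes B: "brownian_motion M B"
    and Y: "stochastic_integral M B (\<lambda>s. spd_sqrt (G s)) Y"
begin

sublocale B: path_process M B by (rule brownian_path_process [OF B])
sublocale Y: path_process M Y by (rule stochastic_integral_path_process [OF B Y])

abbreviation Qa :: "(real \<Rightarrow> real ^ 'l) measure" where "Qa \<equiv> path_law M Y"
abbreviation BM :: "(real \<Rightarrow> real ^ 'l) measure" where "BM \<equiv> path_law M B"
abbreviation ld :: "nat \<Rightarrow> (real \<Rightarrow> real ^ 'l) \<Rightarrow> real" where
  "ld n \<equiv> log_density (grid_restr n Qa) (grid_restr n BM)"

text \<open>The likelihood ratio of the increments of \<open>Y\<close> against those of
  \<open>B\<close>: in the eigenbasis of each averaged matrix it is a product of one-dimensional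
  ratios.\<close>

definition incr_density :: "nat \<Rightarrow> (nat \<times> 'l \<Rightarrow> real) \<Rightarrow> real" where
  "incr_density n y = (\<Prod>b\<in>gridset n. normal_ratio (sqrt (1 / real n)) (sqrt (eigval n b))
     (rotate_grid n (\<lambda>k. transpose (rotation n k)) y b))"

lemma incr_density_measurable [measurable]:
  "incr_density n \<in> borel_measurable (grid_borel n)"
  unfolding incr_density_def by measurable

lemma incr_density_pos: "0 < n \<Longrightarrow> 0 < incr_density n y"
  unfolding incr_density_def using eigval_pos' by (intro prod_pos normal_ratio_pos) auto

lemma distr_grid_incr_Y:
  assumes n: "0 < n"
  shows "distr M (grid_borel n) (\<lambda>w. grid_incr n (\<lambda>t. Y t w)) = density (driver n) (\<lambda>y. ennreal (incr_density n y))"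
proof -
  have "(\<Prod>b\<in>gridset n. ennreal (normal_ratio (sqrt (1 / real n)) (sqrt (eigval n b)) (rotate_grid n (\<lambda>k. transpose (rotation n k)) y b)))
     = ennreal (incr_density n y)" for y
    unfolding incr_density_def
    by (rule prod_ennreal) (use n eigval_pos' in \<open>auto intro!: less_imp_le normal_ratio_pos\<close>)
  then show ?thesis
    unfolding distr_grid_incr_ito [OF B Y n]
    using distr_rotate_scale_normal_prod [of "sqrt (1 / real n)" "rotation n" "\<lambda>b. sqrt (eigval n b)" n] n eigval_pos' orthogonal_rotation
    by simp
qed

text \<open>At the image of the driver the inverse rotation cancels, and each ratio is evaluated at
  a scaled coordinate, where its logarithm is explicit.\<close>

lemma ln_incr_density:
  assumes n: "0 < n"
  shows "ln (incr_density n (rotate_grid n (rotation n) (scaling n x))) = gauss_log_density n x"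
proof -
  let ?\<sigma> = "sqrt (1 / real n)"
  have \<sigma>: "0 < ?\<sigma>" using n by simp
  have pos: "0 < normal_ratio ?\<sigma> (sqrt (eigval n b)) y" for b y
    using eigval_pos' by (intro normal_ratio_pos [OF \<sigma>]) simp
  have ext: "scaling n x \<in> extensional (gridset n)" by (simp add: scale_grid_def)
  have "ln (incr_density n (rotate_grid n (rotation n) (scaling n x)))
     = ln (\<Prod>b\<in>gridset n. normal_ratio ?\<sigma> (sqrt (eigval n b)) (scaling n x b))"
    unfolding incr_density_def by (simp only: rotate_grid_inverse [OF orthogonal_rotation ext])
  also have "\<dots> = (\<Sum>b\<in>gridset n. ln (normal_ratio ?\<sigma> (sqrt (eigval n b)) (scaling n x b)))"
    by (rule ln_prod) (simp_all add: less_imp_neq [OF pos, symmetric])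
  also have "\<dots> = gauss_log_density n x"
    unfolding gauss_log_density_def
  proof (intro sum.cong refl)
    fix b :: "nat \<times> 'l" assume b: "b \<in> gridset n"
    have "scaling n x b = sqrt (eigval n b) * x b"
      using b by (simp add: scale_grid_def)
    moreover have "0 < sqrt (eigval n b)" using eigval_pos' by simp
    ultimately show "ln (normal_ratio ?\<sigma> (sqrt (eigval n b)) (scaling n x b))
      = ((eigval n b - 1) * (real n * (x b)\<^sup>2) - ln (eigval n b)) / 2"
      using ln_normal_ratio [OF \<sigma>, of "sqrt (eigval n b)" "x b"] n eigval_pos' [of n b] by (simp add: less_imp_le mult_ac)
  qed
  finally show ?thesis .
qed

lemma sets_grid_restr:
  assumes "0 < n"
  shows "sets (grid_restr n Qa) = sets (grid_algebra n)" "sets (grid_restr n BM) = sets (grid_algebra n)"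
  unfolding grid_restr_def
  by (rule sets_restr_to_subalg, rule Y.subalgebra_path_law [OF assms], rule sets_restr_to_subalg, rule B.subalgebra_path_law [OF assms])

text \<open>An event of the grid algebra is tested through its counterpart in increment space. There
  the density is known with respect to \<open>driver n\<close>, which is also the law of the
  Brownian increments, so the integral can be pulled back to paths.\<close>

lemma grid_restr_density:
  assumes n: "0 < n"
  shows "grid_restr n Qa = density (grid_restr n BM) (\<lambda>\<omega>. ennreal (incr_density n (grid_incr n \<omega>)))"
proof (rule measure_eqI)
  show "sets (grid_restr n Qa) = sets (density (grid_restr n BM) (\<lambda>\<omega>. ennreal (incr_density n (grid_incr n \<omega>))))"
    by (simp add: sets_grid_restr [OF n])
  fix E assume "E \<in> sets (grid_restr n Qa)"
  then have E: "E \<in> sets (grid_algebra n)" by (simp add: sets_grid_restr [OF n])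
  obtain E' where E': "E' \<in> sets (grid_borel n)"
    and eq: "\<And>\<omega>. \<omega> \<in> path_space \<Longrightarrow> \<omega> 0 = 0 \<Longrightarrow> (\<omega> \<in> E \<longleftrightarrow> grid_incr n \<omega> \<in> E')"
    using grid_set_factor [OF n E] by blast
  have m: "(\<lambda>\<omega>. ennreal (incr_density n (grid_incr n \<omega>))) \<in> borel_measurable (grid_algebra n)"
    by (rule measurable_compose [OF grid_incr_measurable [OF n]]) measurable
  have "emeasure (grid_restr n Qa) E = (\<integral>\<^sup>+\<omega>. 1 * indicator E \<omega> \<partial>grid_restr n Qa)"
    using E by (simp add: sets_grid_restr [OF n])
  also have "\<dots> = (\<integral>\<^sup>+x. 1 * indicator E' x \<partial>distr M (grid_borel n) (\<lambda>w. grid_incr n (\<lambda>t. Y t w)))"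
    by (rule Y.nn_integral_path_law [OF n E E' eq]) auto
  also have "\<dots> = (\<integral>\<^sup>+x. ennreal (incr_density n x) * indicator E' x \<partial>driver n)"
    unfolding distr_grid_incr_Y [OF n]
    using E' by (subst nn_integral_density) (auto simp: measurable_cong_sets [OF sets_normal_prod refl])
  also have "\<dots> = (\<integral>\<^sup>+x. ennreal (incr_density n x) * indicator E' x \<partial>distr M (grid_borel n) (\<lambda>w. grid_incr n (\<lambda>t. B t w)))"
    by (simp only: distr_grid_incr_brownian [OF B n])
  also have "\<dots> = (\<integral>\<^sup>+\<omega>. ennreal (incr_density n (grid_incr n \<omega>)) * indicator E \<omega> \<partial>grid_restr n BM)"
    by (rule B.nn_integral_path_law [OF n E E' eq, symmetric]) auto
  also have "\<dots> = emeasure (density (grid_restr n BM) (\<lambda>\<omega>. ennreal (incr_density n (grid_incr n \<omega>)))) E"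
    using E m by (intro emeasure_density [symmetric]) (auto simp: sets_grid_restr [OF n] measurable_cong_sets [OF sets_grid_restr(2) [OF n] refl])
  finally show "emeasure (grid_restr n Qa) E = emeasure (density (grid_restr n BM) (\<lambda>\<omega>. ennreal (incr_density n (grid_incr n \<omega>)))) E" .
qed

lemma density_measurable:
  assumes n: "0 < n"
  shows "(\<lambda>\<omega>. ennreal (incr_density n (grid_incr n \<omega>))) \<in> borel_measurable (grid_restr n BM)"
  unfolding measurable_cong_sets [OF sets_grid_restr(2) [OF n] refl]
  by (rule measurable_compose [OF grid_incr_measurable [OF n]]) measurable

lemma abs_cont: "0 < n \<Longrightarrow> absolutely_continuous (grid_restr n BM) (grid_restr n Qa)"
  unfolding grid_restr_density by (rule absolutely_continuousI_density [OF density_measurable])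

lemma ld_measurable:
  assumes n: "0 < n"
  shows "ld n \<in> borel_measurable (grid_algebra n)"
proof -
  have "RN_deriv (grid_restr n BM) (grid_restr n Qa) \<in> borel_measurable (grid_algebra n)"
    using borel_measurable_RN_deriv [of "grid_restr n BM" "grid_restr n Qa"]
    by (simp only: measurable_cong_sets [OF sets_grid_restr(2) [OF n] refl])
  note [measurable] = this
  show ?thesis unfolding log_density_def [abs_def] by measurable
qed

text \<open>Uniqueness of the Radon-Nikodym derivative holds almost everywhere for the Brownian law;
  absolute continuity on the grid algebra carries it over to \<open>Qa\<close>.\<close>

lemma ld_eq:
  assumes n: "0 < n"
  shows "AE \<omega> in Qa. ld n \<omega> = ln (incr_density n (grid_incr n \<omega>))"
proof -
  interpret P: prob_space "grid_restr n BM"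
    unfolding grid_restr_def by (rule prob_space_restr_to_subalg [OF B.subalgebra_path_law [OF n] B.prob_space_path_law])
  have "AE \<omega> in grid_restr n BM. ennreal (incr_density n (grid_incr n \<omega>)) = RN_deriv (grid_restr n BM) (grid_restr n Qa) \<omega>"
    by (rule P.RN_deriv_unique [OF density_measurable [OF n] grid_restr_density [OF n, symmetric]])
  then have "AE \<omega> in grid_restr n BM. ld n \<omega> = ln (incr_density n (grid_incr n \<omega>))"
  proof eventually_elim
    case (elim \<omega>)
    have "0 \<le> incr_density n (grid_incr n \<omega>)" using incr_density_pos [OF n] by (rule less_imp_le)
    then show ?case by (simp add: log_density_def elim [symmetric])
  qed
  then have "AE \<omega> in grid_restr n Qa. ld n \<omega> = ln (incr_density n (grid_incr n \<omega>))"
    by (rule absolutely_continuous_AE [rotated 2]) (simp_all add: sets_grid_restr [OF n] abs_cont [OF n])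
  then show ?thesis unfolding grid_restr_def by (rule AE_restr_to_subalg [OF Y.subalgebra_path_law [OF n]])
qed

lemma ld_measurable_Qa: "0 < n \<Longrightarrow> ld n \<in> borel_measurable Qa"
  by (rule measurable_from_subalg [OF Y.subalgebra_path_law ld_measurable])

lemma gauss_log_density_measurable:
  "gauss_log_density n \<in> borel_measurable (driver n)"
proof -
  have "gauss_log_density n \<in> borel_measurable (grid_borel n)"
    unfolding gauss_log_density_def by measurable
  then show ?thesis by (simp only: measurable_cong_sets [OF sets_normal_prod refl])
qed

text \<open>Under \<open>Qa\<close> the increments are an image of the driver, along which the
  log-density is \<open>gauss_log_density n\<close>. Integrability, means and L1 distances depend
  only on this law and are computed for the Gaussian driver.\<close>

lemma distr_ld:
  assumes n: "0 < n"
  shows "distr Qa borel (ld n) = distr (driver n) borel (gauss_log_density n)"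
proof -
  let ?P = "PiM (gridset n :: (nat \<times> 'l) set) (\<lambda>_. borel :: real measure)"
  let ?h = "\<lambda>y. ln (incr_density n y)"
  let ?T = "\<lambda>x. rotate_grid n (rotation n) (scaling n x)"
  have h: "?h \<in> borel_measurable ?P" by measurable
  have g: "grid_incr n \<in> measurable Qa ?P"
    by (rule measurable_from_subalg [OF Y.subalgebra_path_law [OF n] grid_incr_measurable [OF n]])
  have T: "?T \<in> measurable (driver n) ?P"
    unfolding measurable_cong_sets [OF sets_normal_prod refl] by measurable
  have "distr Qa borel (ld n) = distr Qa borel (\<lambda>\<omega>. ?h (grid_incr n \<omega>))"
    by (rule distr_cong_AE [OF refl refl ld_eq [OF n] ld_measurable_Qa [OF n] measurable_compose [OF g h]])
  also have "\<dots> = distr (distr Qa ?P (grid_incr n)) borel ?h"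
    using distr_distr [OF h g] by (simp add: comp_def)
  also have "distr Qa ?P (grid_incr n) = distr M ?P (\<lambda>w. grid_incr n (\<lambda>t. Y t w))"
  proof -
    have "distr Qa ?P (grid_incr n) = distr M ?P (\<lambda>w. grid_incr n (Y.path w))"
      unfolding path_law_def
      using distr_distr [OF _ Y.path_measurable, of "grid_incr n" ?P] g by (simp add: comp_def path_law_def)
    then show ?thesis by (simp only: Y.grid_incr_path [OF n])
  qed
  also have "\<dots> = distr (driver n) ?P ?T" by (rule distr_grid_incr_ito [OF B Y n])
  also have "distr (distr (driver n) ?P ?T) borel ?h = distr (driver n) borel (\<lambda>x. ?h (?T x))"
    using distr_distr [OF h T] by (simp add: comp_def)
  also have "\<dots> = distr (driver n) borel (gauss_log_density n)"
    by (simp only: ln_incr_density [OF n])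
  finally show ?thesis .
qed

lemma ld_integrable: "0 < n \<Longrightarrow> integrable Qa (ld n)"
  and ld_integral: "0 < n \<Longrightarrow> (\<integral>\<omega>. ld n \<omega> \<partial>Qa) = real n * mean_entropy n / 2"
proof -
  assume n: "0 < n"
  have "integrable (distr (driver n) borel (gauss_log_density n)) (\<lambda>x. x)"
    by (subst integrable_distr_eq) (use gauss_log_density_measurable gauss_log_density_integral(1) [OF n] in auto)
  then have "integrable (distr Qa borel (ld n)) (\<lambda>x. x)" by (simp only: distr_ld [OF n])
  then show "integrable Qa (ld n)"
    by (subst (asm) integrable_distr_eq) (use ld_measurable_Qa [OF n] in auto)
  have "(\<integral>\<omega>. ld n \<omega> \<partial>Qa) = (\<integral>x. x \<partial>distr Qa borel (ld n))"
    using ld_measurable_Qa [OF n] by (subst integral_distr) auto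
  also have "\<dots> = (\<integral>x. gauss_log_density n x \<partial>driver n)"
    unfolding distr_ld [OF n] using gauss_log_density_measurable by (subst integral_distr) auto
  finally show "(\<integral>\<omega>. ld n \<omega> \<partial>Qa) = real n * mean_entropy n / 2"
    by (simp only: gauss_log_density_integral(2) [OF n])
qed

lemma ext_integral_integrable:
  assumes "integrable N f"
  shows "ext_integral N f = ereal (\<integral>x. f x \<partial>N)"
proof -
  have fin: "(\<integral>\<^sup>+x. ennreal (f x) \<partial>N) \<noteq> \<infinity>" "(\<integral>\<^sup>+x. ennreal (- f x) \<partial>N) \<noteq> \<infinity>"
    using assms by (simp_all add: real_integrable_def)
  obtain r where r: "0 \<le> r" "(\<integral>\<^sup>+x. ennreal (f x) \<partial>N) = ennreal r"
    using fin(1) by (cases "\<integral>\<^sup>+x. ennreal (f x) \<partial>N") auto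
  obtain q where q: "0 \<le> q" "(\<integral>\<^sup>+x. ennreal (- f x) \<partial>N) = ennreal q"
    using fin(2) by (cases "\<integral>\<^sup>+x. ennreal (- f x) \<partial>N") auto
  show ?thesis
    unfolding ext_integral_def real_lebesgue_integral_def [OF assms] r(2) q(2)
    using r(1) q(1) by (simp add: enn2ereal_ennreal)
qed

lemma rel_entropy_grid:
  assumes n: "0 < n"
  shows "rel_entropy (grid_restr n Qa) (grid_restr n BM) = ereal (real n * mean_entropy n / 2)"
proof -
  have "ext_integral (grid_restr n Qa) (ld n) = ext_integral Qa (ld n)"
    unfolding ext_integral_def grid_restr_def
    using ld_measurable [OF n] unfolding grid_restr_def
    by (subst (1 2) nn_integral_subalgebra2 [OF Y.subalgebra_path_law [OF n]]) auto
  also have "\<dots> = ereal (real n * mean_entropy n / 2)"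
    by (simp only: ext_integral_integrable [OF ld_integrable [OF n]] ld_integral [OF n])
  finally show ?thesis by (simp add: rel_entropy_def abs_cont [OF n])
qed

section \<open>Limits of the normalised entropies\<close>

lemma ext_integral_entropy: "ext_integral L (\<lambda>s. spd_entropy (G s)) = enn2ereal J"
proof -
  have "(\<integral>\<^sup>+s. ennreal (- spd_entropy (G s)) \<partial>L) = (\<integral>\<^sup>+s. 0 \<partial>L)"
    using spd_entropy_nonneg [OF G_spd] by (intro nn_integral_cong) (simp add: ennreal_neg)
  then show ?thesis by (simp add: ext_integral_def J_def zero_ennreal.rep_eq)
qed

lemma mean_entropy_tendsto: "(\<lambda>n. ennreal (mean_entropy n)) \<longlonglongrightarrow> J"
proof (rule Liminf_eq_Limsup)
  have "limsup (\<lambda>n. ennreal (mean_entropy n)) \<le> J"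
    by (rule Limsup_bounded) (simp add: mean_entropy_le)
  moreover have "liminf (\<lambda>n. ennreal (mean_entropy n)) \<le> limsup (\<lambda>n. ennreal (mean_entropy n))"
    by (rule Liminf_le_Limsup) simp
  ultimately show "liminf (\<lambda>n. ennreal (mean_entropy n)) = J" "limsup (\<lambda>n. ennreal (mean_entropy n)) = J"
    using J_le_liminf by order+
qed simp

definition rate :: ereal where "rate = ereal (1/2) * enn2ereal J"

lemma half_mean_entropy: "ereal (mean_entropy n / 2) = ereal (1/2) * enn2ereal (ennreal (mean_entropy n))"
  by (simp add: enn2ereal_ennreal mean_entropy_nonneg)

lemma half_mean_entropy_tendsto: "(\<lambda>n. ereal (mean_entropy n / 2)) \<longlonglongrightarrow> rate"
  unfolding half_mean_entropy rate_def
  by (intro tendsto_cmult_ereal tendsto_enn2erealI mean_entropy_tendsto) simp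

lemma half_mean_entropy_le: "ereal (mean_entropy n / 2) \<le> rate"
  unfolding half_mean_entropy rate_def using mean_entropy_le [of n]
  by (intro ereal_mult_left_mono) (simp_all add: less_eq_ennreal.rep_eq)

lemma scaled_rel_entropy:
  assumes n: "0 < n"
  shows "ereal (1 / real n) * rel_entropy (grid_restr n Qa) (grid_restr n BM) = ereal (mean_entropy n / 2)"
  using n by (simp add: rel_entropy_grid)

lemma specific_eq: "specific_rel_entropy Qa BM = rate"
proof -
  have "strict_mono (\<lambda>n. 2 ^ n :: nat)" by (rule strict_monoI) simp
  from LIMSEQ_subseq_LIMSEQ [OF half_mean_entropy_tendsto this]
  have "(\<lambda>n. ereal (mean_entropy (2 ^ n) / 2)) \<longlonglongrightarrow> rate" by (simp add: comp_def)
  then have "liminf (\<lambda>n. ereal (mean_entropy (2 ^ n) / 2)) = rate"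
    by (intro lim_imp_Liminf) simp_all
  moreover have "ereal (1 / 2 ^ n) * rel_entropy (grid_restr (2 ^ n) Qa) (grid_restr (2 ^ n) BM) = ereal (mean_entropy (2 ^ n) / 2)" for n
    using scaled_rel_entropy [of "2 ^ n"] by simp
  ultimately show ?thesis by (simp add: specific_rel_entropy_def)
qed

text \<open>The grids are not nested, so the terms need not increase; but each is below
  \<open>rate\<close> by Jensen's inequality and they converge to it, so the supremum is the
  limit.\<close>

lemma rate_eq_SUP: "rate = (SUP n\<in>{1..}. ereal (1 / real n) * rel_entropy (grid_restr n Qa) (grid_restr n BM))"
proof -
  have "(SUP n\<in>{1..}. ereal (1 / real n) * rel_entropy (grid_restr n Qa) (grid_restr n BM)) = (SUP n\<in>{1..}. ereal (mean_entropy n / 2))"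
    by (intro SUP_cong refl scaled_rel_entropy) simp
  also have "\<dots> = rate"
  proof (rule antisym)
    show "(SUP n\<in>{1..}. ereal (mean_entropy n / 2)) \<le> rate" by (intro SUP_least half_mean_entropy_le)
    show "rate \<le> (SUP n\<in>{1..}. ereal (mean_entropy n / 2))"
    proof (rule LIMSEQ_le_const2 [OF half_mean_entropy_tendsto], intro exI allI impI)
      fix n :: nat assume "1 \<le> n"
      then show "ereal (mean_entropy n / 2) \<le> (SUP n\<in>{1..}. ereal (mean_entropy n / 2))"
        by (intro SUP_upper) simp
    qed
  qed
  finally show ?thesis by simp
qed

lemma rate_nonneg: "0 \<le> rate"
  unfolding rate_def by simp

context
  assumes finite_rate: "rate < \<infinity>"
begin

lemma J_finite: "J < \<infinity>"
  using finite_rate unfolding rate_def by (cases J) (auto simp: enn2ereal_ennreal)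

lemma entropy_integrable: "integrable L (\<lambda>s. spd_entropy (G s))"
proof (rule integrableI_bounded [OF G_entropy_measurable])
  have "(\<integral>\<^sup>+s. ennreal (norm (spd_entropy (G s))) \<partial>L) = J"
    unfolding J_def using spd_entropy_nonneg [OF G_spd] by (intro nn_integral_cong) simp
  then show "(\<integral>\<^sup>+s. ennreal (norm (spd_entropy (G s))) \<partial>L) < \<infinity>" using J_finite by simp
qed

lemma mean_entropy_tendsto_real: "mean_entropy \<longlonglongrightarrow> (LINT s|L. spd_entropy (G s))"
proof -
  have "J = ennreal (LINT s|L. spd_entropy (G s))"
    unfolding J_def by (rule nn_integral_eq_integral [OF entropy_integrable]) (use spd_entropy_nonneg [OF G_spd] in auto)
  moreover have "0 \<le> (LINT s|L. spd_entropy (G s))"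
    using spd_entropy_nonneg [OF G_spd] by (intro integral_nonneg_AE) auto
  ultimately show ?thesis
    using mean_entropy_tendsto mean_entropy_nonneg by (simp add: tendsto_ennreal_iff)
qed

text \<open>The error splits into the random fluctuation around the mean on the grid and the
  deterministic distance of that mean from its limit; the second part is where finiteness of
  \<open>rate\<close> is used.\<close>

lemma ld_L1_tendsto:
  "(\<lambda>n. LINT \<omega>|Qa. \<bar>1 / real n * ld n \<omega> - 1/2 * (LINT s|L. spd_entropy (G s))\<bar>) \<longlonglongrightarrow> 0"
proof (rule tendsto_sandwich [where f = "\<lambda>_. 0"])
  let ?j = "LINT s|L. spd_entropy (G s)"
  let ?e = "\<lambda>n. (\<integral>x. \<bar>gauss_log_density n x / real n - mean_entropy n / 2\<bar> \<partial>driver n) + \<bar>mean_entropy n / 2 - ?j / 2\<bar>"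
  show "eventually (\<lambda>n. (LINT \<omega>|Qa. \<bar>1 / real n * ld n \<omega> - 1/2 * ?j\<bar>) \<le> ?e n) sequentially"
    using eventually_gt_at_top [of 0]
  proof eventually_elim
    case (elim n)
    then have n: "0 < n" .
    interpret D: prob_space "driver n" by (rule prob_space_normal_prod) (use n in simp)
    have gi: "integrable (driver n) (\<lambda>x. gauss_log_density n x / real n)"
      using gauss_log_density_integral(1) [OF n] by simp
    have "(LINT \<omega>|Qa. \<bar>1 / real n * ld n \<omega> - 1/2 * ?j\<bar>) = (LINT y|distr Qa borel (ld n). \<bar>1 / real n * y - 1/2 * ?j\<bar>)"
      using ld_measurable_Qa [OF n] by (subst integral_distr) auto
    also have "\<dots> = (\<integral>x. \<bar>gauss_log_density n x / real n - ?j / 2\<bar> \<partial>driver n)"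
      unfolding distr_ld [OF n] using gauss_log_density_measurable by (subst integral_distr) auto
    also have "\<dots> \<le> (\<integral>x. \<bar>gauss_log_density n x / real n - mean_entropy n / 2\<bar> + \<bar>mean_entropy n / 2 - ?j / 2\<bar> \<partial>driver n)"
      using gi by (intro integral_mono) auto
    also have "\<dots> = ?e n" using gi D.prob_space by simp
    finally show ?case .
  qed
  have "?e \<longlonglongrightarrow> 0 + \<bar>?j / 2 - ?j / 2\<bar>"
    by (intro tendsto_add tendsto_rabs tendsto_diff tendsto_divide tendsto_const gauss_log_density_L1_tendsto mean_entropy_tendsto_real) simp
  then show "?e \<longlonglongrightarrow> 0" by simp
qed auto

end

end

theorem proposition2p3:
  fixes a G :: "real \<Rightarrow> real ^ 'l ^ 'l"
    and M :: "'w measure"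
    and B Y :: "real \<Rightarrow> 'w \<Rightarrow> real ^ 'l"
  assumes G_measurable: "G \<in> borel_measurable (lebesgue_on {0..1})"
    and G_spd: "\<And>s. s \<in> {0..1} \<Longrightarrow> spd (G s)"
    and G_finite: "\<And>i. (\<integral>\<^sup>+ s. ennreal (G s $ i $ i) \<partial>lebesgue_on {0..1}) < \<infinity>"
    and a_integral: "\<And>t. t \<in> {0..1} \<Longrightarrow> a t = (LINT s|lebesgue_on {0..t}. G s)"
    and a_deriv: "AE t in lebesgue_on {0..1}. (a has_vector_derivative G t) (at t within {0..1})"
    and B: "brownian_motion M B"
    and Y: "stochastic_integral M B (\<lambda>s. spd_sqrt (G s)) Y"
  shows
    "let Qa = path_law M Y;
         BM = path_law M B;
         f = (\<lambda>s. trace (G s) - real CARD('l) - ln (det (G s)));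
         I = ereal (1/2) * ext_integral (lebesgue_on {0..1}) f;
         Z = (\<lambda>n \<omega>. 1 / real n * log_density (grid_restr n Qa) (grid_restr n BM) \<omega>)
     in specific_rel_entropy Qa BM = I \<and>
        I = (SUP n\<in>{1..}. ereal (1 / real n) * rel_entropy (grid_restr n Qa) (grid_restr n BM)) \<and>
        0 \<le> I \<and>
        (I < \<infinity> \<longrightarrow>
           integrable (lebesgue_on {0..1}) f \<and>
           (\<forall>n\<ge>1. integrable Qa (Z n)) \<and>
           (\<lambda>n. LINT \<omega>|Qa. \<bar>Z n \<omega> - 1/2 * (LINT s|lebesgue_on {0..1}. f s)\<bar>) \<longlonglongrightarrow> 0)"
proof -
  interpret volatility_law a G M B Y
    by unfold_locales (fact assms)+
  have f: "(\<lambda>s. trace (G s) - real CARD('l) - ln (det (G s))) = (\<lambda>s. spd_entropy (G s))"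
    by (simp add: spd_entropy_def)
  have I: "ereal (1/2) * ext_integral L (\<lambda>s. spd_entropy (G s)) = rate"
    by (simp only: ext_integral_entropy rate_def)
  show ?thesis
    unfolding Let_def f I
    using specific_eq rate_eq_SUP rate_nonneg entropy_integrable ld_integrable ld_L1_tendsto by auto
qed

end
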